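(* Let $X$ be a finite-dimensional real Hilbert space, $T>0$, and let $\mathcal E:[0,T]\times X\to[0,+\infty)$, $(t,u)\mapsto\mathcal E_t(u)$, satisfy: (i) $\mathcal E\in C^1([0,T]\times X)$; (ii) for every $\rho>0$ the set $\{u\in X:\ \sup_{t\in[0,T]}|\mathcal E_t(u)|\le\rho\}$ is bounded; (iii) there exist $C_1,C_2>0$ such that $|\partial_t\mathcal E_t(u)|\le C_1\mathcal E_t(u)+C_2$ for all $(t,u)\in[0,T]\times X$; (iv) for every $t\in[0,T]$ the set $\mathcal C(t)=\{u\in X: D\mathcal E_t(u)=0\}$ consists of isolated points. Let $(\varepsilon_n)_n\subset(0,+\infty)$ with $\varepsilon_n\to0$, let $(u^0_{\varepsilon_n})_n\subset X$ satisfy $u^0_{\varepsilon_n}\to u_0$ in $X$ as $n\to\infty$, and for each $n$ let $u_{\varepsilon_n}\in H^1(0,T;X)$ be a solution of $$\varepsilon_n u_{\varepsilon_n}'(t)+D\mathcal E_t(u_{\varepsilon_n}(t))=0\ \text{ in }X\ \text{ for a.a. }t\in[0,T],\qquad u_{\varepsilon_n}(0)=u^0_{\varepsilon_n}.$$ Then there exist a (not relabeled) subsequence and a curve $u:[0,T]\to X$, measurable, bounded and everywhere defined, such that: (1) $u_{\varepsilon_n}(t)\to u(t)$ for all $t\in[0,T]$; $u_{\varepsilon_n}\rightharpoonup^* u$ in $L^\infty(0,T;X)$; and $u_{\varepsilon_n}\to u$ in $L^p(0,T;X)$ for all $1\le p<\infty$; (2) $u(0)=u_0$ and $u$ is a Dissipative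 Viscosity solution of $D\mathcal E_t(u(t))=0$, $t\in[0,T]$.
   Context: $D\mathcal E_t(u)$ is the differential of $\mathcal E$ with respect to $u$ (identified with an element of $X$), and $\mathcal C(t)=\{u\in X: D\mathcal E_t(u)=0\}$. Admissible curves. For $t\in[0,T]$ and $u_1\ne u_2$ in $X$, $\mathscr A^t_{u_1,u_2}$ is the set of $\vartheta\in C([0,1];X)$ with $\vartheta(0)=u_1$, $\vartheta(1)=u_2$ for which there is a partition $0=\mathsf t_0<\mathsf t_1<\dots<\mathsf t_j=1$ such that $\vartheta|_{(\mathsf t_i,\mathsf t_{i+1})}$ is locally Lipschitz for all $i=0,\dots,j-1$; $\vartheta(\mathsf t_i)\in\mathcal C(t)$ for $i=1,\dots,j-1$; and $\vartheta(r)\notin\mathcal C(t)$ for all $r\in(\mathsf t_i,\mathsf t_{i+1})$, $i=0,\dots,j-1$. Energy-dissipation cost. $\mathsf c_t(u_1;u_2):=\inf\{\int_0^1\|D\mathcal E_t(\vartheta(s))\|\,\|\vartheta'(s)\|\,ds:\ \vartheta\in\mathscr A^t_{u_1,u_2}\}$ if $u_1\neq u_2$, and $\mathsf c_t(u_1;u_2):=0$ if $u_1=u_2$. Dissipative Viscosity solution. A measurable, bounded, everywhere defined $u:[0,T]\to X$ such that: (1) the left limits $u_-(s)=\lim_{\tau\uparrow s}u(\tau)$, $0<s\le T$, and right limits $u_+(t)=\lim_{\tau\downarrow t}u(\tau)$, $0\le t<T$, exist, and there is a positive Radon measure $\mu$ on $[0,T]$ (the defect measure), whose set of atoms $J$ is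 countable, such that, with the conventions $u_-(0):=u(0)$, $u_+(T):=u(T)$, $$\mu([s,t])+\mathcal E_t(u_+(t))=\mathcal E_s(u_-(s))+\int_s^t\partial_t\mathcal E_r(u(r))\,dr\quad\text{for all }0\le s\le t\le T;$$ (2) $u$ is continuous on $[0,T]\setminus J$ and $u(t)\in\mathcal C(t)$ for all $t\in(0,T]\setminus J$; (3) $u_-(s)\in\mathcal C(s)$ for all $0<s\le T$ and $u_+(t)\in\mathcal C(t)$ for all $0\le t<T$; $J=\{t\in[0,T]:u_-(t)\ne u_+(t)\}$; and $0<\mathsf c_t(u_-(t);u_+(t))=\mu(\{t\})=\mathcal E_t(u_-(t))-\mathcal E_t(u_+(t))$ for every $t\in J$. *)

theory Defs
  imports "HOL-Analysis.Analysis"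
begin

section \<open>The energy functional\<close>

text \<open>
  An energy on \<open>[0,T] \<times> X\<close> is a total function \<open>E :: real \<Rightarrow> 'a \<Rightarrow> real\<close>; only its values for
  \<open>t \<in> {0..T}\<close> matter. Accordingly all derivatives involving the time variable are taken within
  \<open>{0..T}\<close>, hence are one-sided at the endpoints.
\<close>

definition C1_energy :: "real \<Rightarrow> (real \<Rightarrow> 'a::euclidean_space \<Rightarrow> real) \<Rightarrow> bool" where
  "C1_energy T E \<longleftrightarrow>
     (\<exists>D :: real \<times> 'a \<Rightarrow> (real \<times> 'a) \<Rightarrow>\<^sub>L real.
        (\<forall>p \<in> {0..T} \<times> UNIV.
           ((\<lambda>(t, u). E t u) has_derivative blinfun_apply (D p)) (at p within {0..T} \<times> UNIV)) \<and>
        continuous_on ({0..T} \<times> UNIV) D)"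

definition grad :: "('a::euclidean_space \<Rightarrow> real) \<Rightarrow> 'a \<Rightarrow> 'a" where
  "grad f u = (THE g. GDERIV f u :> g)"

lemma grad_eqI:
  assumes "GDERIV f u :> g"
  shows "grad f u = g"
  unfolding grad_def
proof (rule the_equality[where P = "\<lambda>g. GDERIV f u :> g"])
  show "GDERIV f u :> g" by (rule assms)
next
  fix h assume "GDERIV f u :> h"
  with assms have "(\<lambda>x. inner x g) = (\<lambda>x. inner x h)"
    unfolding gderiv_def by (rule has_derivative_unique)
  then have "inner x h = inner x g" for x
    by metis
  then show "h = g"
    by (metis vector_eq_ldot)
qed

definition time_deriv :: "real \<Rightarrow> (real \<Rightarrow> 'a \<Rightarrow> real) \<Rightarrow> real \<Rightarrow> 'a \<Rightarrow> real" where
  "time_deriv T E t u = vector_derivative (\<lambda>s. E s u) (at t within {0..T})"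

definition crit :: "(real \<Rightarrow> 'a::euclidean_space \<Rightarrow> real) \<Rightarrow> real \<Rightarrow> 'a set" where
  "crit E t = {u. grad (E t) u = 0}"


section \<open>Lebesgue-Bochner and Sobolev spaces on \<open>(0,T)\<close>\<close>

definition mem_Lp :: "real \<Rightarrow> real \<Rightarrow> (real \<Rightarrow> 'a::euclidean_space) \<Rightarrow> bool" where
  "mem_Lp p T f \<longleftrightarrow>
     f \<in> borel_measurable (lebesgue_on {0..T}) \<and>
     integrable (lebesgue_on {0..T}) (\<lambda>t. norm (f t) powr p)"

definition mem_Linf :: "real \<Rightarrow> (real \<Rightarrow> 'a::euclidean_space) \<Rightarrow> bool" where
  "mem_Linf T f \<longleftrightarrow>
     f \<in> borel_measurable (lebesgue_on {0..T}) \<and>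
     (\<exists>C. AE t in lebesgue_on {0..T}. norm (f t) \<le> C)"

definition tendsto_Lp ::
    "real \<Rightarrow> real \<Rightarrow> (nat \<Rightarrow> real \<Rightarrow> 'a::euclidean_space) \<Rightarrow> (real \<Rightarrow> 'a) \<Rightarrow> bool" where
  "tendsto_Lp p T f g \<longleftrightarrow>
     (\<forall>n. mem_Lp p T (f n)) \<and> mem_Lp p T g \<and>
     (\<lambda>n. LINT t|lebesgue_on {0..T}. norm (f n t - g t) powr p) \<longlonglongrightarrow> 0"

text \<open>Weak-star convergence refers to the duality between \<open>L\<^sup>\<infinity>(0,T;X)\<close> and \<open>L\<^sup>1(0,T;X)\<close>.\<close>

definition weak_star_tendsto_Linf ::
    "real \<Rightarrow> (nat \<Rightarrow> real \<Rightarrow> 'a::euclidean_space) \<Rightarrow> (real \<Rightarrow> 'a) \<Rightarrow> bool" where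
  "weak_star_tendsto_Linf T f g \<longleftrightarrow>
     (\<forall>n. mem_Linf T (f n)) \<and> mem_Linf T g \<and>
     (\<forall>\<phi>. mem_Lp 1 T \<phi> \<longrightarrow>
        (\<lambda>n. LINT t|lebesgue_on {0..T}. \<phi> t \<bullet> f n t)
          \<longlonglongrightarrow> (LINT t|lebesgue_on {0..T}. \<phi> t \<bullet> g t))"

text \<open>
  \<open>H1_with_deriv T u v\<close>: \<open>u\<close> is (the continuous representative of) an element of
  \<open>H\<^sup>1(0,T;X)\<close> and \<open>v\<close> is its weak derivative, tested against functions in \<open>C\<^sub>c\<^sup>1(0,T)\<close>.
\<close>

definition H1_with_deriv ::
    "real \<Rightarrow> (real \<Rightarrow> 'a::euclidean_space) \<Rightarrow> (real \<Rightarrow> 'a) \<Rightarrow> bool" where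
  "H1_with_deriv T u v \<longleftrightarrow>
     continuous_on {0..T} u \<and> mem_Lp 2 T u \<and> mem_Lp 2 T v \<and>
     (\<forall>\<phi> :: real \<Rightarrow> real.
        \<phi> C1_differentiable_on UNIV \<and> closure {t. \<phi> t \<noteq> 0} \<subseteq> {0<..<T} \<longrightarrow>
        (LINT t|lebesgue_on {0..T}. deriv \<phi> t *\<^sub>R u t)
          = - (LINT t|lebesgue_on {0..T}. \<phi> t *\<^sub>R v t))"

definition viscous_solution ::
    "real \<Rightarrow> (real \<Rightarrow> 'a::euclidean_space \<Rightarrow> real) \<Rightarrow> real \<Rightarrow> 'a \<Rightarrow> (real \<Rightarrow> 'a) \<Rightarrow> bool" where
  "viscous_solution T E \<epsilon> x u \<longleftrightarrow>
     (\<exists>v. H1_with_deriv T u v \<and>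
          (AE t in lebesgue_on {0..T}. \<epsilon> *\<^sub>R v t + grad (E t) (u t) = 0)) \<and>
     u 0 = x"


section \<open>Admissible curves and the energy-dissipation cost\<close>

definition locally_lipschitz_on :: "real set \<Rightarrow> (real \<Rightarrow> 'a::metric_space) \<Rightarrow> bool" where
  "locally_lipschitz_on S f \<longleftrightarrow>
     (\<forall>x\<in>S. \<exists>e>0. \<exists>L. lipschitz_on L (ball x e \<inter> S) f)"

definition admissible ::
    "(real \<Rightarrow> 'a::euclidean_space \<Rightarrow> real) \<Rightarrow> real \<Rightarrow> 'a \<Rightarrow> 'a \<Rightarrow> (real \<Rightarrow> 'a) set" where
  "admissible E t u1 u2 =
     {\<theta>. continuous_on {0..1} \<theta> \<and> \<theta> 0 = u1 \<and> \<theta> 1 = u2 \<and>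
         (\<exists>(j::nat) (\<tau> :: nat \<Rightarrow> real).
            \<tau> 0 = 0 \<and> \<tau> j = 1 \<and> (\<forall>i<j. \<tau> i < \<tau> (Suc i)) \<and>
            (\<forall>i<j. locally_lipschitz_on {\<tau> i<..<\<tau> (Suc i)} \<theta>) \<and>
            (\<forall>i\<in>{0<..<j}. \<theta> (\<tau> i) \<in> crit E t) \<and>
            (\<forall>i<j. \<forall>r\<in>{\<tau> i<..<\<tau> (Suc i)}. \<theta> r \<notin> crit E t))}"

text \<open>
  The cost is valued in \<open>ennreal\<close>: the infimum over an empty class of curves is \<open>\<infinity>\<close>, and the
  dissipation integral of a curve may diverge. An admissible curve is differentiable almost
  everywhere, so the value of \<open>vector_derivative\<close> elsewhere is irrelevant.
\<close>

definition cost ::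
    "(real \<Rightarrow> 'a::euclidean_space \<Rightarrow> real) \<Rightarrow> real \<Rightarrow> 'a \<Rightarrow> 'a \<Rightarrow> ennreal" where
  "cost E t u1 u2 =
     (if u1 = u2 then 0
      else (INF \<theta> \<in> admissible E t u1 u2.
              (\<integral>\<^sup>+s. ennreal (norm (grad (E t) (\<theta> s)) * norm (vector_derivative \<theta> (at s)))
                 \<partial>lebesgue_on {0..1})))"


section \<open>Dissipative Viscosity solutions\<close>

definition left_lim :: "(real \<Rightarrow> 'a::t2_space) \<Rightarrow> real \<Rightarrow> 'a" where
  "left_lim u s = (if s = 0 then u 0 else Lim (at_left s) u)"

definition right_lim :: "real \<Rightarrow> (real \<Rightarrow> 'a::t2_space) \<Rightarrow> real \<Rightarrow> 'a" where
  "right_lim T u t = (if t = T then u T else Lim (at_right t) u)"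

text \<open>On the compact interval \<open>[0,T]\<close> the positive Radon measures are the finite Borel measures.\<close>

definition DV_solution_with ::
    "real \<Rightarrow> (real \<Rightarrow> 'a::euclidean_space \<Rightarrow> real) \<Rightarrow> (real \<Rightarrow> 'a) \<Rightarrow> real measure \<Rightarrow> bool" where
  "DV_solution_with T E u \<mu> \<longleftrightarrow>
     (let J = {t \<in> {0..T}. measure \<mu> {t} > 0} in
        u \<in> borel_measurable (lebesgue_on {0..T}) \<and>
        bounded (u ` {0..T}) \<and>
        (\<forall>s\<in>{0<..T}. \<exists>l. (u \<longlongrightarrow> l) (at_left s)) \<and>
        (\<forall>t\<in>{0..<T}. \<exists>l. (u \<longlongrightarrow> l) (at_right t)) \<and>
        sets \<mu> = sets (restrict_space borel {0..T}) \<and> finite_measure \<mu> \<and>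
        countable J \<and>
        (\<forall>s t. 0 \<le> s \<and> s \<le> t \<and> t \<le> T \<longrightarrow>
           measure \<mu> {s..t} + E t (right_lim T u t)
             = E s (left_lim u s) + (LINT r|lebesgue_on {s..t}. time_deriv T E r (u r))) \<and>
        (\<forall>t\<in>{0..T} - J. continuous (at t within {0..T}) u) \<and>
        (\<forall>t\<in>{0<..T} - J. u t \<in> crit E t) \<and>
        (\<forall>s\<in>{0<..T}. left_lim u s \<in> crit E s) \<and>
        (\<forall>t\<in>{0..<T}. right_lim T u t \<in> crit E t) \<and>
        J = {t \<in> {0..T}. left_lim u t \<noteq> right_lim T u t} \<and>
        (\<forall>t\<in>J. 0 < cost E t (left_lim u t) (right_lim T u t) \<and>
                cost E t (left_lim u t) (right_lim T u t) = emeasure \<mu> {t} \<and>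
                measure \<mu> {t} = E t (left_lim u t) - E t (right_lim T u t)))"

definition DV_solution ::
    "real \<Rightarrow> (real \<Rightarrow> 'a::euclidean_space \<Rightarrow> real) \<Rightarrow> (real \<Rightarrow> 'a) \<Rightarrow> bool" where
  "DV_solution T E u \<longleftrightarrow> (\<exists>\<mu>. DV_solution_with T E u \<mu>)"

end

theory Submission
  imports Defs "HOL-Probability.Helly_Selection"
begin

text \<open>
  Multiplying the equation by \<open>u'\<close> gives the energy balance
  \<open>E\<^sub>t(u(t)) + D(t) = E\<^sub>0(u(0)) + \<integral>\<^sub>0\<^sup>t \<partial>\<^sub>t E\<close> with \<open>D(t) = \<integral>\<^sub>0\<^sup>t \<parallel>DE\<parallel> \<parallel>u'\<parallel>\<close>, so by Gronwall and
  coercivity the trajectories stay in a fixed ball and the increasing functions \<open>D\<close> are bounded. Helly's theorem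
  yields a limit \<open>F\<close> of \<open>D\<close> along a subsequence. Since critical points are isolated, a trajectory
  that leaves a small ball crosses an annulus free of critical points and dissipates a definite amount; hence small
  increments of \<open>F\<close> force small oscillation, which gives pointwise convergence, one-sided limits, and
  continuity at the continuity points of \<open>F\<close>. The defect measure is the Stieltjes measure of \<open>F\<close>; the
  one-sided limits are critical because \<open>\<integral> \<parallel>DE\<parallel>\<^sup>2 = \<epsilon> D\<close> tends to zero.

  At a jump the cost is at least the energy drop by the chain rule along admissible curves. Conversely
  the viscous trajectories near the jump, with segments through critical points in place of the
  portions close to them, are admissible and have nearly that dissipation.
\<close>

section \<open>Lipschitz functions of one real variable\<close>

text \<open>No variation bound for the trajectories uniform in the viscosity is available: only the
  dissipation is controlled, and it degenerates at critical points. Hence compactness is extracted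
  from the scalar monotone functions \<open>D n\<close>, and closeness of trajectory values at two
  times is deduced from the increment of \<open>D n\<close> between them. In the limit the energy
  balances from the left and from the right show that the jump of \<open>F\<close> at
  \<open>t\<close> is exactly the energy drop there; therefore the chain drop \<le> cost \<le> jump
  of \<open>F\<close> closes to equalities. The upper bound meets two obstacles. A trajectory
  dissipates through \<open>grad (E s)\<close> with \<open>s\<close> moving, the cost through
  \<open>grad (E t)\<close>, and the two are comparable up to a factor near one only where the
  gradient is bounded below. Moreover a curve is admissible only if it meets critical points at
  finitely many times. Cutting out small balls around the critical points answers both: the number
  of balls depends neither on the viscosity nor on the radius, so the inserted radii cost a multiple
  of the radius.\<close>

lemma emeasure_interval_measure_Ioo:
  assumes m: "\<And>x y. x \<le> y \<Longrightarrow> F x \<le> F y" and c: "continuous_on UNIV F" and ab: "a \<le> b"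
  shows "emeasure (interval_measure F) {a<..<b} = F b - F a"
proof -
  have i: "emeasure (interval_measure F) {x..y} = F y - F x" if "x \<le> y" for x y
    by (rule emeasure_interval_measure_Icc[OF that m]) (use c in auto)
  have o: "emeasure (interval_measure F) {a<..b} = F b - F a"
    by (rule emeasure_interval_measure_Ioc[OF ab m])
      (use c in \<open>auto simp: continuous_on_eq_continuous_at intro: continuous_at_imp_continuous_at_within\<close>)
  show ?thesis
  proof (cases "a = b")
    case False
    then have "a < b" using ab by simp
    have z: "emeasure (interval_measure F) {b} = 0" using i[of b b] by simp
    have "{a<..b} = {a<..<b} \<union> {b}" using \<open>a < b\<close> by auto
    then have "emeasure (interval_measure F) {a<..b} = emeasure (interval_measure F) {a<..<b} + emeasure (interval_measure F) {b}"
      by (simp only:) (rule plus_emeasure[symmetric], auto)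
    then show ?thesis using o z by simp
  qed simp
qed

text \<open>Lebesgue measure is the sum of the Stieltjes measures of \<open>F\<close> and of
  \<open>H = id - F\<close>, both increasing by the two hypotheses; a Lebesgue null set is therefore
  null for each summand.\<close>

lemma interval_measure_abs_cont:
  fixes F :: "real \<Rightarrow> real"
  assumes m: "\<And>x y. x \<le> y \<Longrightarrow> F x \<le> F y" and m2: "\<And>x y. x \<le> y \<Longrightarrow> F y - F x \<le> y - x"
  shows "absolutely_continuous lborel (interval_measure F)"
proof -
  have lipF: "1-lipschitz_on UNIV F"
  proof (rule lipschitz_onI)
    fix x y show "dist (F x) (F y) \<le> 1 * dist x y"
      using m[of x y] m[of y x] m2[of x y] m2[of y x] by (cases "x \<le> y") (auto simp: dist_real_def)
  qed simp
  then have cF: "continuous_on UNIV F" by (rule lipschitz_on_continuous_on)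
  define H where "H x = x - F x" for x
  have cH: "continuous_on UNIV H" unfolding H_def by (intro continuous_intros cF)
  have mH: "H x \<le> H y" if "x \<le> y" for x y using m2[OF that] by (simp add: H_def)
  let ?A = "interval_measure F" and ?B = "interval_measure H"
  define N where "N = measure_of UNIV (sets borel) (\<lambda>A. emeasure ?A A + emeasure ?B A)"
  have sN: "sets N = sets (borel :: real measure)"
    unfolding N_def using sets.sigma_sets_eq[of "borel :: real measure"] by simp
  have eN: "emeasure N A = emeasure ?A A + emeasure ?B A" if "A \<in> sets borel" for A
    unfolding N_def
  proof (rule emeasure_measure_of_sigma)
    show "sigma_algebra UNIV (sets (borel :: real measure))"
      using sets.sigma_algebra_axioms[of "borel :: real measure"] by simp
    show "positive (sets borel) (\<lambda>A. emeasure ?A A + emeasure ?B A)" by (simp add: positive_def)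
    show "countably_additive (sets borel) (\<lambda>A. emeasure ?A A + emeasure ?B A)"
    proof (rule countably_additiveI)
      fix S :: "nat \<Rightarrow> real set" assume S: "range S \<subseteq> sets borel" "disjoint_family S"
      then have "(\<Sum>i. emeasure ?A (S i)) = emeasure ?A (\<Union>i. S i)" "(\<Sum>i. emeasure ?B (S i)) = emeasure ?B (\<Union>i. S i)"
        by (auto intro!: suminf_emeasure)
      then show "(\<Sum>i. emeasure ?A (S i) + emeasure ?B (S i)) = emeasure ?A (\<Union>i. S i) + emeasure ?B (\<Union>i. S i)"
        by (simp add: suminf_add[symmetric])
    qed
    show "A \<in> sets borel" by (rule that)
  qed
  \<comment> \<open>Open intervals determine Lebesgue measure, and on them the two increments add up
    to the length.\<close>
  have "lborel = N"
  proof (rule lborel_eqI)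
    fix l u :: real assume "\<And>b. b \<in> Basis \<Longrightarrow> l \<bullet> b \<le> u \<bullet> b"
    then have "l \<le> u" by simp
    then have "emeasure N {l<..<u} = ennreal (F u - F l) + ennreal (H u - H l)"
      by (simp add: eN emeasure_interval_measure_Ioo[OF m cF] emeasure_interval_measure_Ioo[OF mH cH])
    also have "\<dots> = ennreal (u - l)"
      using m[OF \<open>l \<le> u\<close>] mH[OF \<open>l \<le> u\<close>] by (subst ennreal_plus[symmetric]) (auto simp: H_def)
    finally show "emeasure N (box l u) = (\<Prod>b\<in>Basis. (u - l) \<bullet> b)" by (simp add: box_real)
  qed (simp add: sN)
  then have "emeasure ?A A = 0" if "A \<in> sets borel" "emeasure lborel A = 0" for A
    using eN[OF that(1)] that(2) by simp
  then show ?thesis unfolding absolutely_continuous_def by (auto simp: null_sets_def)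
qed

lemma has_real_derivative_at_of_one_sided_quotients:
  fixes f :: "real \<Rightarrow> real"
  assumes r: "\<And>e. 0 < e \<Longrightarrow> \<exists>d>0. \<forall>h. 0 < h \<and> h < d \<longrightarrow> \<bar>(f (x + h) - f x) / h - k\<bar> < e"
    and l: "\<And>e. 0 < e \<Longrightarrow> \<exists>d>0. \<forall>h. 0 < h \<and> h < d \<longrightarrow> \<bar>(f x - f (x - h)) / h - k\<bar> < e"
  shows "(f has_real_derivative k) (at x)"
  unfolding DERIV_def LIM_eq
proof (intro allI impI)
  fix e :: real assume "0 < e"
  obtain d1 where d1: "d1 > 0" "\<And>h. 0 < h \<Longrightarrow> h < d1 \<Longrightarrow> \<bar>(f (x + h) - f x) / h - k\<bar> < e" using r[OF \<open>0 < e\<close>] by auto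
  obtain d2 where d2: "d2 > 0" "\<And>h. 0 < h \<Longrightarrow> h < d2 \<Longrightarrow> \<bar>(f x - f (x - h)) / h - k\<bar> < e" using l[OF \<open>0 < e\<close>] by auto
  show "\<exists>s>0. \<forall>h. h \<noteq> 0 \<and> norm (h - 0) < s \<longrightarrow> norm ((f (x + h) - f x) / h - k) < e"
  proof (intro exI[of _ "min d1 d2"] conjI allI impI)
    fix h :: real assume h: "h \<noteq> 0 \<and> norm (h - 0) < min d1 d2"
    show "norm ((f (x + h) - f x) / h - k) < e"
    proof (cases "h > 0")
      case True then show ?thesis using d1(2)[of h] h by auto
    next
      case False
      then have "\<bar>(f x - f (x + h)) / (- h) - k\<bar> < e" using d2(2)[of "-h"] h by auto
      moreover have "(f x - f (x + h)) / (- h) = (f (x + h) - f x) / h" by (simp add: minus_divide_left)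
      ultimately show ?thesis by simp
    qed
  qed (use d1(1) d2(1) in auto)
qed

text \<open>The differentiation theorem is applied to averages over intervals starting at the point,
  so it gives difference quotients to the right only. Quotients to the left come from the reflected
  integrand \<open>k (- x)\<close>, whose exceptional set is reflected back.\<close>

lemma integral_derivative_ae:
  fixes k f :: "real \<Rightarrow> real"
  assumes k: "\<And>a b. a \<le> b \<Longrightarrow> (k has_integral (f b - f a)) {a..b}"
  obtains N where "negligible N" "\<And>x. x \<notin> N \<Longrightarrow> (f has_real_derivative k x) (at x)"
proof -
  have k1: "k integrable_on cbox a b" for a b
    using k[of a b] by (cases "a \<le> b") (auto simp: integrable_on_def)
  have kr: "((\<lambda>x. k (- x)) has_integral (f b - f a)) {-b..-a}" if "a \<le> b" for a b
    using has_integral_reflect_lemma_real[OF k[OF that]] by simp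
  have k2: "(\<lambda>x. k (- x)) integrable_on cbox a b" for a b
    using kr[of "-b" "-a"] by (cases "a \<le> b") (auto simp: integrable_on_def)
  obtain N1 where N1: "negligible N1" "\<And>x e. \<lbrakk>x \<notin> N1; 0 < e\<rbrakk> \<Longrightarrow>
     \<exists>d>0. \<forall>h. 0 < h \<and> h < d \<longrightarrow> norm(integral (cbox x (x + h *\<^sub>R One)) k /\<^sub>R h ^ DIM(real) - k x) < e"
    using integrable_ccontinuous_explicit[OF k1] by metis
  obtain N2 where N2: "negligible N2" "\<And>x e. \<lbrakk>x \<notin> N2; 0 < e\<rbrakk> \<Longrightarrow>
     \<exists>d>0. \<forall>h. 0 < h \<and> h < d \<longrightarrow> norm(integral (cbox x (x + h *\<^sub>R One)) (\<lambda>x. k (- x)) /\<^sub>R h ^ DIM(real) - k (- x)) < e"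
    using integrable_ccontinuous_explicit[OF k2] by metis
  let ?N = "N1 \<union> uminus ` N2"
  have "negligible (uminus ` N2)"
    by (rule negligible_differentiable_image_negligible) (auto simp: N2(1) intro!: derivative_intros differentiable_on_minus)
  then have "negligible ?N" using N1(1) by (rule negligible_Un[rotated])
  moreover have "(f has_real_derivative k x) (at x)" if "x \<notin> ?N" for x
  proof (rule has_real_derivative_at_of_one_sided_quotients)
    fix e :: real assume e: "0 < e"
    have "x \<notin> N1" "- x \<notin> N2" using that by (auto simp: image_iff)
    note a = N1(2)[OF this(1) e] and b = N2(2)[OF this(2) e]
    from a obtain d where d: "d > 0" "\<And>h. 0 < h \<Longrightarrow> h < d \<Longrightarrow> norm(integral (cbox x (x + h *\<^sub>R One)) k /\<^sub>R h ^ DIM(real) - k x) < e" by auto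
    have "\<bar>(f (x + h) - f x) / h - k x\<bar> < e" if "0 < h" "h < d" for h
      using d(2)[OF that] integral_unique[OF k[of x "x + h"]] that by (simp add: field_simps)
    then show "\<exists>d>0. \<forall>h. 0 < h \<and> h < d \<longrightarrow> \<bar>(f (x + h) - f x) / h - k x\<bar> < e" using d(1) by auto
    from b obtain d where d: "d > 0" "\<And>h. 0 < h \<Longrightarrow> h < d \<Longrightarrow> norm(integral (cbox (-x) (-x + h *\<^sub>R One)) (\<lambda>x. k (- x)) /\<^sub>R h ^ DIM(real) - k x) < e" by auto
    have "\<bar>(f x - f (x - h)) / h - k x\<bar> < e" if "0 < h" "h < d" for h
      using d(2)[OF that] integral_unique[OF kr[of "x - h" x]] that by (simp add: field_simps)
    then show "\<exists>d>0. \<forall>h. 0 < h \<and> h < d \<longrightarrow> \<bar>(f x - f (x - h)) / h - k x\<bar> < e" using d(1) by auto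
  qed
  ultimately show ?thesis by (rule that)
qed

text \<open>Radon--Nikodym for the Stieltjes measure of \<open>(s + f s / K) / 2\<close> with \<open>K > L\<close>, whose increments lie between
  zero and those of the identity.\<close>

lemma lipschitz_derivative_ae:
  fixes f :: "real \<Rightarrow> real"
  assumes L: "L-lipschitz_on UNIV f"
  obtains k N where "negligible N" "\<And>x. x \<notin> N \<Longrightarrow> (f has_real_derivative k x) (at x)"
    "\<And>a b. a \<le> b \<Longrightarrow> (k has_integral (f b - f a)) {a..b}"
    "\<And>a b. k absolutely_integrable_on {a..b}"
proof -
  \<comment> \<open>The added one keeps \<open>K\<close> positive when \<open>L = 0\<close>.\<close>
  define K where "K = L + 1"
  have "L \<ge> 0" using L lipschitz_on_nonneg by blast
  then have K: "K > 0" by (simp add: K_def)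
  have lip: "\<bar>f y - f x\<bar> \<le> K * (y - x)" if "x \<le> y" for x y
  proof -
    have "\<bar>f y - f x\<bar> \<le> L * (y - x)" using lipschitz_onD[OF L, of y x] that by (simp add: dist_real_def)
    also have "\<dots> \<le> K * (y - x)" using that by (intro mult_right_mono) (auto simp: K_def)
    finally show ?thesis .
  qed
  define F where "F s = (s + f s / K) / 2" for s
  have lip': "\<bar>f y / K - f x / K\<bar> \<le> y - x" if "x \<le> y" for x y
    using lip[OF that] K by (simp add: diff_divide_distrib[symmetric] abs_divide pos_divide_le_eq mult.commute)
  have half: "(x + a) / 2 \<le> (y + b) / 2 \<and> (y + b) / 2 - (x + a) / 2 \<le> y - x" if "\<bar>b - a\<bar> \<le> y - x" for x y a b :: real
    using that by (auto simp: field_simps abs_le_iff)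
  have m: "F x \<le> F y" if "x \<le> y" for x y
    unfolding F_def using half[OF lip'[OF that]] by blast
  have m2: "F y - F x \<le> y - x" if "x \<le> y" for x y
    unfolding F_def using half[OF lip'[OF that]] by blast
  have cF: "continuous_on UNIV F" unfolding F_def
    by (intro continuous_intros lipschitz_on_continuous_on[OF L]) (use K in auto)
  obtain h where h: "h \<in> borel_measurable lborel" "density lborel h = interval_measure F"
    using sigma_finite_measure.Radon_Nikodym[OF sigma_finite_lborel interval_measure_abs_cont[OF m m2]] by auto
  have hi: "(\<integral>\<^sup>+x. h x * indicator {a..b} x \<partial>lborel) = ennreal (F b - F a)" if "a \<le> b" for a b
  proof -
    have "emeasure (interval_measure F) {a..b} = F b - F a"
      by (rule emeasure_interval_measure_Icc[OF that m]) (use cF in auto)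
    then show ?thesis using emeasure_density[OF h(1), of "{a..b}"] h(2) by simp
  qed
  define g where "g x = enn2real (h x)" for x
  have gm: "g \<in> borel_measurable lborel" unfolding g_def using h(1) by measurable
  \<comment> \<open>The density takes values in \<open>ennreal\<close>; finite mass on each
    \<open>{-n..n}\<close> makes it finite almost everywhere, so that its real version
    \<open>g\<close> has the same integrals.\<close>
  have fin: "AE x in lborel. h x \<noteq> \<infinity>"
  proof -
    have "AE x in lborel. h x * indicator {- real n..real n} x \<noteq> \<infinity>" for n :: nat
    proof (rule nn_integral_PInf_AE)
      show "(\<lambda>x. h x * indicator {- real n..real n} x) \<in> borel_measurable lborel" using h(1) by measurable
      show "(\<integral>\<^sup>+ x. h x * indicator {- real n..real n} x \<partial>lborel) \<noteq> \<infinity>" by (subst hi) auto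
    qed
    then have "AE x in lborel. \<forall>n::nat. h x * indicator {- real n..real n} x \<noteq> \<infinity>" by (simp add: AE_all_countable)
    then show ?thesis
    proof eventually_elim
      case (elim x)
      obtain n :: nat where "\<bar>x\<bar> \<le> real n" using real_arch_simple by blast
      then show ?case using elim[rule_format, of n] by (auto simp: indicator_def abs_le_iff split: if_splits)
    qed
  qed
  have gi: "(g has_integral (F b - F a)) {a..b}" if "a \<le> b" for a b
  proof -
    have "(\<integral>\<^sup>+x. ennreal (indicator {a..b} x * g x) \<partial>lborel) = (\<integral>\<^sup>+x. h x * indicator {a..b} x \<partial>lborel)"
      by (rule nn_integral_cong_AE) (use fin in \<open>eventually_elim, auto simp: g_def indicator_def less_top\<close>)
    then have *: "(\<integral>\<^sup>+x. ennreal (indicator {a..b} x * g x) \<partial>lborel) = ennreal (F b - F a)" using hi[OF that] by simp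
    have [measurable]: "g \<in> borel_measurable borel" using gm by simp
    have "(\<lambda>x. indicator {a..b} x * g x) \<in> borel_measurable borel" by measurable
    then have "((\<lambda>x. indicator {a..b} x * g x) has_integral (F b - F a)) UNIV"
      by (rule nn_integral_has_integral) (use * m[OF that] in \<open>auto simp: g_def\<close>)
    moreover have "(\<lambda>x. indicator {a..b} x * g x) = (\<lambda>x. if x \<in> {a..b} then g x else 0)" by (auto simp: indicator_def)
    ultimately show ?thesis by (simp only: has_integral_restrict_UNIV)
  qed
  \<comment> \<open>Inverts \<open>F s = (s + f s / K) / 2\<close>: the increments of
    \<open>f\<close> are \<open>K\<close> times those of \<open>2 F - id\<close>.\<close>
  define k where "k x = K * (2 * g x - 1)" for x
  have ki: "(k has_integral (f b - f a)) {a..b}" if "a \<le> b" for a b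
  proof -
    have "((\<lambda>x. K * (2 * g x - 1)) has_integral K * (2 * (F b - F a) - (b - a))) {a..b}"
      using has_integral_const_real[of "1::real" a b] that
      by (intro has_integral_mult_right has_integral_diff gi) auto
    moreover have "K * (2 * (F b - F a) - (b - a)) = f b - f a" using K by (simp add: F_def field_simps)
    ultimately show ?thesis by (simp add: k_def[abs_def])
  qed
  obtain N where "negligible N" "\<And>x. x \<notin> N \<Longrightarrow> (f has_real_derivative k x) (at x)"
    using integral_derivative_ae[of k f] ki by blast
  moreover have "k absolutely_integrable_on {a..b}" for a b
  proof (cases "a \<le> b")
    case True
    have "g absolutely_integrable_on {a..b}"
      by (rule nonnegative_absolutely_integrable_1) (use gi[OF True] in \<open>auto simp: g_def integrable_on_def\<close>)
    then show ?thesis unfolding k_def[abs_def]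
      by (intro set_integral_diff set_integrable_mult_right absolutely_integrable_on_const) auto
  qed simp
  ultimately show ?thesis using ki that by blast
qed

text \<open>The dissipation integrand of an admissible curve involves \<open>vector_derivative\<close>, which is arbitrary where the
  curve is not differentiable, so additivity of its integral over subintervals is not directly available.
  The lower speed of the energy along the curve is a Borel minorant that is.\<close>

definition lower_speed :: "(real \<Rightarrow> real) \<Rightarrow> real \<Rightarrow> ennreal" where
  "lower_speed f s = liminf (\<lambda>n. ennreal (real (Suc n) * \<bar>f (s + 1 / real (Suc n)) - f s\<bar>))"

lemma lower_speed_measurable:
  assumes "continuous_on UNIV f"
  shows "lower_speed f \<in> borel_measurable borel"
proof -
  have [measurable]: "f \<in> borel_measurable borel" using assms by (rule borel_measurable_continuous_onI)
  show ?thesis unfolding lower_speed_def by measurable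
qed

lemma lower_speed_derivative:
  assumes "(f has_real_derivative k) (at s)"
  shows "lower_speed f s = ennreal \<bar>k\<bar>"
proof -
  have "(\<lambda>h. (f (s + h) - f s) / h) \<midarrow>0\<rightarrow> k" using assms by (simp add: DERIV_def)
  moreover have "filterlim (\<lambda>n. 1 / real (Suc n)) (at 0) sequentially"
    using LIMSEQ_inverse_real_of_nat by (auto simp: filterlim_at inverse_eq_divide)
  ultimately have "(\<lambda>n. (f (s + 1 / real (Suc n)) - f s) / (1 / real (Suc n))) \<longlonglongrightarrow> k"
    by (rule filterlim_compose)
  then have "(\<lambda>n. \<bar>(f (s + 1 / real (Suc n)) - f s) / (1 / real (Suc n))\<bar>) \<longlonglongrightarrow> \<bar>k\<bar>"
    by (rule tendsto_rabs)
  then have "(\<lambda>n. real (Suc n) * \<bar>f (s + 1 / real (Suc n)) - f s\<bar>) \<longlonglongrightarrow> \<bar>k\<bar>"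
    by (simp add: abs_mult mult.commute)
  then have "(\<lambda>n. ennreal (real (Suc n) * \<bar>f (s + 1 / real (Suc n)) - f s\<bar>)) \<longlonglongrightarrow> ennreal \<bar>k\<bar>"
    by (rule tendsto_ennrealI)
  then show ?thesis unfolding lower_speed_def by (intro lim_imp_Liminf) auto
qed

text \<open>Precomposition with this projection extends a function on \<open>{a..b}\<close> to the
  line by constants, keeping continuity and Lipschitz constants; the derivative theorem and the
  measurability of \<open>lower_speed\<close> are stated for functions on the whole line.\<close>

definition clamp_to :: "real \<Rightarrow> real \<Rightarrow> real \<Rightarrow> real" where
  "clamp_to a b s = max a (min b s)"

lemma clamp_to_mem: "a \<le> b \<Longrightarrow> clamp_to a b s \<in> {a..b}"
  by (auto simp: clamp_to_def)

lemma clamp_to_id: "s \<in> {a..b} \<Longrightarrow> clamp_to a b s = s"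
  by (auto simp: clamp_to_def)

lemma clamp_to_mono: "s \<le> t \<Longrightarrow> clamp_to a b s \<le> clamp_to a b t"
  by (auto simp: clamp_to_def)

lemma dist_clamp_to: "\<bar>clamp_to a b s - clamp_to a b t\<bar> \<le> \<bar>s - t\<bar>"
  by (auto simp: clamp_to_def max_def min_def)

lemma clamp_to_continuous: "continuous_on S (clamp_to a b)"
  unfolding clamp_to_def by (intro continuous_intros)

lemma lipschitz_clamp:
  fixes f :: "real \<Rightarrow> 'a::metric_space"
  assumes "L-lipschitz_on {a..b} f" "a \<le> b"
  shows "L-lipschitz_on UNIV (\<lambda>s. f (clamp_to a b s))"
proof (rule lipschitz_onI)
  fix x y
  have "dist (f (clamp_to a b x)) (f (clamp_to a b y)) \<le> L * dist (clamp_to a b x) (clamp_to a b y)"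
    by (rule lipschitz_onD[OF assms(1)]) (auto intro: clamp_to_mem assms simp del: atLeastAtMost_iff)
  also have "\<dots> \<le> L * dist x y"
    using dist_clamp_to lipschitz_on_nonneg[OF assms(1)] by (auto simp: dist_real_def intro!: mult_left_mono)
  finally show "dist (f (clamp_to a b x)) (f (clamp_to a b y)) \<le> L * dist x y" .
qed (rule lipschitz_on_nonneg[OF assms(1)])

lemma lipschitz_on_interval_derivative_ae:
  fixes f :: "real \<Rightarrow> real"
  assumes L: "L-lipschitz_on {p..q} f" and pq: "p \<le> q"
  obtains k N where "negligible N" "\<And>x. x \<in> {p<..<q} - N \<Longrightarrow> (f has_real_derivative k x) (at x)"
    "(k has_integral (f q - f p)) {p..q}" "k absolutely_integrable_on {p..q}"
proof -
  let ?f = "\<lambda>s. f (clamp_to p q s)"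
  obtain k N where k: "negligible N" "\<And>x. x \<notin> N \<Longrightarrow> (?f has_real_derivative k x) (at x)"
    "\<And>a b. a \<le> b \<Longrightarrow> (k has_integral (?f b - ?f a)) {a..b}" "\<And>a b. k absolutely_integrable_on {a..b}"
    using lipschitz_derivative_ae[OF lipschitz_clamp[OF L pq]] by metis
  have "(f has_real_derivative k x) (at x)" if "x \<in> {p<..<q} - N" for x
    by (rule has_field_derivative_transform_within_open[OF k(2), of _ "{p<..<q}"])
      (use that in \<open>auto simp: clamp_to_id\<close>)
  moreover have "(k has_integral (f q - f p)) {p..q}" using k(3)[OF pq] pq by (simp add: clamp_to_id)
  ultimately show ?thesis using k(1,4) that by blast
qed

text \<open>\<open>lower_speed f\<close> equals the modulus of the derivative almost everywhere,
  whose integral dominates the increment. The integrals pass through the completed measure because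
  the exceptional set is only known to be Lebesgue negligible.\<close>

lemma lipschitz_increment_le_lower_speed:
  fixes f :: "real \<Rightarrow> real"
  assumes L: "L-lipschitz_on {p..q} f" and pq: "p \<le> q"
  shows "ennreal (f p - f q) \<le> (\<integral>\<^sup>+s. lower_speed f s * indicator {p<..<q} s \<partial>lborel)"
proof -
  obtain k N where k: "negligible N" "\<And>x. x \<in> {p<..<q} - N \<Longrightarrow> (f has_real_derivative k x) (at x)"
    "(k has_integral (f q - f p)) {p..q}" "k absolutely_integrable_on {p..q}"
    using lipschitz_on_interval_derivative_ae[OF L pq] by metis
  have ki: "(\<lambda>s. \<bar>k s\<bar>) integrable_on {p..q}" using k(4) by (auto simp: absolutely_integrable_on_def)
  have "\<bar>f q - f p\<bar> \<le> integral {p..q} (\<lambda>s. \<bar>k s\<bar>)"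
    using integral_norm_bound_integral[of k "{p..q}" "\<lambda>s. \<bar>k s\<bar>"] k(3) ki integral_unique[OF k(3)] by (auto simp: integrable_on_def)
  then have "ennreal (f p - f q) \<le> ennreal (integral {p..q} (\<lambda>s. \<bar>k s\<bar>))" by (intro ennreal_leI) auto
  also have "\<dots> = (\<integral>\<^sup>+s. indicator {p..q} s * \<bar>k s\<bar> \<partial>lborel)"
    by (rule nn_integral_has_integral_lebesgue[symmetric]) (use ki in \<open>auto intro: integrable_integral\<close>)
  also have "\<dots> = (\<integral>\<^sup>+s. indicator {p..q} s * \<bar>k s\<bar> \<partial>lebesgue)" by (simp add: nn_integral_completion)
  also have "\<dots> \<le> (\<integral>\<^sup>+s. lower_speed f s * indicator {p<..<q} s \<partial>lebesgue)"
  proof (rule nn_integral_mono_AE)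
    have "AE s in lebesgue. s \<notin> N \<union> {p, q}"
      by (rule AE_not_in) (use k(1) in \<open>auto simp: negligible_iff_null_sets[symmetric] negligible_Un\<close>)
    then show "AE s in lebesgue. ennreal (indicator {p..q} s * \<bar>k s\<bar>) \<le> lower_speed f s * indicator {p<..<q} s"
      by eventually_elim (auto simp: indicator_def lower_speed_derivative[OF k(2)])
  qed
  also have "\<dots> = (\<integral>\<^sup>+s. lower_speed f s * indicator {p<..<q} s \<partial>lborel)" by (simp add: nn_integral_completion)
  finally show ?thesis .
qed

lemma locally_lipschitz_on_subinterval:
  fixes f :: "real \<Rightarrow> 'a::metric_space"
  assumes "locally_lipschitz_on {c<..<d} f" "c < p" "q < d"
  obtains L where "L-lipschitz_on {p..q} f"
proof -
  \<comment> \<open>The notion carries a parameter; the one-point set \<open>{0}\<close> is a dummy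
    for it.\<close>
  have "local_lipschitz {0::real} {p..q} (\<lambda>_. f)"
  proof (rule local_lipschitzI)
    fix t x assume "t \<in> {0::real}" "x \<in> {p..q}"
    then have "x \<in> {c<..<d}" using assms by auto
    then obtain e L where e: "e > 0" "L-lipschitz_on (ball x e \<inter> {c<..<d}) f"
      using assms(1) unfolding locally_lipschitz_on_def by blast
    have "L-lipschitz_on (cball x (e/2) \<inter> {p..q}) f"
      by (rule lipschitz_on_subset[OF e(2)]) (use e(1) assms in auto)
    then show "\<exists>u>0. \<exists>L. \<forall>t\<in>cball t u \<inter> {0}. L-lipschitz_on (cball x u \<inter> {p..q}) f"
      using e(1) by (intro exI[of _ "e/2"]) auto
  qed
  then obtain L where "\<And>t. t \<in> {0::real} \<Longrightarrow> L-lipschitz_on {p..q} f"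
    by (rule local_lipschitz_compact_implies_lipschitz) auto
  then show ?thesis using that by blast
qed

text \<open>Exhaustion of the open interval by countably many compact ones, on each of which
  \<open>f\<close> is Lipschitz.\<close>

lemma locally_lipschitz_derivative_ae:
  fixes f :: "real \<Rightarrow> real"
  assumes "locally_lipschitz_on {c<..<d} f"
  obtains N where "negligible N" "\<And>x. x \<in> {c<..<d} - N \<Longrightarrow> \<exists>k. (f has_real_derivative k) (at x)"
proof -
  have "\<exists>N. negligible N \<and> (\<forall>x \<in> {c + 1 / real (Suc n)<..<d - 1 / real (Suc n)} - N. \<exists>k. (f has_real_derivative k) (at x))" for n
  proof (cases "c + 1 / real (Suc n) \<le> d - 1 / real (Suc n)")
    case True
    obtain L where L: "L-lipschitz_on {c + 1 / real (Suc n)..d - 1 / real (Suc n)} f"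
      by (rule locally_lipschitz_on_subinterval[OF assms, of "c + 1 / real (Suc n)" "d - 1 / real (Suc n)"]) auto
    show ?thesis using lipschitz_on_interval_derivative_ae[OF L True] by metis
  qed auto
  then obtain N where N: "\<And>n. negligible (N n)"
    "\<And>n x. x \<in> {c + 1 / real (Suc n)<..<d - 1 / real (Suc n)} - N n \<Longrightarrow> \<exists>k. (f has_real_derivative k) (at x)" by metis
  have "negligible (\<Union>n. N n)" by (rule negligible_countable_Union) (use N(1) in auto)
  moreover have "\<exists>k. (f has_real_derivative k) (at x)" if "x \<in> {c<..<d} - (\<Union>n. N n)" for x
  proof -
    have "min (x - c) (d - x) > 0" using that by auto
    then obtain n where "1 / real (Suc n) < min (x - c) (d - x)" using nat_approx_posE by blast
    then show ?thesis using N(2)[of x n] that by auto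
  qed
  ultimately show ?thesis by (rule that)
qed

text \<open>Lipschitz constants may blow up at \<open>c\<close> and \<open>d\<close>, so the
  estimate is applied at distance \<open>1 / (n + 1)\<close> from them; continuity of
  \<open>f\<close> recovers the full increment in the limit.\<close>

lemma locally_lipschitz_increment_le_lower_speed:
  fixes f :: "real \<Rightarrow> real"
  assumes f: "locally_lipschitz_on {c<..<d} f" and cont: "continuous_on UNIV f" and cd: "c < d"
  shows "ennreal (f c - f d) \<le> (\<integral>\<^sup>+s. lower_speed f s * indicator {c<..<d} s \<partial>lborel)"
proof (rule tendsto_upperbound)
  let ?e = "\<lambda>n. 1 / real (Suc n)"
  have aux: "x < (d - c) / 2 \<Longrightarrow> c + x \<le> d - x" for x by (simp add: field_simps)
  have e0: "?e \<longlonglongrightarrow> 0" using LIMSEQ_inverse_real_of_nat by (simp add: inverse_eq_divide)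
  have "(\<lambda>n. f (c + ?e n)) \<longlonglongrightarrow> f (c + 0)" "(\<lambda>n. f (d - ?e n)) \<longlonglongrightarrow> f (d - 0)"
    by (intro continuous_on_tendsto_compose[OF cont] tendsto_intros e0; simp)+
  then show "(\<lambda>n. ennreal (f (c + ?e n) - f (d - ?e n))) \<longlonglongrightarrow> ennreal (f c - f d)"
    by (intro tendsto_ennrealI tendsto_diff) simp_all
  have "eventually (\<lambda>n. ?e n < (d - c) / 2) sequentially"
    using e0 cd by (intro order_tendstoD) auto
  then show "\<forall>\<^sub>F n in sequentially. ennreal (f (c + ?e n) - f (d - ?e n)) \<le> (\<integral>\<^sup>+s. lower_speed f s * indicator {c<..<d} s \<partial>lborel)"
  proof eventually_elim
    case (elim n)
    obtain L where "L-lipschitz_on {c + ?e n..d - ?e n} f"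
      by (rule locally_lipschitz_on_subinterval[OF f, of "c + ?e n" "d - ?e n"]) auto
    then have "ennreal (f (c + ?e n) - f (d - ?e n)) \<le> (\<integral>\<^sup>+s. lower_speed f s * indicator {c + ?e n<..<d - ?e n} s \<partial>lborel)"
      by (rule lipschitz_increment_le_lower_speed) (use aux[OF elim] in simp)
    also have "\<dots> \<le> (\<integral>\<^sup>+s. lower_speed f s * indicator {c<..<d} s \<partial>lborel)"
    proof (rule nn_integral_mono)
      fix s
      have "0 < ?e n" by simp
      then have "c < s" "s < d" if "s \<in> {c + ?e n<..<d - ?e n}"
        using that unfolding greaterThanLessThan_iff by argo+
      then have "s \<in> {c + ?e n<..<d - ?e n} \<Longrightarrow> s \<in> {c<..<d}" by simp
      then show "lower_speed f s * indicator {c + ?e n<..<d - ?e n} s \<le> lower_speed f s * indicator {c<..<d} s"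
        by (auto simp del: greaterThanLessThan_iff split: split_indicator)
    qed
    finally show ?case .
  qed
qed simp

text \<open>The pieces are put together by additivity of the integral, which rests on the
  measurability of \<open>lower_speed\<close>; the half-open interval on the right makes the
  successive domains disjoint.\<close>

lemma piecewise_lipschitz_increment_le_lower_speed:
  fixes f :: "real \<Rightarrow> real" and \<tau> :: "nat \<Rightarrow> real"
  assumes cont: "continuous_on UNIV f" and inc: "\<And>i. i < j \<Longrightarrow> \<tau> i < \<tau> (Suc i)"
    and lip: "\<And>i. i < j \<Longrightarrow> locally_lipschitz_on {\<tau> i<..<\<tau> (Suc i)} f"
  shows "\<tau> 0 \<le> \<tau> j \<and> ennreal (f (\<tau> 0) - f (\<tau> j)) \<le> (\<integral>\<^sup>+s. lower_speed f s * indicator {\<tau> 0..<\<tau> j} s \<partial>lborel)"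
  using inc lip
proof (induction j)
  case (Suc j)
  note [measurable] = lower_speed_measurable[OF cont]
  have IH: "\<tau> 0 \<le> \<tau> j" "ennreal (f (\<tau> 0) - f (\<tau> j)) \<le> (\<integral>\<^sup>+s. lower_speed f s * indicator {\<tau> 0..<\<tau> j} s \<partial>lborel)"
    using Suc by auto
  have lt: "\<tau> j < \<tau> (Suc j)" using Suc by auto
  have "ennreal (f (\<tau> 0) - f (\<tau> (Suc j))) \<le> ennreal (f (\<tau> 0) - f (\<tau> j)) + ennreal (f (\<tau> j) - f (\<tau> (Suc j)))"
    by (cases "0 \<le> f (\<tau> 0) - f (\<tau> j)"; cases "0 \<le> f (\<tau> j) - f (\<tau> (Suc j))")
      (auto simp: ennreal_plus[symmetric] ennreal_neg simp del: ennreal_plus intro!: ennreal_leI)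
  also have "\<dots> \<le> (\<integral>\<^sup>+s. lower_speed f s * indicator {\<tau> 0..<\<tau> j} s \<partial>lborel) + (\<integral>\<^sup>+s. lower_speed f s * indicator {\<tau> j<..<\<tau> (Suc j)} s \<partial>lborel)"
    by (intro add_mono IH locally_lipschitz_increment_le_lower_speed) (use Suc.prems cont in auto)
  also have "\<dots> = (\<integral>\<^sup>+s. lower_speed f s * indicator {\<tau> 0..<\<tau> j} s + lower_speed f s * indicator {\<tau> j<..<\<tau> (Suc j)} s \<partial>lborel)"
    by (rule nn_integral_add[symmetric]) auto
  also have "\<dots> \<le> (\<integral>\<^sup>+s. lower_speed f s * indicator {\<tau> 0..<\<tau> (Suc j)} s \<partial>lborel)"
    by (rule nn_integral_mono) (use lt IH(1) in \<open>auto split: split_indicator\<close>)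
  finally show ?case using lt IH(1) by simp
qed simp

section \<open>Chain rule and lower bound for the cost\<close>

locale C1_energy_on =
  fixes T :: real and E :: "real \<Rightarrow> 'a::euclidean_space \<Rightarrow> real"
  assumes T_pos: "T > 0" and C1: "C1_energy T E"
begin

text \<open>\<open>grad\<close> and \<open>time_deriv\<close> are given by a description and by a
  one-dimensional derivative. Here both are recognised as partial derivatives of one continuous
  \<open>D\<close>, which is the source of their joint continuity and of the chain rule.\<close>

lemma total_derivative:
  obtains D :: "real \<times> 'a \<Rightarrow> (real \<times> 'a) \<Rightarrow>\<^sub>L real" where
    "\<And>p. p \<in> {0..T} \<times> UNIV \<Longrightarrow> ((\<lambda>p. E (fst p) (snd p)) has_derivative blinfun_apply (D p)) (at p within {0..T} \<times> UNIV)"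
    "continuous_on ({0..T} \<times> UNIV) D"
    "\<And>t u. t \<in> {0..T} \<Longrightarrow> GDERIV (E t) u :> grad (E t) u"
    "\<And>t u h. t \<in> {0..T} \<Longrightarrow> D (t, u) (0, h) = h \<bullet> grad (E t) u"
    "\<And>t u. t \<in> {0..T} \<Longrightarrow> ((\<lambda>s. E s u) has_real_derivative time_deriv T E t u) (at t within {0..T})"
    "\<And>t u. t \<in> {0..T} \<Longrightarrow> D (t, u) (1, 0) = time_deriv T E t u"
proof -
  obtain D :: "real \<times> 'a \<Rightarrow> (real \<times> 'a) \<Rightarrow>\<^sub>L real" where
    D: "\<And>p. p \<in> {0..T} \<times> UNIV \<Longrightarrow> ((\<lambda>(t, u). E t u) has_derivative blinfun_apply (D p)) (at p within {0..T} \<times> UNIV)"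
    and cont: "continuous_on ({0..T} \<times> UNIV) D"
    using C1 unfolding C1_energy_def by blast
  have D': "((\<lambda>p. E (fst p) (snd p)) has_derivative blinfun_apply (D p)) (at p within {0..T} \<times> UNIV)" if "p \<in> {0..T} \<times> UNIV" for p
    using D[OF that] by (simp add: case_prod_beta')
  have x: "(E t has_derivative (\<lambda>h. D (t, u) (0, h))) (at u)" if t: "t \<in> {0..T}" for t u
  proof -
    have "((\<lambda>v. E (fst (t, v)) (snd (t, v))) has_derivative (\<lambda>h. D (t, u) (0, h))) (at u within UNIV)"
      by (rule has_derivative_in_compose2[OF D', where s = "UNIV" and f = "\<lambda>v. (t, v)"])
        (use t in \<open>auto intro!: derivative_eq_intros\<close>)
    then show ?thesis by simp
  qed
  have g: "GDERIV (E t) u :> (\<Sum>b\<in>Basis. D (t, u) (0, b) *\<^sub>R b)" (is "GDERIV _ _ :> ?g") if t: "t \<in> {0..T}" for t u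
  proof -
    have "D (t, u) (0, h) = h \<bullet> ?g" for h
    proof -
      have lin: "linear (\<lambda>h. D (t, u) (0, h))" by (rule has_derivative_linear[OF x[OF t]])
      have "D (t, u) (0, h) = D (t, u) (0, \<Sum>b\<in>Basis. (h \<bullet> b) *\<^sub>R b)" by (simp add: euclidean_representation)
      also have "\<dots> = (\<Sum>b\<in>Basis. D (t, u) (0, (h \<bullet> b) *\<^sub>R b))"
        by (rule linear_sum[OF lin])
      also have "\<dots> = (\<Sum>b\<in>Basis. (h \<bullet> b) * D (t, u) (0, b))"
        by (intro sum.cong refl) (metis linear_scale[OF lin] real_scaleR_def)
      finally show ?thesis by (simp add: inner_sum_right mult.commute)
    qed
    then have eq: "(\<lambda>h. D (t, u) (0, h)) = (\<lambda>h. h \<bullet> ?g)" by (rule ext)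
    show ?thesis unfolding gderiv_def eq[symmetric] by (rule x[OF t])
  qed
  have ge: "grad (E t) u = (\<Sum>b\<in>Basis. D (t, u) (0, b) *\<^sub>R b)" if t: "t \<in> {0..T}" for t u
    by (rule grad_eqI[OF g[OF t]])
  have g': "GDERIV (E t) u :> grad (E t) u" if t: "t \<in> {0..T}" for t u
    using g[OF t] ge[OF t] by simp
  have gD: "D (t, u) (0, h) = h \<bullet> grad (E t) u" if t: "t \<in> {0..T}" for t u h
    using has_derivative_unique[OF x[OF t] g'[OF t, unfolded gderiv_def]] by metis
  have s: "((\<lambda>s. E s u) has_derivative (\<lambda>h. D (t, u) (h, 0))) (at t within {0..T})" if t: "t \<in> {0..T}" for t u
  proof -
    have "((\<lambda>s. E (fst (s, u)) (snd (s, u))) has_derivative (\<lambda>h. D (t, u) (h, 0))) (at t within {0..T})"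
      by (rule has_derivative_in_compose2[OF D', where s = "{0..T}" and f = "\<lambda>s. (s, u)"])
        (use t in \<open>auto intro!: derivative_eq_intros\<close>)
    then show ?thesis by simp
  qed
  have sv: "((\<lambda>s. E s u) has_vector_derivative D (t, u) (1, 0)) (at t within {0..T})" if t: "t \<in> {0..T}" for t u
  proof -
    have lin: "linear (\<lambda>h. D (t, u) (h, 0))" by (rule has_derivative_linear[OF s[OF t]])
    have hD: "D (t, u) (h, 0) = h * D (t, u) (1, 0)" for h
      by (metis linear_scale[OF lin, of h 1] mult.right_neutral real_scaleR_def)
    have eq: "(\<lambda>h. D (t, u) (h, 0)) = (\<lambda>h. h *\<^sub>R D (t, u) (1, 0))"
      unfolding real_scaleR_def by (rule ext) (rule hD)
    show ?thesis unfolding has_vector_derivative_def eq[symmetric] by (rule s[OF t])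
  qed
  have td: "time_deriv T E t u = D (t, u) (1, 0)" if t: "t \<in> {0..T}" for t u
    unfolding time_deriv_def by (rule vector_derivative_within_closed_interval[OF T_pos t sv[OF t]])
  show ?thesis
  proof (rule that[of D])
    show "((\<lambda>s. E s u) has_real_derivative time_deriv T E t u) (at t within {0..T})" if "t \<in> {0..T}" for t u
      using sv[OF that, of u] td[OF that, of u] by (simp add: has_real_derivative_iff_has_vector_derivative)
  qed (use D' cont g' gD td in auto)
qed

lemma GDERIV_grad: "t \<in> {0..T} \<Longrightarrow> GDERIV (E t) u :> grad (E t) u"
proof (rule total_derivative)
  assume "t \<in> {0..T}" "\<And>t u. t \<in> {0..T} \<Longrightarrow> GDERIV (E t) u :> grad (E t) u"
  then show ?thesis by simp
qed

lemma continuous_on_grad: "continuous_on ({0..T} \<times> UNIV) (\<lambda>p. grad (E (fst p)) (snd p))"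
proof (rule total_derivative)
  fix D :: "real \<times> 'a \<Rightarrow> (real \<times> 'a) \<Rightarrow>\<^sub>L real"
  assume D: "continuous_on ({0..T} \<times> UNIV) D" "\<And>t u h. t \<in> {0..T} \<Longrightarrow> D (t, u) (0, h) = h \<bullet> grad (E t) u"
  have "continuous_on ({0..T} \<times> UNIV) (\<lambda>p. \<Sum>b\<in>Basis. D p (0, b) *\<^sub>R b)"
    by (intro continuous_intros D(1))
  moreover have "(\<Sum>b\<in>Basis. D p (0, b) *\<^sub>R b) = grad (E (fst p)) (snd p)" if "p \<in> {0..T} \<times> UNIV" for p
    using D(2)[of "fst p" "snd p"] that by (auto simp: inner_commute[of _ "grad _ _"] euclidean_representation)
  ultimately show ?thesis by (simp cong: continuous_on_cong)
qed

lemma continuous_on_time_deriv: "continuous_on ({0..T} \<times> UNIV) (\<lambda>p. time_deriv T E (fst p) (snd p))"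
proof (rule total_derivative)
  fix D :: "real \<times> 'a \<Rightarrow> (real \<times> 'a) \<Rightarrow>\<^sub>L real"
  assume D: "continuous_on ({0..T} \<times> UNIV) D" "\<And>t u. t \<in> {0..T} \<Longrightarrow> D (t, u) (1, 0) = time_deriv T E t u"
  have "continuous_on ({0..T} \<times> UNIV) (\<lambda>p. D p (1, 0))"
    by (intro continuous_intros D(1))
  moreover have "D p (1, 0) = time_deriv T E (fst p) (snd p)" if "p \<in> {0..T} \<times> UNIV" for p
    using D(2)[of "fst p" "snd p"] that by auto
  ultimately show ?thesis by (simp cong: continuous_on_cong)
qed

lemma continuous_on_energy: "continuous_on ({0..T} \<times> UNIV) (\<lambda>p. E (fst p) (snd p))"
proof (rule total_derivative)
  fix D :: "real \<times> 'a \<Rightarrow> (real \<times> 'a) \<Rightarrow>\<^sub>L real"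
  assume "\<And>p. p \<in> {0..T} \<times> UNIV \<Longrightarrow> ((\<lambda>p. E (fst p) (snd p)) has_derivative blinfun_apply (D p)) (at p within {0..T} \<times> UNIV)"
  then show ?thesis
    unfolding continuous_on_eq_continuous_within by (blast intro: has_derivative_continuous)
qed

lemma continuous_on_compose_energy:
  assumes "continuous_on S a" "continuous_on S b" "\<And>x. x \<in> S \<Longrightarrow> a x \<in> {0..T}"
  shows "continuous_on S (\<lambda>x. E (a x) (b x))"
    "continuous_on S (\<lambda>x. grad (E (a x)) (b x))"
    "continuous_on S (\<lambda>x. time_deriv T E (a x) (b x))"
proof -
  have p: "continuous_on S (\<lambda>x. (a x, b x))" by (intro continuous_intros assms)
  have i: "(\<lambda>x. (a x, b x)) ` S \<subseteq> {0..T} \<times> UNIV" using assms(3) by auto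
  show "continuous_on S (\<lambda>x. E (a x) (b x))"
    using continuous_on_compose2[OF continuous_on_energy p i] by simp
  show "continuous_on S (\<lambda>x. grad (E (a x)) (b x))"
    using continuous_on_compose2[OF continuous_on_grad p i] by simp
  show "continuous_on S (\<lambda>x. time_deriv T E (a x) (b x))"
    using continuous_on_compose2[OF continuous_on_time_deriv p i] by simp
qed

lemma energy_time_derivative:
  "t \<in> {0..T} \<Longrightarrow> ((\<lambda>s. E s u) has_real_derivative time_deriv T E t u) (at t within {0..T})"
proof (rule total_derivative)
  assume "t \<in> {0..T}"
    "\<And>t u. t \<in> {0..T} \<Longrightarrow> ((\<lambda>s. E s u) has_real_derivative time_deriv T E t u) (at t within {0..T})"
  then show ?thesis by simp
qed

lemma energy_chain:
  assumes t: "t \<in> {0..T}" and y: "(y has_vector_derivative v) (at t within {0..T})"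
  shows "((\<lambda>s. E s (y s)) has_real_derivative time_deriv T E t (y t) + grad (E t) (y t) \<bullet> v) (at t within {0..T})"
proof (rule total_derivative)
  fix D :: "real \<times> 'a \<Rightarrow> (real \<times> 'a) \<Rightarrow>\<^sub>L real"
  assume D: "\<And>p. p \<in> {0..T} \<times> UNIV \<Longrightarrow> ((\<lambda>p. E (fst p) (snd p)) has_derivative blinfun_apply (D p)) (at p within {0..T} \<times> UNIV)"
    "\<And>t u h. t \<in> {0..T} \<Longrightarrow> D (t, u) (0, h) = h \<bullet> grad (E t) u"
    "\<And>t u. t \<in> {0..T} \<Longrightarrow> D (t, u) (1, 0) = time_deriv T E t u"
  have y': "(y has_derivative (\<lambda>h. h *\<^sub>R v)) (at t within {0..T})" using y by (simp add: has_vector_derivative_def)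
  have "((\<lambda>s. E (fst (s, y s)) (snd (s, y s))) has_derivative (\<lambda>h. D (t, y t) (h, h *\<^sub>R v))) (at t within {0..T})"
    by (rule has_derivative_in_compose2[OF D(1), where s = "{0..T}" and f = "\<lambda>s. (s, y s)"])
      (use t in \<open>auto intro!: derivative_eq_intros y'\<close>)
  moreover have "D (t, y t) (h, h *\<^sub>R v) = (time_deriv T E t (y t) + grad (E t) (y t) \<bullet> v) * h" for h
  proof -
    have "D (t, y t) (h, h *\<^sub>R v) = D (t, y t) (h *\<^sub>R ((1, 0) + (0, v)))" by simp
    also have "\<dots> = h * (D (t, y t) (1, 0) + D (t, y t) (0, v))"
      by (simp only: blinfun.scaleR_right blinfun.add_right real_scaleR_def)
    finally show ?thesis using D(2,3)[OF t] by (simp add: inner_commute mult.commute)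
  qed
  ultimately show ?thesis by (simp add: has_field_derivative_def)
qed

lemma energy_chain_frozen:
  assumes t: "t \<in> {0..T}" and y: "(\<theta> has_vector_derivative v) (at s within S)"
  shows "((\<lambda>s. E t (\<theta> s)) has_real_derivative grad (E t) (\<theta> s) \<bullet> v) (at s within S)"
proof -
  have "((\<lambda>s. E t (\<theta> s)) has_derivative (\<lambda>h. (h *\<^sub>R v) \<bullet> grad (E t) (\<theta> s))) (at s within S)"
    using has_derivative_compose[OF y[unfolded has_vector_derivative_def] GDERIV_grad[OF t, unfolded gderiv_def]] .
  then show ?thesis by (simp add: has_field_derivative_def inner_commute mult_commute_abs)
qed

text \<open>Carries local Lipschitz bounds from a curve over to the energy along it; the ball is
  convex and the gradient is bounded on it.\<close>

lemma energy_lipschitz_on_cball: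
  assumes t: "t \<in> {0..T}"
  obtains \<Gamma> where "\<Gamma>-lipschitz_on (cball z r) (E t)"
proof -
  have "continuous_on (cball z r) (grad (E t))"
    by (rule continuous_on_compose_energy(2)[where a = "\<lambda>_. t" and b = "\<lambda>x. x"]) (use t in \<open>auto intro!: continuous_intros\<close>)
  then have "compact (grad (E t) ` cball z r)" by (rule compact_continuous_image) simp
  then obtain \<Gamma> where \<Gamma>: "\<Gamma> > 0" "\<And>x. x \<in> cball z r \<Longrightarrow> norm (grad (E t) x) \<le> \<Gamma>"
    using compact_imp_bounded[of "grad (E t) ` cball z r"] bounded_pos by (metis imageI)
  have "\<Gamma>-lipschitz_on (cball z r) (E t)"
  proof (rule bounded_derivative_imp_lipschitz)
    show "(E t has_derivative (\<lambda>h. h \<bullet> grad (E t) x)) (at x within cball z r)" for x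
      using GDERIV_grad[OF t, of x] by (simp add: gderiv_def has_derivative_at_withinI)
    show "onorm (\<lambda>h. h \<bullet> grad (E t) x) \<le> \<Gamma>" if "x \<in> cball z r" for x
    proof (rule onorm_le)
      fix h
      have "norm (h \<bullet> grad (E t) x) \<le> norm h * norm (grad (E t) x)" by (simp add: Cauchy_Schwarz_ineq2)
      also have "\<dots> \<le> norm h * \<Gamma>" by (intro mult_left_mono \<Gamma>(2) that) auto
      finally show "norm (h \<bullet> grad (E t) x) \<le> \<Gamma> * norm h" by (simp add: mult.commute)
    qed
  qed (use \<Gamma>(1) in auto)
  then show ?thesis by (rule that)
qed

text \<open>Chain rule and Cauchy-Schwarz bound the lower speed of the energy along the curve by the
  dissipation integrand almost everywhere, and the lower speed already integrates to at least the
  drop. An empty class of curves gives an infinite cost.\<close>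

theorem energy_drop_le_cost:
  assumes t: "t \<in> {0..T}"
  shows "ennreal (E t a - E t b) \<le> cost E t a b"
proof (cases "a = b")
  case False
  have "ennreal (E t a - E t b) \<le> (\<integral>\<^sup>+s. ennreal (norm (grad (E t) (\<theta> s)) * norm (vector_derivative \<theta> (at s))) \<partial>lebesgue_on {0..1})"
    (is "_ \<le> (\<integral>\<^sup>+s. ?h s \<partial>_)") if \<theta>: "\<theta> \<in> admissible E t a b" for \<theta>
  proof -
    obtain j and \<tau> :: "nat \<Rightarrow> real" where c: "continuous_on {0..1} \<theta>" "\<theta> 0 = a" "\<theta> 1 = b"
      and \<tau>: "\<tau> 0 = 0" "\<tau> j = 1" "\<And>i. i < j \<Longrightarrow> \<tau> i < \<tau> (Suc i)"
        "\<And>i. i < j \<Longrightarrow> locally_lipschitz_on {\<tau> i<..<\<tau> (Suc i)} \<theta>"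
      using \<theta> unfolding admissible_def by blast
    have \<tau>mono: "\<tau> i \<le> \<tau> k" if "i \<le> k" "k \<le> j" for i k
      using that
    proof (induction rule: dec_induct)
      case (step n) then show ?case using \<tau>(3)[of n] by simp
    qed simp
    have sub: "{\<tau> i<..<\<tau> (Suc i)} \<subseteq> {0<..<1}" if "i < j" for i
      using \<tau>mono[of 0 i] \<tau>mono[of "Suc i" j] that \<tau>(1,2) by auto
    \<comment> \<open>The clamp makes \<open>f\<close> continuous on the whole line, as the estimate
      by the lower speed requires; on \<open>{0..1}\<close> nothing changes.\<close>
    define f where "f s = E t (\<theta> (clamp_to 0 1 s))" for s
    have f_eq: "f s = E t (\<theta> s)" if "s \<in> {0..1}" for s using that by (simp add: f_def clamp_to_id)
    have "continuous_on UNIV (\<lambda>s. \<theta> (clamp_to 0 1 s))"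
      by (rule continuous_on_compose2[OF c(1) clamp_to_continuous]) (auto simp: clamp_to_def)
    then have cf: "continuous_on UNIV f" unfolding f_def
      by (rule continuous_on_compose_energy(1)[OF continuous_on_const]) (rule t)
    have "bounded (\<theta> ` {0..1})" by (intro compact_imp_bounded compact_continuous_image c) simp
    then obtain R where "\<forall>x\<in>\<theta> ` {0..1}. norm x \<le> R" unfolding bounded_iff by blast
    then have R: "\<theta> ` {0..1} \<subseteq> cball 0 R" by auto
    obtain \<Gamma> where \<Gamma>: "\<Gamma>-lipschitz_on (cball 0 R) (E t)" by (rule energy_lipschitz_on_cball[OF t])
    have lf: "locally_lipschitz_on {\<tau> i<..<\<tau> (Suc i)} f" if i: "i < j" for i
      unfolding locally_lipschitz_on_def
    proof
      fix x assume "x \<in> {\<tau> i<..<\<tau> (Suc i)}"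
      then obtain e L where e: "e > 0" "L-lipschitz_on (ball x e \<inter> {\<tau> i<..<\<tau> (Suc i)}) \<theta>"
        using \<tau>(4)[OF i] unfolding locally_lipschitz_on_def by blast
      let ?B = "ball x e \<inter> {\<tau> i<..<\<tau> (Suc i)}"
      have B: "?B \<subseteq> {0..1}" using sub[OF i] by auto
      have "(\<Gamma> * L)-lipschitz_on ?B (\<lambda>s. E t (\<theta> s))"
        by (rule lipschitz_on_compose2[OF e(2)]) (rule lipschitz_on_subset[OF \<Gamma>], use B R in blast)
      then have "(\<Gamma> * L)-lipschitz_on ?B f"
        by (rule lipschitz_on_transform) (use f_eq B in auto)
      then show "\<exists>e>0. \<exists>L. L-lipschitz_on (ball x e \<inter> {\<tau> i<..<\<tau> (Suc i)}) f" using e(1) by blast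
    qed
    have drop: "ennreal (f 0 - f 1) \<le> (\<integral>\<^sup>+s. lower_speed f s * indicator {0..<1} s \<partial>lborel)"
      using piecewise_lipschitz_increment_le_lower_speed[of f j \<tau>] cf \<tau>(3) lf \<tau>(1,2) by simp
    \<comment> \<open>Differentiability almost everywhere is known for real functions, so it is
      applied to each coordinate, and the finitely many exceptional sets are joined.\<close>
    have diff: "\<exists>N. negligible N \<and> (\<forall>s\<in>{\<tau> i<..<\<tau> (Suc i)} - N. \<exists>v. (\<theta> has_vector_derivative v) (at s))" if i: "i < j" for i
    proof -
      have "\<exists>N. negligible N \<and> (\<forall>s\<in>{\<tau> i<..<\<tau> (Suc i)} - N. \<exists>k. ((\<lambda>s. \<theta> s \<bullet> b) has_real_derivative k) (at s))" if "b \<in> Basis" for b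
      proof -
        have "locally_lipschitz_on {\<tau> i<..<\<tau> (Suc i)} (\<lambda>s. \<theta> s \<bullet> b)"
          unfolding locally_lipschitz_on_def
        proof
          fix x assume "x \<in> {\<tau> i<..<\<tau> (Suc i)}"
          then obtain e L where e: "e > 0" "L-lipschitz_on (ball x e \<inter> {\<tau> i<..<\<tau> (Suc i)}) \<theta>"
            using \<tau>(4)[OF i] unfolding locally_lipschitz_on_def by blast
          have "L-lipschitz_on (ball x e \<inter> {\<tau> i<..<\<tau> (Suc i)}) (\<lambda>s. \<theta> s \<bullet> b)"
          proof (rule lipschitz_onI)
            fix p q assume pq: "p \<in> ball x e \<inter> {\<tau> i<..<\<tau> (Suc i)}" "q \<in> ball x e \<inter> {\<tau> i<..<\<tau> (Suc i)}"
            have "dist (\<theta> p \<bullet> b) (\<theta> q \<bullet> b) = \<bar>(\<theta> p - \<theta> q) \<bullet> b\<bar>" by (simp add: dist_real_def inner_diff_left)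
            also have "\<dots> \<le> norm (\<theta> p - \<theta> q)" by (rule Basis_le_norm[OF that])
            also have "\<dots> \<le> L * dist p q" using lipschitz_onD[OF e(2) pq] by (simp add: dist_norm)
            finally show "dist (\<theta> p \<bullet> b) (\<theta> q \<bullet> b) \<le> L * dist p q" .
          qed (rule lipschitz_on_nonneg[OF e(2)])
          then show "\<exists>e>0. \<exists>L. L-lipschitz_on (ball x e \<inter> {\<tau> i<..<\<tau> (Suc i)}) (\<lambda>s. \<theta> s \<bullet> b)" using e(1) by blast
        qed
        then show ?thesis using locally_lipschitz_derivative_ae by metis
      qed
      then obtain N where N: "\<And>b. b \<in> Basis \<Longrightarrow> negligible (N b)"
        "\<And>b s. b \<in> Basis \<Longrightarrow> s \<in> {\<tau> i<..<\<tau> (Suc i)} - N b \<Longrightarrow> \<exists>k. ((\<lambda>s. \<theta> s \<bullet> b) has_real_derivative k) (at s)" by metis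
      have "negligible (\<Union>b\<in>(Basis::'a set). N b)" by (intro negligible_Union) (use N(1) in auto)
      moreover have "\<exists>v. (\<theta> has_vector_derivative v) (at s)" if s: "s \<in> {\<tau> i<..<\<tau> (Suc i)} - (\<Union>b\<in>(Basis::'a set). N b)" for s
      proof -
        have "\<exists>k. ((\<lambda>s. \<theta> s \<bullet> b) has_real_derivative k) (at s)" if "b \<in> Basis" for b using N(2)[OF that, of s] s that by auto
        then obtain k where k: "\<And>b. b \<in> Basis \<Longrightarrow> ((\<lambda>s. \<theta> s \<bullet> b) has_real_derivative k b) (at s)" by metis
        have "(\<theta> has_vector_derivative (\<Sum>b\<in>Basis. k b *\<^sub>R b)) (at s)"
          unfolding has_vector_derivative_def
        proof (subst has_derivative_componentwise_within, rule ballI)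
          fix b :: 'a assume b: "b \<in> Basis"
          show "((\<lambda>x. \<theta> x \<bullet> b) has_derivative (\<lambda>x. x *\<^sub>R (\<Sum>b\<in>Basis. k b *\<^sub>R b) \<bullet> b)) (at s)"
            using k[OF b] b by (simp add: has_field_derivative_def inner_sum_left_Basis mult_commute_abs)
        qed
        then show ?thesis by blast
      qed
      ultimately show ?thesis by blast
    qed
    then obtain N where N: "\<And>i. i < j \<Longrightarrow> negligible (N i)"
      "\<And>i s. i < j \<Longrightarrow> s \<in> {\<tau> i<..<\<tau> (Suc i)} - N i \<Longrightarrow> \<exists>v. (\<theta> has_vector_derivative v) (at s)" by metis
    let ?N = "(\<Union>i<j. N i) \<union> \<tau> ` {..j}"
    have "negligible (\<Union>i<j. N i)" by (rule negligible_Union) (use N(1) in auto)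
    then have negN: "negligible ?N" by (rule negligible_Un) (auto intro: negligible_finite)
    have le: "lower_speed f s \<le> ?h s" if s: "s \<in> {0..<1} - ?N" for s
    proof -
      have "\<exists>i<j. s \<in> {\<tau> i<..<\<tau> (Suc i)}"
      proof -
        \<comment> \<open>The first partition time beyond \<open>s\<close>; it exists because
          \<open>\<tau> j = 1\<close>, and its predecessor starts the piece containing
          \<open>s\<close>.\<close>
        define k where "k = (LEAST k. s < \<tau> k)"
        have "s < \<tau> j" using s \<tau>(2) by auto
        then have k: "s < \<tau> k" "k \<le> j" "\<And>i. i < k \<Longrightarrow> \<not> s < \<tau> i"
          unfolding k_def by (auto intro: LeastI Least_le dest: not_less_Least)
        have "k \<noteq> 0" using k(1) \<tau>(1) s by (cases "k = 0") auto
        then obtain i where "k = Suc i" using not0_implies_Suc by blast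
        then have "i < j" "s < \<tau> (Suc i)" "\<tau> i \<le> s" "\<tau> i \<noteq> s" using k(1,2) k(3)[of i] s by auto
        then show ?thesis by auto
      qed
      then obtain i where i: "i < j" "s \<in> {\<tau> i<..<\<tau> (Suc i)}" by blast
      obtain v where v: "(\<theta> has_vector_derivative v) (at s)" using N(2)[OF i(1), of s] i(2) s i(1) by blast
      have "((\<lambda>s. E t (\<theta> s)) has_real_derivative grad (E t) (\<theta> s) \<bullet> v) (at s)" by (rule energy_chain_frozen[OF t v])
      then have "(f has_real_derivative grad (E t) (\<theta> s) \<bullet> v) (at s)"
        by (rule has_field_derivative_transform_within_open[of _ _ _ "{\<tau> i<..<\<tau> (Suc i)}"]) (use i sub f_eq in force)+
      then have "lower_speed f s = ennreal \<bar>grad (E t) (\<theta> s) \<bullet> v\<bar>" by (rule lower_speed_derivative)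
      also have "\<dots> \<le> ennreal (norm (grad (E t) (\<theta> s)) * norm v)" by (intro ennreal_leI Cauchy_Schwarz_ineq2)
      also have "v = vector_derivative \<theta> (at s)" using vector_derivative_at[OF v] by simp
      finally show ?thesis .
    qed
    have "ennreal (E t a - E t b) \<le> (\<integral>\<^sup>+s. lower_speed f s * indicator {0..<1} s \<partial>lebesgue)"
      using drop c by (simp add: f_eq nn_integral_completion)
    also have "\<dots> \<le> (\<integral>\<^sup>+s. ?h s * indicator {0..1} s \<partial>lebesgue)"
    proof (rule nn_integral_mono_AE)
      have "AE s in lebesgue. s \<notin> ?N" by (rule AE_not_in) (use negN in \<open>simp add: negligible_iff_null_sets\<close>)
      then show "AE s in lebesgue. lower_speed f s * indicator {0..<1} s \<le> ?h s * indicator {0..1} s"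
        by eventually_elim (use le in \<open>auto split: split_indicator\<close>)
    qed
    also have "\<dots> = (\<integral>\<^sup>+s. ?h s \<partial>lebesgue_on {0..1})" by (simp add: nn_integral_restrict_space)
    finally show ?thesis .
  qed
  then show ?thesis using False unfolding cost_def by (auto intro: INF_greatest)
qed (simp add: cost_def)

end

section \<open>Regularity and bounds for viscous solutions\<close>

lemma DERIV_mult_abs: "((\<lambda>x::real. x * \<bar>x\<bar>) has_real_derivative 2 * \<bar>x\<bar>) (at x)"
proof -
  consider "x > 0" | "x < 0" | "x = 0" by linarith
  then show ?thesis
  proof cases
    case 1
    have "((\<lambda>x. x * x) has_real_derivative 2 * \<bar>x\<bar>) (at x)" using 1 by (auto intro!: derivative_eq_intros)
    then show ?thesis
      by (rule has_field_derivative_transform_within_open[where S = "{0<..}"]) (use 1 in auto)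
  next
    case 2
    have "((\<lambda>x. - (x * x)) has_real_derivative 2 * \<bar>x\<bar>) (at x)" using 2 by (auto intro!: derivative_eq_intros)
    then show ?thesis
      by (rule has_field_derivative_transform_within_open[where S = "{..<0}"]) (use 2 in auto)
  next
    case 3
    have "((\<lambda>h::real. \<bar>h\<bar>) \<longlongrightarrow> 0) (at 0)" by (rule tendsto_rabs_zero) simp
    then have "((\<lambda>h. ((0 + h) * \<bar>0 + h\<bar> - 0 * \<bar>0\<bar>) / h) \<longlongrightarrow> (0::real)) (at 0)"
      by (rule Lim_transform_eventually) (auto simp: eventually_at intro!: exI[of _ 1])
    then show ?thesis using 3 by (simp add: DERIV_def)
  qed
qed

text \<open>A \<open>C\<^sup>1\<close> function that rises from \<open>- h\<^sup>2\<close> to \<open>h\<^sup>2\<close> on \<open>{-h..h}\<close>; its derivative is the tent \<open>2 (h - \<bar>x\<bar>)\<^sup>+\<close>.\<close>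

definition smooth_step :: "real \<Rightarrow> real \<Rightarrow> real" where
  "smooth_step h x = ((x - h) * \<bar>x - h\<bar> - 2 * (x * \<bar>x\<bar>) + (x + h) * \<bar>x + h\<bar>) / 2"

definition tent :: "real \<Rightarrow> real \<Rightarrow> real" where
  "tent h x = \<bar>x - h\<bar> - 2 * \<bar>x\<bar> + \<bar>x + h\<bar>"

lemma smooth_step_deriv: "((\<lambda>s. smooth_step h (s - p)) has_real_derivative tent h (s - p)) (at s)"
proof -
  have a: "((\<lambda>s. (s - a) * \<bar>s - a\<bar>) has_real_derivative 2 * \<bar>s - a\<bar>) (at s)" for a
    using DERIV_chain'[OF DERIV_diff[OF DERIV_ident DERIV_const[of a]] DERIV_mult_abs[of "s - a"]] by simp
  have "((\<lambda>s. ((s - (p + h)) * \<bar>s - (p + h)\<bar> - 2 * ((s - p) * \<bar>s - p\<bar>) + (s - (p - h)) * \<bar>s - (p - h)\<bar>) / 2)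
      has_real_derivative ((2 * \<bar>s - (p + h)\<bar> - 2 * (2 * \<bar>s - p\<bar>) + 2 * \<bar>s - (p - h)\<bar>) / 2)) (at s)"
    by (intro DERIV_cdivide DERIV_add DERIV_diff DERIV_cmult a)
  moreover have "s - (p + h) = s - p - h" "s - (p - h) = s - p + h" for s by auto
  moreover have "(2 * a - 2 * (2 * b) + 2 * c) / 2 = a - 2 * b + c" for a b c :: real by simp
  ultimately show ?thesis by (simp only: smooth_step_def tent_def)
qed

lemma tent_nonneg: "0 \<le> h \<Longrightarrow> 0 \<le> tent h x"
  by (auto simp: tent_def abs_if)

lemma tent_outside: "0 \<le> h \<Longrightarrow> h \<le> \<bar>x\<bar> \<Longrightarrow> tent h x = 0"
  by (auto simp: tent_def abs_if split: if_splits)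

lemma smooth_step_right: "0 \<le> h \<Longrightarrow> h \<le> x \<Longrightarrow> smooth_step h x = h\<^sup>2"
  by (simp add: smooth_step_def power2_eq_square algebra_simps)

lemma smooth_step_left: "0 \<le> h \<Longrightarrow> x \<le> - h \<Longrightarrow> smooth_step h x = - h\<^sup>2"
  by (cases "x = - h") (simp_all add: smooth_step_def power2_eq_square abs_if algebra_simps)

lemma tent_continuous [continuous_intros]: "continuous_on S f \<Longrightarrow> continuous_on S (\<lambda>s. tent h (f s))"
  unfolding tent_def by (intro continuous_intros)

lemma smooth_step_continuous [continuous_intros]:
  "continuous_on S f \<Longrightarrow> continuous_on S (\<lambda>s. smooth_step h (f s))"
  unfolding smooth_step_def by (intro continuous_intros) auto

text \<open>Its derivative, the tent, is nonnegative, so the step stays between its two constant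
  values.\<close>

lemma smooth_step_bound: "0 \<le> h \<Longrightarrow> \<bar>smooth_step h x\<bar> \<le> h\<^sup>2"
proof -
  assume h: "0 \<le> h"
  have mono: "smooth_step h x \<le> smooth_step h y" if "x \<le> y" for x y
    by (rule DERIV_nonneg_imp_nondecreasing[OF that])
      (use smooth_step_deriv[of h 0] tent_nonneg[OF h] in auto)
  show ?thesis
    using mono[of x "max x h"] mono[of "min x (- h)" x] smooth_step_right[OF h, of "max x h"] smooth_step_left[OF h, of "min x (- h)"]
    by (auto simp: abs_le_iff)
qed

text \<open>The normalised tent is an averaging kernel supported within \<open>h\<close> of
  \<open>p\<close>. The constant \<open>2 * h\<^sup>2\<close> is the mass of the tent, namely the
  total rise of \<open>smooth_step h\<close>.\<close>

lemma tent_average: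
  fixes u :: "real \<Rightarrow> 'a::euclidean_space"
  assumes h: "h > 0" "0 \<le> p - h" "p + h \<le> T" and u: "continuous_on {0..T} u"
    and e: "\<And>s. \<bar>s - p\<bar> \<le> h \<Longrightarrow> norm (u s - u p) \<le> e"
  shows "norm (integral {0..T} (\<lambda>s. (tent h (s - p) / (2 * h\<^sup>2)) *\<^sub>R u s) - u p) \<le> e"
proof -
  let ?K = "\<lambda>s. tent h (s - p) / (2 * h\<^sup>2)"
  have cK: "continuous_on {0..T} ?K" by (intro continuous_intros) (use h in auto)
  have "((\<lambda>s. tent h (s - p)) has_integral smooth_step h (T - p) - smooth_step h (0 - p)) {0..T}"
    by (rule fundamental_theorem_of_calculus)
      (use h smooth_step_deriv in \<open>auto simp: has_real_derivative_iff_has_vector_derivative[symmetric] intro: has_field_derivative_at_within\<close>)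
  then have "((\<lambda>s. tent h (s - p)) has_integral 2 * h\<^sup>2) {0..T}"
    using smooth_step_right[of h "T - p"] smooth_step_left[of h "- p"] h by simp
  from has_integral_divide[OF this, of "2 * h\<^sup>2"] have K1: "(?K has_integral 1) {0..T}" using h by simp
  have Ku: "(\<lambda>s. ?K s *\<^sub>R u s) integrable_on {0..T}"
    by (intro integrable_continuous_real continuous_intros cK u)
  have "((\<lambda>s. ?K s *\<^sub>R u p) has_integral 1 *\<^sub>R u p) {0..T}" by (rule has_integral_scaleR_left[OF K1])
  then have "((\<lambda>s. ?K s *\<^sub>R u s - ?K s *\<^sub>R u p) has_integral integral {0..T} (\<lambda>s. ?K s *\<^sub>R u s) - 1 *\<^sub>R u p) {0..T}"
    by (intro has_integral_diff integrable_integral Ku)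
  then have i: "((\<lambda>s. ?K s *\<^sub>R (u s - u p)) has_integral integral {0..T} (\<lambda>s. ?K s *\<^sub>R u s) - u p) {0..T}"
    by (simp add: scaleR_diff_right)
  have "norm (integral {0..T} (\<lambda>s. ?K s *\<^sub>R (u s - u p))) \<le> integral {0..T} (\<lambda>s. ?K s * e)"
  proof (rule integral_norm_bound_integral)
    show "(\<lambda>s. ?K s *\<^sub>R (u s - u p)) integrable_on {0..T}" using i by blast
    show "(\<lambda>s. ?K s * e) integrable_on {0..T}" using has_integral_mult_left[OF K1, of e] by blast
    fix s
    show "norm (?K s *\<^sub>R (u s - u p)) \<le> ?K s * e"
    proof (cases "\<bar>s - p\<bar> \<le> h")
      case True
      then show ?thesis using e[OF True] tent_nonneg[of h "s - p"] h
        by (simp add: abs_mult divide_right_mono mult_left_mono)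
    next
      case False then show ?thesis using tent_outside[of h "s - p"] h by simp
    qed
  qed
  also have "integral {0..T} (\<lambda>s. ?K s * e) = e" using integral_unique[OF has_integral_mult_left[OF K1, of e]] by (simp only: mult_1)
  finally show ?thesis using integral_unique[OF i] by simp
qed

text \<open>The test function is a step at \<open>p\<close> minus a step at \<open>q\<close>.
  Divided by \<open>2 * h\<^sup>2\<close>, its derivative averages \<open>u\<close> near
  \<open>p\<close> minus \<open>u\<close> near \<open>q\<close>, while its negative tends to the
  indicator of the interval between them; the weak equation becomes the claimed identity.\<close>

lemma du_Bois_Reymond_interior:
  fixes u c :: "real \<Rightarrow> 'a::euclidean_space"
  assumes u: "H1_with_deriv T u v" and c: "continuous_on {0..T} c"
    and v: "AE t in lebesgue_on {0..T}. v t = c t"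
    and q: "0 < q" "q < p" "p < T"
  shows "u p - u q = integral {q..p} c"
proof -
  have cu: "continuous_on {0..T} u" using u by (simp add: H1_with_deriv_def)
  \<comment> \<open>Half widths below \<open>d\<close> keep the two steps apart and inside
    \<open>{0..T}\<close>.\<close>
  define d where "d = min q (min (T - p) (p / 2 - q / 2))"
  have d: "d > 0" "d \<le> q" "p + d \<le> T" "2 * d \<le> p - q" using q by (auto simp: d_def min_def)
  \<comment> \<open>With \<open>n + 2\<close> the width stays strictly below \<open>d\<close>
    already at \<open>n = 0\<close>, so that the closed support lies in the open interval.\<close>
  define h where "h n = d / real (n + 2)" for n
  have h: "h n > 0" "h n < d" for n
    using d(1) by (simp_all add: h_def divide_less_eq)
  have h0: "h \<longlonglongrightarrow> 0" unfolding h_def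
    using LIMSEQ_ignore_initial_segment[OF lim_const_over_n[of d], of 2] by simp
  define \<phi> where "\<phi> n s = smooth_step (h n) (s - p) - smooth_step (h n) (s - q)" for n s
  have D\<phi>: "(\<phi> n has_real_derivative tent (h n) (s - p) - tent (h n) (s - q)) (at s)" for n s
    unfolding \<phi>_def by (intro DERIV_diff smooth_step_deriv)
  have test: "integral {0..T} (\<lambda>t. (tent (h n) (t - p) - tent (h n) (t - q)) *\<^sub>R u t) = - integral {0..T} (\<lambda>t. \<phi> n t *\<^sub>R c t)" for n
  proof -
    have C1: "\<phi> n C1_differentiable_on UNIV"
      unfolding C1_differentiable_on_def
      by (rule exI[of _ "\<lambda>s. tent (h n) (s - p) - tent (h n) (s - q)"])
        (use D\<phi> in \<open>auto simp: has_real_derivative_iff_has_vector_derivative[symmetric] intro!: continuous_intros\<close>)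
    have z: "\<phi> n s = 0" if "s \<notin> {q - h n..p + h n}" for s
    proof (cases "s < q - h n")
      case True then show ?thesis using smooth_step_left[of "h n" "s - p"] smooth_step_left[of "h n" "s - q"] h[of n] q by (simp add: \<phi>_def)
    next
      case False then show ?thesis using that smooth_step_right[of "h n" "s - p"] smooth_step_right[of "h n" "s - q"] h[of n] q by (simp add: \<phi>_def)
    qed
    have "closure {t. \<phi> n t \<noteq> 0} \<subseteq> {q - h n..p + h n}" by (rule closure_minimal) (use z in blast, simp)
    also have "\<dots> \<subseteq> {0<..<T}" using h[of n] d by auto
    finally have supp: "closure {t. \<phi> n t \<noteq> 0} \<subseteq> {0<..<T}" .
    have "(LINT t|lebesgue_on {0..T}. deriv (\<phi> n) t *\<^sub>R u t) = - (LINT t|lebesgue_on {0..T}. \<phi> n t *\<^sub>R v t)"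
      using u C1 supp unfolding H1_with_deriv_def by blast
    moreover have "deriv (\<phi> n) t = tent (h n) (t - p) - tent (h n) (t - q)" for t by (rule DERIV_imp_deriv[OF D\<phi>])
    moreover have "(LINT t|lebesgue_on {0..T}. \<phi> n t *\<^sub>R v t) = (LINT t|lebesgue_on {0..T}. \<phi> n t *\<^sub>R c t)"
    proof (rule integral_cong_AE)
      have m\<phi>: "\<phi> n \<in> borel_measurable (lebesgue_on {0..T})"
        unfolding \<phi>_def by (intro continuous_imp_measurable_on_sets_lebesgue continuous_intros) auto
      show "(\<lambda>t. \<phi> n t *\<^sub>R v t) \<in> borel_measurable (lebesgue_on {0..T})"
        using m\<phi> u by (auto simp: H1_with_deriv_def mem_Lp_def)
      have "c \<in> borel_measurable (lebesgue_on {0..T})"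
        by (intro continuous_imp_measurable_on_sets_lebesgue c) auto
      then show "(\<lambda>t. \<phi> n t *\<^sub>R c t) \<in> borel_measurable (lebesgue_on {0..T})" using m\<phi> by auto
      show "AE t in lebesgue_on {0..T}. \<phi> n t *\<^sub>R v t = \<phi> n t *\<^sub>R c t" using v by eventually_elim simp
    qed
    moreover have "(LINT t|lebesgue_on {0..T}. \<phi> n t *\<^sub>R c t) = integral {0..T} (\<lambda>t. \<phi> n t *\<^sub>R c t)"
      by (intro lebesgue_integral_eq_integral continuous_imp_integrable_real) (auto simp: \<phi>_def intro!: continuous_intros c)
    moreover have "(LINT t|lebesgue_on {0..T}. (tent (h n) (t - p) - tent (h n) (t - q)) *\<^sub>R u t) = integral {0..T} (\<lambda>t. (tent (h n) (t - p) - tent (h n) (t - q)) *\<^sub>R u t)"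
      by (intro lebesgue_integral_eq_integral continuous_imp_integrable_real) (auto intro!: continuous_intros cu)
    ultimately show ?thesis by simp
  qed
  let ?A = "\<lambda>x n. integral {0..T} (\<lambda>s. (tent (h n) (s - x) / (2 * (h n)\<^sup>2)) *\<^sub>R u s)"
  have A: "?A x \<longlonglongrightarrow> u x" if x: "d \<le> x" "x + d \<le> T" for x
  proof (rule LIMSEQ_I)
    fix e :: real assume "e > 0"
    have "x \<in> {0..T}" using x d(1) by auto
    then obtain r where r: "r > 0" "\<And>s. s \<in> {0..T} \<Longrightarrow> dist s x < r \<Longrightarrow> dist (u s) (u x) < e / 2"
      using cu \<open>e > 0\<close> unfolding continuous_on_iff by (metis half_gt_zero)
    obtain N where N: "\<And>n. n \<ge> N \<Longrightarrow> h n < r" using order_tendstoD(2)[OF h0 r(1)] unfolding eventually_sequentially by blast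
    have "norm (?A x n - u x) < e" if "n \<ge> N" for n
    proof -
      have "norm (?A x n - u x) \<le> e / 2"
      proof (rule tent_average)
        fix s assume s: "\<bar>s - x\<bar> \<le> h n"
        then have "s \<in> {0..T}" "dist s x < r" using N[OF that] h[of n] x by (auto simp: dist_real_def)
        then show "norm (u s - u x) \<le> e / 2" using r(2)[of s] by (simp add: dist_norm)
      qed (use h[of n] x cu in auto)
      then show ?thesis using \<open>e > 0\<close> by simp
    qed
    then show "\<exists>no. \<forall>n\<ge>no. norm (?A x n - u x) < e" by blast
  qed
  let ?B = "\<lambda>n. integral {0..T} (\<lambda>t. (- \<phi> n t / (2 * (h n)\<^sup>2)) *\<^sub>R c t)"
  have AB: "?A p n - ?A q n = ?B n" for n
  proof -
    have I: "(\<lambda>s. (tent (h n) (s - x) / (2 * (h n)\<^sup>2)) *\<^sub>R u s) integrable_on {0..T}" for x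
      by (intro integrable_continuous_real continuous_intros cu) (use h(1)[of n] in auto)
    have "?A p n - ?A q n = integral {0..T} (\<lambda>t. (1 / (2 * (h n)\<^sup>2)) *\<^sub>R ((tent (h n) (t - p) - tent (h n) (t - q)) *\<^sub>R u t))"
      unfolding integral_diff[symmetric, OF I I]
      by (rule Henstock_Kurzweil_Integration.integral_cong) (simp add: scaleR_diff_left[symmetric] diff_divide_distrib[symmetric])
    also have "\<dots> = (1 / (2 * (h n)\<^sup>2)) *\<^sub>R - integral {0..T} (\<lambda>t. \<phi> n t *\<^sub>R c t)"
      by (simp only: integral_cmul test)
    also have "\<dots> = integral {0..T} (\<lambda>t. (- 1 / (2 * (h n)\<^sup>2)) *\<^sub>R (\<phi> n t *\<^sub>R c t))"
      by (simp only: integral_cmul) simp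
    finally show ?thesis by simp
  qed
  obtain B where "\<forall>x \<in> c ` {0..T}. norm x \<le> B"
    using compact_imp_bounded[OF compact_continuous_image[OF c]] unfolding bounded_iff by auto
  then have B: "norm (c t) \<le> B" if "t \<in> {0..T}" for t using that by blast
  \<comment> \<open>The value \<open>1 / 2\<close> at \<open>q\<close> and \<open>p\<close> is the
    true pointwise limit, because a step vanishes at its centre.\<close>
  define g where "g t = (if q < t \<and> t < p then 1 else if t = q \<or> t = p then 1 / 2 else 0 :: real)" for t
  have "?B \<longlonglongrightarrow> integral {0..T} (\<lambda>t. g t *\<^sub>R c t)"
  proof (rule dominated_convergence(2)[where h = "\<lambda>_. B"])
    show "(\<lambda>t. (- \<phi> n t / (2 * (h n)\<^sup>2)) *\<^sub>R c t) integrable_on {0..T}" for n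
      unfolding \<phi>_def by (intro integrable_continuous_real continuous_intros c) (use h(1)[of n] in auto)
    show "norm ((- \<phi> n t / (2 * (h n)\<^sup>2)) *\<^sub>R c t) \<le> B" if "t \<in> {0..T}" for n t
    proof -
      have "\<bar>\<phi> n t\<bar> \<le> 2 * (h n)\<^sup>2"
        using smooth_step_bound[of "h n" "t - p"] smooth_step_bound[of "h n" "t - q"] h(1)[of n] unfolding \<phi>_def by argo
      then have "\<bar>- \<phi> n t / (2 * (h n)\<^sup>2)\<bar> \<le> 1" using h(1)[of n] by (simp add: abs_divide)
      then have "\<bar>- \<phi> n t / (2 * (h n)\<^sup>2)\<bar> * norm (c t) \<le> 1 * B" using B[OF that] by (intro mult_mono) auto
      then show ?thesis by simp
    qed
    show "(\<lambda>n. (- \<phi> n t / (2 * (h n)\<^sup>2)) *\<^sub>R c t) \<longlonglongrightarrow> g t *\<^sub>R c t" if "t \<in> {0..T}" for t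
    proof -
      \<comment> \<open>The smallest distance from \<open>t\<close> to the two centres, where
        \<open>d\<close> is a positive substitute for a distance that vanishes. Once
        \<open>h n < m\<close>, the quotient has its limit value.\<close>
      define m where "m = min (if t = q then d else \<bar>t - q\<bar>) (if t = p then d else \<bar>t - p\<bar>)"
      have "m > 0" using d(1) by (auto simp: m_def)
      then have "eventually (\<lambda>n. h n < m) sequentially" using order_tendstoD(2)[OF h0] by blast
      then have "eventually (\<lambda>n. - \<phi> n t / (2 * (h n)\<^sup>2) = g t) sequentially"
      proof eventually_elim
        case (elim n)
        have hq: "t \<noteq> q \<Longrightarrow> h n < \<bar>t - q\<bar>" and hp: "t \<noteq> p \<Longrightarrow> h n < \<bar>t - p\<bar>"
          using elim by (auto simp: m_def)
        have h2: "(h n)\<^sup>2 \<noteq> 0" using h(1)[of n] by simp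
        have s0: "smooth_step (h n) 0 = 0" using h(1)[of n] by (simp add: smooth_step_def)
        have R: "smooth_step (h n) (t - x) = (h n)\<^sup>2" if "x < t" "h n < \<bar>t - x\<bar>" for x
          by (rule smooth_step_right) (use that h(1)[of n] in auto)
        have L: "smooth_step (h n) (t - x) = - (h n)\<^sup>2" if "t < x" "h n < \<bar>t - x\<bar>" for x
          by (rule smooth_step_left) (use that h(1)[of n] in auto)
        consider "t < q" | "t = q" | "q < t" "t < p" | "t = p" | "p < t" by linarith
        then show ?case
        proof cases
          case 1 then show ?thesis using L[of p] L[of q] hp hq q by (simp add: \<phi>_def g_def)
        next
          case 2 then show ?thesis using L[of p] hp q s0 h2 by (simp add: \<phi>_def g_def)
        next
          case 3 then show ?thesis using L[of p] R[of q] hp hq h2 by (simp add: \<phi>_def g_def)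
        next
          case 4 then show ?thesis using R[of q] hq q s0 h2 by (simp add: \<phi>_def g_def)
        next
          case 5 then show ?thesis using R[of p] R[of q] hp hq q by (simp add: \<phi>_def g_def)
        qed
      qed
      then have "(\<lambda>n. - \<phi> n t / (2 * (h n)\<^sup>2)) \<longlonglongrightarrow> g t" by (rule tendsto_eventually)
      then show ?thesis by (intro tendsto_scaleR tendsto_const)
    qed
  qed (auto intro: integrable_const_ivl)
  moreover have "(\<lambda>n. ?A p n - ?A q n) \<longlonglongrightarrow> u p - u q"
    by (intro tendsto_diff A) (use d in auto)
  ultimately have "u p - u q = integral {0..T} (\<lambda>t. g t *\<^sub>R c t)"
    unfolding AB using LIMSEQ_unique by blast
  also have "\<dots> = integral {0..T} (\<lambda>t. if t \<in> {q..p} then c t else 0)"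
    by (rule integral_spike[of "{q, p}"]) (auto simp: g_def)
  also have "\<dots> = integral {q..p} c"
    using integral_restrict_Int[of "{0..T}" "{q..p}" c] q by (simp add: Int_absorb1)
  finally show ?thesis .
qed

text \<open>On the open interval \<open>u\<close> differs from a primitive of \<open>c\<close> by a
  constant; continuity carries this to the end points, where the derivative is one-sided.\<close>

theorem du_Bois_Reymond:
  fixes u c :: "real \<Rightarrow> 'a::euclidean_space"
  assumes T: "T > 0" and u: "H1_with_deriv T u v" and c: "continuous_on {0..T} c"
    and v: "AE t in lebesgue_on {0..T}. v t = c t" and t: "t \<in> {0..T}"
  shows "(u has_vector_derivative c t) (at t within {0..T})"
proof -
  have cu: "continuous_on {0..T} u" using u by (simp add: H1_with_deriv_def)
  define C where "C t = integral {0..t} c" for t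
  have dC: "(C has_vector_derivative c t) (at t within {0..T})" if "t \<in> {0..T}" for t
    unfolding C_def by (rule integral_has_vector_derivative[OF c that])
  have cC: "continuous_on {0..T} C"
    unfolding continuous_on_eq_continuous_within using dC has_vector_derivative_continuous by blast
  have ic: "c integrable_on {0..t}" if "t \<le> T" for t
    by (rule integrable_continuous_real[OF continuous_on_subset[OF c]]) (use that in auto)
  let ?m = "T / 2"
  have lt: "u p - C p = u q - C q" if "0 < q" "q < p" "p < T" for p q
  proof -
    have "C q + integral {q..p} c = C p" unfolding C_def
      by (rule Henstock_Kurzweil_Integration.integral_combine) (use that ic in auto)
    moreover have "u p - u q = integral {q..p} c" by (rule du_Bois_Reymond_interior[OF u c v that])
    ultimately show ?thesis by (simp add: algebra_simps)
  qed
  define k where "k = u ?m - C ?m"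
  have k: "u s - C s = k" if "s \<in> {0<..<T}" for s
    using lt[of s ?m] lt[of ?m s] that T unfolding k_def by (cases s ?m rule: linorder_cases) auto
  have eq: "u s = C s + k" if "s \<in> {0..T}" for s
  proof -
    have "u s - C s = k"
    proof (rule continuous_constant_on_closure[where S = "{0<..<T}" and f = "\<lambda>s. u s - C s"])
      show "continuous_on (closure {0<..<T}) (\<lambda>s. u s - C s)" using T by (auto intro!: continuous_intros cu cC)
      show "s \<in> closure {0<..<T}" using that T by simp
    qed (rule k)
    then show ?thesis by (simp add: algebra_simps)
  qed
  have "((\<lambda>s. C s + k) has_vector_derivative c t) (at t within {0..T})"
    using has_vector_derivative_add[OF dC[OF t] has_vector_derivative_const] by simp
  then show ?thesis
    by (rule has_vector_derivative_transform[OF t, rotated]) (rule eq)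
qed

text \<open>The equation makes the weak derivative equal almost everywhere to a continuous function
  of time, so the solution is classical at every time, end points included; this is the form of the
  equation used from here on.\<close>

lemma viscous_solution_has_vector_derivative:
  assumes en: "C1_energy_on T E" and \<epsilon>: "\<epsilon> > 0" and u: "viscous_solution T E \<epsilon> x u" and t: "t \<in> {0..T}"
  shows "(u has_vector_derivative - (1 / \<epsilon>) *\<^sub>R grad (E t) (u t)) (at t within {0..T})"
proof -
  interpret C1_energy_on T E by (rule en)
  obtain v where v: "H1_with_deriv T u v" "AE t in lebesgue_on {0..T}. \<epsilon> *\<^sub>R v t + grad (E t) (u t) = 0"
    using u unfolding viscous_solution_def by blast
  have cu: "continuous_on {0..T} u" using v by (simp add: H1_with_deriv_def)
  show ?thesis
  proof (rule du_Bois_Reymond[OF T_pos v(1) _ _ t])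
    show "continuous_on {0..T} (\<lambda>t. - (1 / \<epsilon>) *\<^sub>R grad (E t) (u t))"
      by (intro continuous_intros continuous_on_compose_energy(2) cu) auto
    show "AE t in lebesgue_on {0..T}. v t = - (1 / \<epsilon>) *\<^sub>R grad (E t) (u t)"
      using v(2)
    proof eventually_elim
      case (elim t)
      then have "\<epsilon> *\<^sub>R v t = - grad (E t) (u t)" by (simp add: eq_neg_iff_add_eq_0)
      then have "(1 / \<epsilon>) *\<^sub>R (\<epsilon> *\<^sub>R v t) = (1 / \<epsilon>) *\<^sub>R (- grad (E t) (u t))" by simp
      then show ?case using \<epsilon> by simp
    qed
  qed
qed

text \<open>The shift by \<open>C2 / C1\<close> absorbs the additive constant:
  \<open>f + C2 / C1\<close> times \<open>exp (- C1 * t)\<close> decreases in the first case, and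
  times \<open>exp (C1 * t)\<close> it increases in the second, which runs backwards in
  time.\<close>

lemma gronwall:
  fixes f f' :: "real \<Rightarrow> real"
  assumes ab: "a \<le> b" and C: "C1 > 0"
    and d: "\<And>t. t \<in> {a..b} \<Longrightarrow> (f has_real_derivative f' t) (at t within {a..b})"
  shows "(\<And>t. t \<in> {a..b} \<Longrightarrow> f' t \<le> C1 * f t + C2) \<Longrightarrow> f b + C2 / C1 \<le> (f a + C2 / C1) * exp (C1 * (b - a))"
    and "(\<And>t. t \<in> {a..b} \<Longrightarrow> - (C1 * f t + C2) \<le> f' t) \<Longrightarrow> f a + C2 / C1 \<le> (f b + C2 / C1) * exp (C1 * (b - a))"
proof -
  have cf: "continuous_on {a..b} f"
    unfolding continuous_on_eq_continuous_within using d DERIV_continuous by blast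
  have df: "(f has_real_derivative f' t) (at t)" if "a < t" "t < b" for t
    using d[of t] that by (simp add: at_within_Icc_at)
  have dg: "((\<lambda>t. (f t + C2 / C1) * exp (k * t)) has_real_derivative (f' t + k * (f t + C2 / C1)) * exp (k * t)) (at t)"
    if "a < t" "t < b" for t k
    by (rule derivative_eq_intros df[OF that] refl | simp add: algebra_simps)+
  {
    assume le: "\<And>t. t \<in> {a..b} \<Longrightarrow> f' t \<le> C1 * f t + C2"
    have "(f b + C2 / C1) * exp (- C1 * b) \<le> (f a + C2 / C1) * exp (- C1 * a)"
    proof (rule DERIV_nonpos_imp_decreasing_open[OF ab])
      fix t assume t: "a < t" "t < b"
      have "f' t + - C1 * (f t + C2 / C1) \<le> 0" using le[of t] t C by (simp add: distrib_left)
      then have "(f' t + - C1 * (f t + C2 / C1)) * exp (- C1 * t) \<le> 0" by (simp add: mult_nonpos_nonneg)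
      then show "\<exists>y. ((\<lambda>t. (f t + C2 / C1) * exp (- C1 * t)) has_real_derivative y) (at t) \<and> y \<le> 0"
        using dg[OF t] by blast
    qed (intro continuous_intros cf)
    then have "(f b + C2 / C1) * exp (- C1 * b) * exp (C1 * b) \<le> (f a + C2 / C1) * exp (- C1 * a) * exp (C1 * b)"
      by (rule mult_right_mono) simp
    then show "f b + C2 / C1 \<le> (f a + C2 / C1) * exp (C1 * (b - a))"
      by (simp only: mult.assoc exp_add[symmetric]) (simp add: algebra_simps)
  }
  {
    assume le: "\<And>t. t \<in> {a..b} \<Longrightarrow> - (C1 * f t + C2) \<le> f' t"
    have "(f a + C2 / C1) * exp (C1 * a) \<le> (f b + C2 / C1) * exp (C1 * b)"
    proof (rule DERIV_nonneg_imp_increasing_open[OF ab])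
      fix t assume t: "a < t" "t < b"
      have "f' t + C1 * (f t + C2 / C1) \<ge> 0" using le[of t] t C by (simp add: distrib_left)
      then have "(f' t + C1 * (f t + C2 / C1)) * exp (C1 * t) \<ge> 0" by simp
      then show "\<exists>y. ((\<lambda>t. (f t + C2 / C1) * exp (C1 * t)) has_real_derivative y) (at t) \<and> y \<ge> 0"
        using dg[OF t] by blast
    qed (intro continuous_intros cf)
    then have "(f a + C2 / C1) * exp (C1 * a) * exp (- C1 * a) \<le> (f b + C2 / C1) * exp (C1 * b) * exp (- C1 * a)"
      by (rule mult_right_mono) simp
    then show "f a + C2 / C1 \<le> (f b + C2 / C1) * exp (C1 * (b - a))"
      by (simp only: mult.assoc exp_add[symmetric]) (simp add: algebra_simps)
  }
qed

section \<open>Energy balance and a priori bounds\<close>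

context C1_energy_on
begin

text \<open>The velocity is antiparallel to the gradient. Hence their inner product is minus the
  squared gradient norm over \<epsilon>, which is also minus the product of the two norms: equality
  in Cauchy-Schwarz.\<close>

lemma energy_balance:
  assumes \<epsilon>: "\<epsilon> > 0"
    and y: "\<And>t. t \<in> {0..T} \<Longrightarrow> (y has_vector_derivative - (1 / \<epsilon>) *\<^sub>R grad (E t) (y t)) (at t within {0..T})"
    and st: "0 \<le> s" "s \<le> t" "t \<le> T"
  shows "E t (y t) - E s (y s) =
    integral {s..t} (\<lambda>r. time_deriv T E r (y r)) - integral {s..t} (\<lambda>r. (norm (grad (E r) (y r)))\<^sup>2 / \<epsilon>)"
proof -
  have cy: "continuous_on {0..T} y"
    unfolding continuous_on_eq_continuous_within using y has_vector_derivative_continuous by blast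
  have sub: "{s..t} \<subseteq> {0..T}" using st by auto
  have cy': "continuous_on {s..t} y" by (rule continuous_on_subset[OF cy sub])
  have i1: "(\<lambda>r. time_deriv T E r (y r)) integrable_on {s..t}"
    by (intro integrable_continuous_real continuous_on_compose_energy(3) continuous_on_id cy') (use sub in auto)
  have i2: "(\<lambda>r. (norm (grad (E r) (y r)))\<^sup>2 / \<epsilon>) integrable_on {s..t}"
    by (intro integrable_continuous_real continuous_intros continuous_on_compose_energy(2) continuous_on_id cy') (use sub \<epsilon> in auto)
  have "((\<lambda>r. time_deriv T E r (y r) - (norm (grad (E r) (y r)))\<^sup>2 / \<epsilon>) has_integral E t (y t) - E s (y s)) {s..t}"
  proof (rule fundamental_theorem_of_calculus[OF st(2)])
    fix r assume r: "r \<in> {s..t}"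
    then have r': "r \<in> {0..T}" using sub by auto
    have "((\<lambda>s. E s (y s)) has_real_derivative time_deriv T E r (y r) - (norm (grad (E r) (y r)))\<^sup>2 / \<epsilon>) (at r within {0..T})"
      using energy_chain[OF r' y[OF r']] by (simp add: power2_norm_eq_inner)
    then show "((\<lambda>s. E s (y s)) has_vector_derivative time_deriv T E r (y r) - (norm (grad (E r) (y r)))\<^sup>2 / \<epsilon>) (at r within {s..t})"
      using has_field_derivative_subset[OF _ sub] by (simp add: has_real_derivative_iff_has_vector_derivative)
  qed
  from integral_unique[OF this] show ?thesis by (simp add: integral_diff[OF i1 i2])
qed

text \<open>Coercivity concerns the supremum of the energy over all times, whereas the flow controls
  \<open>E t (y n t)\<close> at its own time only. Gronwall is therefore applied twice, along the
  trajectory and then in time at a fixed point; hence the two exponentials in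
  \<open>\<rho>\<close>.\<close>

theorem viscous_bounds:
  fixes y :: "nat \<Rightarrow> real \<Rightarrow> 'a"
  assumes nonneg: "\<And>t u. t \<in> {0..T} \<Longrightarrow> 0 \<le> E t u"
    and coercive: "\<And>\<rho>. \<rho> > 0 \<Longrightarrow> bounded {u. (SUP t\<in>{0..T}. \<bar>E t u\<bar>) \<le> \<rho>}"
    and C: "C1 > 0" "C2 > 0" and growth: "\<And>t u. t \<in> {0..T} \<Longrightarrow> \<bar>time_deriv T E t u\<bar> \<le> C1 * E t u + C2"
    and \<epsilon>: "\<And>n. \<epsilon> n > 0" and x: "(\<lambda>n. y n 0) \<longlonglongrightarrow> u0"
    and y: "\<And>n t. t \<in> {0..T} \<Longrightarrow> (y n has_vector_derivative - (1 / \<epsilon> n) *\<^sub>R grad (E t) (y n t)) (at t within {0..T})"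
  obtains R M where "\<And>n t. t \<in> {0..T} \<Longrightarrow> norm (y n t) \<le> R"
    "\<And>n. integral {0..T} (\<lambda>r. (norm (grad (E r) (y n r)))\<^sup>2 / \<epsilon> n) \<le> M"
proof -
  have T0: "0 \<in> {0..T}" using T_pos by simp
  have "continuous_on UNIV (\<lambda>u. E 0 u)"
    by (rule continuous_on_compose_energy(1)[OF continuous_on_const continuous_on_id]) (rule T0)
  then have "(\<lambda>n. E 0 (y n 0)) \<longlonglongrightarrow> E 0 u0" using x by (rule continuous_on_tendsto_compose) auto
  then obtain K where K: "\<And>n. norm (E 0 (y n 0)) \<le> K" using Bseq_eq_bounded convergent_imp_Bseq convergentI by (metis BseqE)
  have K0: "K \<ge> 0" using K[of 0] norm_ge_zero order_trans by blast
  define c where "c = C2 / C1"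
  have c: "c > 0" using C by (simp add: c_def)
  define \<rho> where "\<rho> = (K + c) * exp (C1 * T) * exp (C1 * T)"
  have \<rho>: "\<rho> > 0" using K0 c by (simp add: \<rho>_def)
  have e1: "E t (y n t) + c \<le> (K + c) * exp (C1 * T)" if t: "t \<in> {0..T}" for n t
  proof -
    have sub: "{0..t} \<subseteq> {0..T}" using t by auto
    have "E t (y n t) + C2 / C1 \<le> (E 0 (y n 0) + C2 / C1) * exp (C1 * (t - 0))"
    proof (rule gronwall(1)[OF _ C(1)])
      fix r assume "r \<in> {0..t}"
      then have r: "r \<in> {0..T}" using sub by auto
      show "((\<lambda>s. E s (y n s)) has_real_derivative time_deriv T E r (y n r) + grad (E r) (y n r) \<bullet> (- (1 / \<epsilon> n) *\<^sub>R grad (E r) (y n r))) (at r within {0..t})"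
        by (rule has_field_derivative_subset[OF energy_chain[OF r y[OF r]] sub])
      show "time_deriv T E r (y n r) + grad (E r) (y n r) \<bullet> (- (1 / \<epsilon> n) *\<^sub>R grad (E r) (y n r)) \<le> C1 * E r (y n r) + C2"
      proof -
        have "0 \<le> grad (E r) (y n r) \<bullet> grad (E r) (y n r) / \<epsilon> n" using \<epsilon>[of n] by simp
        then show ?thesis using growth[OF r, of "y n r"] by (simp add: abs_le_iff)
      qed
    qed (use t in auto)
    also have "\<dots> \<le> (K + c) * exp (C1 * T)"
      using K[of n] t C K0 c nonneg[OF T0] by (intro mult_mono) (auto simp: c_def)
    finally show ?thesis by (simp add: c_def)
  qed
  have e2: "E s u + c \<le> (E t u + c) * exp (C1 * T)" if s: "s \<in> {0..T}" and t: "t \<in> {0..T}" for s t u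
  proof -
    have "E s u + c \<le> (E t u + c) * exp (C1 * \<bar>s - t\<bar>)"
    proof (cases "t \<le> s")
      case True
      have "E s u + C2 / C1 \<le> (E t u + C2 / C1) * exp (C1 * (s - t))"
      proof (rule gronwall(1)[OF True C(1)])
        fix r assume "r \<in> {t..s}"
        then have r: "r \<in> {0..T}" using s t by auto
        show "((\<lambda>s. E s u) has_real_derivative time_deriv T E r u) (at r within {t..s})"
          by (rule has_field_derivative_subset[OF energy_time_derivative[OF r]]) (use s t in auto)
        show "time_deriv T E r u \<le> C1 * E r u + C2" using growth[OF r, of u] by simp
      qed
      then show ?thesis using True by (simp add: c_def)
    next
      case False
      then have "s \<le> t" by simp
      have "E s u + C2 / C1 \<le> (E t u + C2 / C1) * exp (C1 * (t - s))"
      proof (rule gronwall(2)[OF \<open>s \<le> t\<close> C(1)])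
        fix r assume "r \<in> {s..t}"
        then have r: "r \<in> {0..T}" using s t by auto
        show "((\<lambda>s. E s u) has_real_derivative time_deriv T E r u) (at r within {s..t})"
          by (rule has_field_derivative_subset[OF energy_time_derivative[OF r]]) (use s t in auto)
        show "- (C1 * E r u + C2) \<le> time_deriv T E r u" using growth[OF r, of u] by (simp add: abs_le_iff)
      qed
      then show ?thesis using False by (simp add: c_def)
    qed
    also have "\<dots> \<le> (E t u + c) * exp (C1 * T)"
      using s t C nonneg[OF t, of u] c by (intro mult_left_mono) auto
    finally show ?thesis .
  qed
  have e3: "E s (y n t) \<le> \<rho>" if s: "s \<in> {0..T}" and t: "t \<in> {0..T}" for s t n
  proof -
    have "E s (y n t) + c \<le> (E t (y n t) + c) * exp (C1 * T)" by (rule e2[OF s t])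
    also have "\<dots> \<le> (K + c) * exp (C1 * T) * exp (C1 * T)" using e1[OF t, of n] by (rule mult_right_mono) simp
    finally show ?thesis using c by (simp add: \<rho>_def)
  qed
  obtain R where R: "\<And>u. (SUP t\<in>{0..T}. \<bar>E t u\<bar>) \<le> \<rho> \<Longrightarrow> norm u \<le> R"
    using coercive[OF \<rho>] unfolding bounded_iff by blast
  have "norm (y n t) \<le> R" if t: "t \<in> {0..T}" for n t
    by (rule R, rule cSUP_least) (use T0 e3[OF _ t] nonneg in auto)
  \<comment> \<open>The balance over \<open>{0..T}\<close> bounds the dissipation by the initial
    energy plus the power, because the final energy is nonnegative.\<close>
  moreover have "integral {0..T} (\<lambda>r. (norm (grad (E r) (y n r)))\<^sup>2 / \<epsilon> n) \<le> K + (C1 * \<rho> + C2) * T" for n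
  proof -
    have cy: "continuous_on {0..T} (y n)"
      unfolding continuous_on_eq_continuous_within using y has_vector_derivative_continuous by blast
    have "E T (y n T) - E 0 (y n 0) =
      integral {0..T} (\<lambda>r. time_deriv T E r (y n r)) - integral {0..T} (\<lambda>r. (norm (grad (E r) (y n r)))\<^sup>2 / \<epsilon> n)"
      by (rule energy_balance[OF \<epsilon> y]) (use T_pos in auto)
    moreover have "integral {0..T} (\<lambda>r. time_deriv T E r (y n r)) \<le> integral {0..T} (\<lambda>r. C1 * \<rho> + C2)"
    proof (rule integral_le)
      show "(\<lambda>r. time_deriv T E r (y n r)) integrable_on {0..T}"
        by (intro integrable_continuous_real continuous_on_compose_energy(3) continuous_on_id cy) auto
      fix r assume r: "r \<in> {0..T}"
      have "time_deriv T E r (y n r) \<le> C1 * E r (y n r) + C2" using growth[OF r, of "y n r"] by simp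
      also have "\<dots> \<le> C1 * \<rho> + C2" using e3[OF r r, of n] C by simp
      finally show "time_deriv T E r (y n r) \<le> C1 * \<rho> + C2" .
    qed auto
    moreover have "integral {0..T} (\<lambda>r. C1 * \<rho> + C2) = (C1 * \<rho> + C2) * T" using T_pos by simp
    moreover have "E 0 (y n 0) \<le> K" using K[of n] by simp
    moreover have "0 \<le> E T (y n T)" by (rule nonneg) (use T_pos in auto)
    ultimately show ?thesis by linarith
  qed
  ultimately show ?thesis by (rule that)
qed

end

section \<open>Construction of admissible curves\<close>

text \<open>Finitely many critical times determine the partition in the definition of admissible curves, so that,
  unlike admissible curves, these paths can be joined at arbitrary points.\<close>

definition dissipation_path ::
    "(real \<Rightarrow> 'a::euclidean_space \<Rightarrow> real) \<Rightarrow> real \<Rightarrow> 'a \<Rightarrow> 'a \<Rightarrow> real \<Rightarrow> bool" where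
  "dissipation_path E t a b K \<longleftrightarrow>
     (\<exists>\<theta> \<theta>' S L. \<theta> 0 = a \<and> \<theta> 1 = b \<and> L-lipschitz_on {0..1} \<theta> \<and> finite S \<and>
        (\<forall>s\<in>{0..1} - S. (\<theta> has_vector_derivative \<theta>' s) (at s)) \<and>
        finite {s\<in>{0..1}. \<theta> s \<in> crit E t} \<and>
        ((\<lambda>s. norm (grad (E t) (\<theta> s)) * norm (\<theta>' s)) has_integral K) {0..1::real})"

lemma finite_set_enumeration:
  fixes A :: "real set"
  assumes "finite A" "a \<in> A" "b \<in> A" "A \<subseteq> {a..b}"
  obtains j and \<tau> :: "nat \<Rightarrow> real" where "\<tau> 0 = a" "\<tau> j = b" "\<And>i. i < j \<Longrightarrow> \<tau> i < \<tau> (Suc i)"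
    "\<And>i. i \<le> j \<Longrightarrow> \<tau> i \<in> A" "\<And>i r. i < j \<Longrightarrow> r \<in> {\<tau> i<..<\<tau> (Suc i)} \<Longrightarrow> r \<notin> A"
proof -
  define xs where "xs = sorted_list_of_set A"
  have xs: "set xs = A" "sorted xs" "distinct xs" using assms(1) by (simp_all add: xs_def)
  then have strict: "xs ! i < xs ! k" if "i < k" "k < length xs" for i k
    using that sorted_nth_mono[of xs i k] by (auto simp: less_le nth_eq_iff_index_eq)
  have ne: "length xs > 0" using xs(1) assms(2) by (cases xs) auto
  have mem: "xs ! i \<in> A" if "i < length xs" for i using that xs(1) nth_mem by blast
  show ?thesis
  proof (rule that[of "\<lambda>i. xs ! i" "length xs - 1"])
    obtain i where "i < length xs" "xs ! i = a" using assms(2) xs(1) by (metis in_set_conv_nth)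
    then show "xs ! 0 = a" using sorted_nth_mono[OF xs(2), of 0 i] mem[OF ne] assms(4) by auto
    obtain i where i: "i < length xs" "xs ! i = b" using assms(3) xs(1) by (metis in_set_conv_nth)
    have "xs ! i \<le> xs ! (length xs - 1)" by (rule sorted_nth_mono[OF xs(2)]) (use i ne in auto)
    moreover have "xs ! (length xs - 1) \<in> A" by (rule mem) (use ne in simp)
    ultimately show "xs ! (length xs - 1) = b" using i(2) assms(4) by force
    show "xs ! i < xs ! Suc i" if "i < length xs - 1" for i using strict[of i "Suc i"] that by simp
    show "xs ! i \<in> A" if "i \<le> length xs - 1" for i by (rule mem) (use that ne in arith)
    show "r \<notin> A" if i: "i < length xs - 1" and r: "r \<in> {xs ! i<..<xs ! Suc i}" for i r
    proof
      assume "r \<in> A"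
      then obtain k where k: "k < length xs" "xs ! k = r" using xs(1) by (metis in_set_conv_nth)
      have il: "i < length xs" "Suc i < length xs" using i by arith+
      show False
      proof (cases "k \<le> i")
        case True then show False using sorted_nth_mono[OF xs(2), of k i] k r il by auto
      next
        case False then show False using sorted_nth_mono[OF xs(2), of "Suc i" k] k r il by auto
      qed
    qed
  qed
qed

text \<open>The critical times together with \<open>0\<close> and \<open>1\<close> form a partition
  as admissibility demands, and off the finite set \<open>S\<close> the derivative
  \<open>\<theta>'\<close> is the one occurring in the cost, so that the integral there is
  \<open>K\<close>.\<close>

lemma dissipation_path_cost:
  assumes "dissipation_path E t a b K"
  shows "cost E t a b \<le> ennreal K"
proof (cases "a = b")
  case False
  obtain \<theta> \<theta>' S L where \<theta>: "\<theta> 0 = a" "\<theta> 1 = b" "L-lipschitz_on {0..1} \<theta>" "finite S"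
    "\<And>s. s \<in> {0..1} - S \<Longrightarrow> (\<theta> has_vector_derivative \<theta>' s) (at s)"
    "finite {s\<in>{0..1}. \<theta> s \<in> crit E t}"
    "((\<lambda>s. norm (grad (E t) (\<theta> s)) * norm (\<theta>' s)) has_integral K) {0..1::real}"
    using assms unfolding dissipation_path_def by blast
  have "finite ({0, 1} \<union> {s\<in>{0..1}. \<theta> s \<in> crit E t})" "0 \<in> {0, 1} \<union> {s\<in>{0..1}. \<theta> s \<in> crit E t}"
    "1 \<in> {0, 1} \<union> {s\<in>{0..1}. \<theta> s \<in> crit E t}" "{0, 1} \<union> {s\<in>{0..1}. \<theta> s \<in> crit E t} \<subseteq> {0..1}"
    using \<theta>(6) by auto
  then obtain j and \<tau> :: "nat \<Rightarrow> real" where \<tau>: "\<tau> 0 = 0" "\<tau> j = 1" "\<And>i. i < j \<Longrightarrow> \<tau> i < \<tau> (Suc i)"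
    "\<And>i. i \<le> j \<Longrightarrow> \<tau> i \<in> {0, 1} \<union> {s\<in>{0..1}. \<theta> s \<in> crit E t}"
    "\<And>i r. i < j \<Longrightarrow> r \<in> {\<tau> i<..<\<tau> (Suc i)} \<Longrightarrow> r \<notin> {0, 1} \<union> {s\<in>{0..1}. \<theta> s \<in> crit E t}"
    by (rule finite_set_enumeration) blast
  have \<tau>01: "\<tau> i \<in> {0..1}" if "i \<le> j" for i using \<tau>(4)[OF that] by auto
  have \<tau>lt: "\<tau> i < \<tau> k" if "i < k" "k \<le> j" for i k
    using that
  proof (induction rule: less_Suc_induct)
    case (1 i) then show ?case using \<tau>(3) by simp
  next
    case (2 i k l) then show ?case by force
  qed
  have "\<theta> \<in> admissible E t a b"
    unfolding admissible_def
  proof (intro CollectI conjI exI[of _ j] exI[of _ \<tau>] ballI allI impI)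
    show "continuous_on {0..1} \<theta>" by (rule lipschitz_on_continuous_on[OF \<theta>(3)])
    show "locally_lipschitz_on {\<tau> i<..<\<tau> (Suc i)} \<theta>" if "i < j" for i
      unfolding locally_lipschitz_on_def
    proof
      fix x
      have "L-lipschitz_on (ball x 1 \<inter> {\<tau> i<..<\<tau> (Suc i)}) \<theta>"
        by (rule lipschitz_on_subset[OF \<theta>(3)]) (use \<tau>01[of i] \<tau>01[of "Suc i"] that in auto)
      then show "\<exists>e>0. \<exists>L. L-lipschitz_on (ball x e \<inter> {\<tau> i<..<\<tau> (Suc i)}) \<theta>"
        by (intro exI[of _ 1] conjI exI[of _ L]) auto
    qed
    \<comment> \<open>Strict monotonicity separates interior partition times from \<open>0\<close>
      and \<open>1\<close>, so they come from the set of critical times.\<close>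
    show "\<theta> (\<tau> i) \<in> crit E t" if "i \<in> {0<..<j}" for i
      using \<tau>(4)[of i] \<tau>lt[of 0 i] \<tau>lt[of i j] \<tau>(1,2) that by auto
    show "\<theta> r \<notin> crit E t" if "i < j" "r \<in> {\<tau> i<..<\<tau> (Suc i)}" for i r
      using \<tau>(5)[OF that] that \<tau>01[of i] \<tau>01[of "Suc i"] by auto
  qed (use \<theta> \<tau> in auto)
  then have "cost E t a b \<le> (\<integral>\<^sup>+s. ennreal (norm (grad (E t) (\<theta> s)) * norm (vector_derivative \<theta> (at s))) \<partial>lebesgue_on {0..1})"
    using False unfolding cost_def by (auto intro: INF_lower)
  also have "\<dots> = (\<integral>\<^sup>+s. ennreal (norm (grad (E t) (\<theta> s)) * norm (vector_derivative \<theta> (at s))) * indicator {0..1} s \<partial>lebesgue)"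
    by (simp add: nn_integral_restrict_space)
  also have "\<dots> = (\<integral>\<^sup>+s. indicator {0..1} s * (norm (grad (E t) (\<theta> s)) * norm (\<theta>' s)) \<partial>lebesgue)"
  proof (rule nn_integral_cong_AE)
    have "AE s in lebesgue. s \<notin> S"
      by (rule AE_not_in) (use \<theta>(4) in \<open>simp add: negligible_iff_null_sets[symmetric] negligible_finite\<close>)
    then show "AE s in lebesgue. ennreal (norm (grad (E t) (\<theta> s)) * norm (vector_derivative \<theta> (at s))) * indicator {0..1} s =
        ennreal (indicator {0..1} s * (norm (grad (E t) (\<theta> s)) * norm (\<theta>' s)))"
      by eventually_elim (use vector_derivative_at[OF \<theta>(5)] in \<open>auto split: split_indicator\<close>)
  qed
  also have "\<dots> = (\<integral>\<^sup>+s. indicator {0..1} s * (norm (grad (E t) (\<theta> s)) * norm (\<theta>' s)) \<partial>lborel)"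
    by (simp add: nn_integral_completion)
  also have "\<dots> = ennreal K"
    by (rule nn_integral_has_integral_lebesgue[OF _ \<theta>(7)]) simp
  finally show ?thesis .
qed (simp add: cost_def)

text \<open>Both curves are run at double speed; the factor 2 in the velocity cancels the factor 1/2
  from the substitution. The junction time joins the exceptional set, since the velocities may
  differ there.\<close>

lemma dissipation_path_join:
  assumes "dissipation_path E t a z K1" "dissipation_path E t z b K2"
  shows "dissipation_path E t a b (K1 + K2)"
proof -
  obtain \<theta> \<theta>' S L where \<theta>: "\<theta> 0 = a" "\<theta> 1 = z" "L-lipschitz_on {0..1} \<theta>" "finite S"
    "\<And>s. s \<in> {0..1} - S \<Longrightarrow> (\<theta> has_vector_derivative \<theta>' s) (at s)"
    "finite {s\<in>{0..1}. \<theta> s \<in> crit E t}"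
    "((\<lambda>s. norm (grad (E t) (\<theta> s)) * norm (\<theta>' s)) has_integral K1) {0..1::real}"
    using assms(1) unfolding dissipation_path_def by blast
  obtain \<eta> \<eta>' R M where \<eta>: "\<eta> 0 = z" "\<eta> 1 = b" "M-lipschitz_on {0..1} \<eta>" "finite R"
    "\<And>s. s \<in> {0..1} - R \<Longrightarrow> (\<eta> has_vector_derivative \<eta>' s) (at s)"
    "finite {s\<in>{0..1}. \<eta> s \<in> crit E t}"
    "((\<lambda>s. norm (grad (E t) (\<eta> s)) * norm (\<eta>' s)) has_integral K2) {0..1::real}"
    using assms(2) unfolding dissipation_path_def by blast
  define \<zeta> where "\<zeta> s = (if s \<le> 1/2 then \<theta> (2 * s) else \<eta> (2 * s - 1))" for s
  define \<zeta>' where "\<zeta>' s = (if s \<le> 1/2 then 2 *\<^sub>R \<theta>' (2 * s) else 2 *\<^sub>R \<eta>' (2 * s - 1))" for s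
  define Q where "Q = insert (1/2) ((\<lambda>s. s / 2) ` S \<union> (\<lambda>s. (s + 1) / 2) ` R)"
  have l2: "2-lipschitz_on U (\<lambda>s. 2 * s - c)" for U and c :: real
    by (rule lipschitz_onI) (auto simp: dist_real_def abs_if)
  have "(max (L * 2) (M * 2))-lipschitz_on {0..1} \<zeta>"
    unfolding \<zeta>_def
  proof (rule lipschitz_on_concat_max)
    show "(L * 2)-lipschitz_on {0..1/2} (\<lambda>s. \<theta> (2 * s))"
      by (rule lipschitz_on_compose2[OF l2[of _ 0, simplified]], rule lipschitz_on_subset[OF \<theta>(3)]) auto
    show "(M * 2)-lipschitz_on {1/2..1} (\<lambda>s. \<eta> (2 * s - 1))"
      by (rule lipschitz_on_compose2[OF l2], rule lipschitz_on_subset[OF \<eta>(3)]) auto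
    show "\<theta> (2 * (1/2)) = \<eta> (2 * (1/2) - 1)" using \<theta>(2) \<eta>(1) by simp
  qed
  moreover have "(\<zeta> has_vector_derivative \<zeta>' s) (at s)" if s: "s \<in> {0..1} - Q" for s
  proof (cases "s < 1/2")
    case True
    have "2 * s \<notin> S"
    proof
      assume "2 * s \<in> S"
      then have "(\<lambda>s. s / 2) (2 * s) \<in> Q" unfolding Q_def by blast
      then show False using s by simp
    qed
    then have d: "(\<theta> has_vector_derivative \<theta>' (2 * s)) (at (2 * s))" using \<theta>(5)[of "2 * s"] s True by auto
    have d2: "((\<lambda>s. 2 * s) has_vector_derivative 2) (at s)" by (auto intro!: derivative_eq_intros)
    have "((\<lambda>s. \<theta> (2 * s)) has_vector_derivative 2 *\<^sub>R \<theta>' (2 * s)) (at s)"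
      using vector_diff_chain_at[OF d2 d] by (simp add: o_def)
    then have "(\<zeta> has_vector_derivative 2 *\<^sub>R \<theta>' (2 * s)) (at s)"
      by (rule has_vector_derivative_transform_within_open[where S = "{..<1/2}"]) (use True in \<open>auto simp: \<zeta>_def\<close>)
    then show ?thesis using True by (simp add: \<zeta>'_def)
  next
    case False
    have "s \<noteq> 1/2" using s by (auto simp: Q_def)
    then have gt: "1/2 < s" using False by simp
    have "2 * s - 1 \<notin> R"
    proof
      assume "2 * s - 1 \<in> R"
      then have "(\<lambda>s. (s + 1) / 2) (2 * s - 1) \<in> Q" unfolding Q_def by blast
      then show False using s by simp
    qed
    then have d: "(\<eta> has_vector_derivative \<eta>' (2 * s - 1)) (at (2 * s - 1))" using \<eta>(5)[of "2 * s - 1"] s gt by auto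
    have d2: "((\<lambda>s. 2 * s - 1) has_vector_derivative 2) (at s)" by (auto intro!: derivative_eq_intros)
    have "((\<lambda>s. \<eta> (2 * s - 1)) has_vector_derivative 2 *\<^sub>R \<eta>' (2 * s - 1)) (at s)"
      using vector_diff_chain_at[OF d2 d] by (simp add: o_def)
    then have "(\<zeta> has_vector_derivative 2 *\<^sub>R \<eta>' (2 * s - 1)) (at s)"
      by (rule has_vector_derivative_transform_within_open[where S = "{1/2<..}"]) (use gt in \<open>auto simp: \<zeta>_def\<close>)
    then show ?thesis using gt by (simp add: \<zeta>'_def)
  qed
  moreover have "finite {s\<in>{0..1}. \<zeta> s \<in> crit E t}"
  proof (rule finite_subset)
    show "{s\<in>{0..1}. \<zeta> s \<in> crit E t} \<subseteq> (\<lambda>s. s / 2) ` {s\<in>{0..1}. \<theta> s \<in> crit E t} \<union> (\<lambda>s. (s + 1) / 2) ` {s\<in>{0..1}. \<eta> s \<in> crit E t}"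
    proof
      fix s assume s: "s \<in> {s\<in>{0..1}. \<zeta> s \<in> crit E t}"
      show "s \<in> (\<lambda>s. s / 2) ` {s\<in>{0..1}. \<theta> s \<in> crit E t} \<union> (\<lambda>s. (s + 1) / 2) ` {s\<in>{0..1}. \<eta> s \<in> crit E t}"
      proof (cases "s \<le> 1/2")
        case True
        then have "2 * s \<in> {s\<in>{0..1}. \<theta> s \<in> crit E t}" using s by (auto simp: \<zeta>_def)
        then have "(\<lambda>s. s / 2) (2 * s) \<in> (\<lambda>s. s / 2) ` {s\<in>{0..1}. \<theta> s \<in> crit E t}" by (rule imageI)
        then show ?thesis by simp
      next
        case False
        then have "2 * s - 1 \<in> {s\<in>{0..1}. \<eta> s \<in> crit E t}" using s by (auto simp: \<zeta>_def)
        then have "(\<lambda>s. (s + 1) / 2) (2 * s - 1) \<in> (\<lambda>s. (s + 1) / 2) ` {s\<in>{0..1}. \<eta> s \<in> crit E t}" by (rule imageI)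
        then show ?thesis by simp
      qed
    qed
  qed (use \<theta>(6) \<eta>(6) in simp)
  moreover have "((\<lambda>s. norm (grad (E t) (\<zeta> s)) * norm (\<zeta>' s)) has_integral K1 + K2) {0..1}"
  proof (rule has_integral_combine)
    have "((\<lambda>s. norm (grad (E t) (\<theta> (2 * s))) * norm (\<theta>' (2 * s))) has_integral K1 / 2) {0..1/2}"
      using has_integral_affinity'[of "\<lambda>s. norm (grad (E t) (\<theta> s)) * norm (\<theta>' s)" K1 "0::real" 1 2 0] \<theta>(7) by simp
    from has_integral_mult_right[OF this, of 2]
    have "((\<lambda>s. norm (grad (E t) (\<theta> (2 * s))) * norm (2 *\<^sub>R \<theta>' (2 * s))) has_integral K1) {0..1/2}" by (simp add: mult_ac)
    then show "((\<lambda>s. norm (grad (E t) (\<zeta> s)) * norm (\<zeta>' s)) has_integral K1) {0..1/2}"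
      by (rule has_integral_eq[rotated]) (auto simp: \<zeta>_def \<zeta>'_def)
    have "((\<lambda>s. norm (grad (E t) (\<eta> (2 * s - 1))) * norm (\<eta>' (2 * s - 1))) has_integral K2 / 2) {1/2..1}"
      using has_integral_affinity'[of "\<lambda>s. norm (grad (E t) (\<eta> s)) * norm (\<eta>' s)" K2 "0::real" 1 2 "-1"] \<eta>(7) by simp
    from has_integral_mult_right[OF this, of 2]
    have i: "((\<lambda>s. norm (grad (E t) (\<eta> (2 * s - 1))) * norm (2 *\<^sub>R \<eta>' (2 * s - 1))) has_integral K2) {1/2..1}" by (simp add: mult_ac)
    show "((\<lambda>s. norm (grad (E t) (\<zeta> s)) * norm (\<zeta>' s)) has_integral K2) {1/2..1}"
      by (rule has_integral_spike_finite[of "{1/2}", OF _ _ i]) (auto simp: \<zeta>_def \<zeta>'_def)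
  qed auto
  moreover have "finite Q" using \<theta>(4) \<eta>(4) by (simp add: Q_def)
  moreover have "\<zeta> 0 = a" "\<zeta> 1 = b" using \<theta>(1) \<eta>(2) by (auto simp: \<zeta>_def)
  ultimately show ?thesis unfolding dissipation_path_def by blast
qed

section \<open>Segments, arcs and surgery on a trajectory\<close>

context C1_energy_on
begin

text \<open>A nondegenerate segment is traversed injectively, so at most one critical point on it
  means at most one critical time.\<close>

lemma dissipation_path_segment:
  assumes t: "t \<in> {0..T}" and pq: "p \<noteq> q" and seg: "closed_segment p q \<inter> crit E t \<subseteq> {z}"
    and \<Gamma>: "\<And>x. x \<in> closed_segment p q \<Longrightarrow> norm (grad (E t) x) \<le> \<Gamma>"
  obtains K where "dissipation_path E t p q K" "K \<le> \<Gamma> * dist p q"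
proof -
  let ?\<theta> = "\<lambda>s::real. p + s *\<^sub>R (q - p)"
  let ?f = "\<lambda>s. norm (grad (E t) (?\<theta> s)) * norm (q - p)"
  have in_seg: "?\<theta> s \<in> closed_segment p q" if "s \<in> {0..1}" for s
    using that unfolding in_segment by (intro exI[of _ s]) (auto simp: algebra_simps)
  have c: "continuous_on {0..1} ?f"
    by (intro continuous_intros continuous_on_compose_energy(2)) (use t in auto)
  then have i: "(?f has_integral integral {0..1} ?f) {0..1}" by (intro integrable_integral integrable_continuous_real)
  have "integral {0..1} ?f \<le> integral {0..1::real} (\<lambda>_. \<Gamma> * norm (q - p))"
    by (rule integral_le) (use i \<Gamma>[OF in_seg] in \<open>auto intro!: mult_right_mono\<close>)
  then have le: "integral {0..1} ?f \<le> \<Gamma> * dist p q" by (simp add: dist_norm norm_minus_commute)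
  have inj: "inj_on ?\<theta> {0..1}" using pq by (auto simp: inj_on_def)
  have "?\<theta> ` {s\<in>{0..1}. ?\<theta> s \<in> crit E t} \<subseteq> {z}" using in_seg seg by blast
  then have "finite (?\<theta> ` {s\<in>{0..1}. ?\<theta> s \<in> crit E t})" by (rule finite_subset) simp
  then have fin: "finite {s\<in>{0..1}. ?\<theta> s \<in> crit E t}"
    by (rule finite_imageD) (rule inj_on_subset[OF inj], auto)
  have "dissipation_path E t p q (integral {0..1} ?f)"
    unfolding dissipation_path_def
  proof (rule exI[of _ ?\<theta>], rule exI[of _ "\<lambda>_. q - p"], rule exI[of _ "{}"], rule exI[of _ "norm (q - p)"], intro conjI ballI)
    show "(norm (q - p))-lipschitz_on {0..1} ?\<theta>"
      by (rule lipschitz_onI) (auto simp: dist_norm scaleR_diff_left[symmetric] mult.commute)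
    show "(?\<theta> has_vector_derivative q - p) (at s)" for s
      by (auto intro!: derivative_eq_intros)
  qed (use fin i in auto)
  then show ?thesis using le by (rule that)
qed

lemma dissipation_path_arc:
  assumes t: "t \<in> {0..T}" and s: "s1 < s2"
    and y: "\<And>s. s \<in> {s1..s2} \<Longrightarrow> (y has_vector_derivative y' s) (at s within {s1..s2})"
    and c: "continuous_on {s1..s2} y'" and nc: "\<And>s. s \<in> {s1..s2} \<Longrightarrow> y s \<notin> crit E t"
  shows "dissipation_path E t (y s1) (y s2) (integral {s1..s2} (\<lambda>s. norm (grad (E t) (y s)) * norm (y' s)))"
proof -
  let ?m = "s2 - s1"
  let ?\<sigma> = "\<lambda>s. ?m * s + s1"
  let ?\<theta> = "\<lambda>s. y (?\<sigma> s)"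
  let ?f = "\<lambda>s. norm (grad (E t) (y s)) * norm (y' s)"
  have m: "?m > 0" using s by simp
  have \<sigma>: "?\<sigma> x \<in> {s1..s2}" if "x \<in> {0..1}" for x
    using that m mult_left_mono[of x 1 ?m] mult_left_mono[of 0 x ?m] by (auto simp: algebra_simps)
  have cy: "continuous_on {s1..s2} y"
    unfolding continuous_on_eq_continuous_within using y has_vector_derivative_continuous by blast
  obtain B where B: "B > 0" "\<forall>x \<in> y' ` {s1..s2}. norm x \<le> B"
    using compact_imp_bounded[OF compact_continuous_image[OF c]] unfolding bounded_pos by auto
  have "B-lipschitz_on {s1..s2} y"
  proof (rule bounded_derivative_imp_lipschitz)
    show "(y has_derivative (\<lambda>h. h *\<^sub>R y' x)) (at x within {s1..s2})" if "x \<in> {s1..s2}" for x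
      using y[OF that] by (simp add: has_vector_derivative_def)
    show "onorm (\<lambda>h. h *\<^sub>R y' x) \<le> B" if "x \<in> {s1..s2}" for x
      by (rule onorm_le) (use B that in \<open>auto simp: mult.commute[of B] intro!: mult_left_mono\<close>)
  qed (use B in auto)
  then have B2: "B-lipschitz_on (?\<sigma> ` {0..1}) y" by (rule lipschitz_on_subset) (use \<sigma> in blast)
  have l\<sigma>: "?m-lipschitz_on {0..1} ?\<sigma>"
    by (rule lipschitz_onI) (use m in \<open>auto simp: dist_real_def right_diff_distrib[symmetric] abs_mult\<close>)
  have "continuous_on {s1..s2} ?f"
    by (intro continuous_intros continuous_on_compose_energy(2) cy c) (use t in auto)
  then have i: "(?f has_integral integral {s1..s2} ?f) (cbox s1 s2)"
    unfolding cbox_interval by (intro integrable_integral integrable_continuous_real)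
  have "((\<lambda>x. ?f (?\<sigma> x)) has_integral integral {s1..s2} ?f / ?m) {0..1}"
    using has_integral_affinity'[OF i m, of s1] m by (simp add: divide_inverse_commute)
  from has_integral_mult_right[OF this, of ?m]
  have j: "((\<lambda>x. norm (grad (E t) (?\<theta> x)) * norm (?m *\<^sub>R y' (?\<sigma> x))) has_integral integral {s1..s2} ?f) {0..1}"
    using m by (simp add: mult_ac)
  show ?thesis
    unfolding dissipation_path_def
  \<comment> \<open>The end times are exceptional because \<open>y\<close> is assumed differentiable
    only within \<open>{s1..s2}\<close>.\<close>
  proof (rule exI[of _ ?\<theta>], rule exI[of _ "\<lambda>x. ?m *\<^sub>R y' (?\<sigma> x)"], rule exI[of _ "{0,1}"], rule exI[of _ "B * ?m"], intro conjI ballI)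
    show "(B * ?m)-lipschitz_on {0..1} ?\<theta>" by (rule lipschitz_on_compose2[OF l\<sigma> B2])
    show "(?\<theta> has_vector_derivative ?m *\<^sub>R y' (?\<sigma> x)) (at x)" if x: "x \<in> {0..1} - {0, 1}" for x
    proof -
      have x': "0 < x" "x < 1" using x by auto
      have "?\<sigma> x \<in> {s1<..<s2}"
        using mult_strict_left_mono[OF x'(2) m] mult_pos_pos[OF m x'(1)] by auto
      then have "(y has_vector_derivative y' (?\<sigma> x)) (at (?\<sigma> x))"
        using y[of "?\<sigma> x"] by (simp add: at_within_Icc_at)
      moreover have "(?\<sigma> has_vector_derivative ?m) (at x)" by (auto intro!: derivative_eq_intros)
      ultimately show ?thesis using vector_diff_chain_at[of ?\<sigma> ?m x y] by (simp add: o_def)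
    qed
    show "finite {s\<in>{0..1}. ?\<theta> s \<in> crit E t}" by (rule finite_subset[of _ "{}"]) (use nc \<sigma> in blast, simp)
  qed (use j in auto)
qed

text \<open>Take the largest time spent in the closed ball; since the curve is outside right
  afterwards, continuity puts it on the sphere then.\<close>

lemma last_exit:
  fixes y :: "real \<Rightarrow> 'a"
  assumes cy: "continuous_on {p..q} y" and pq: "p \<le> q" and "y p \<in> cball a r" "y q \<notin> cball a r"
  obtains s where "p \<le> s" "s < q" "dist a (y s) = r" "\<And>u. s < u \<Longrightarrow> u \<le> q \<Longrightarrow> r < dist a (y u)"
proof -
  let ?A = "{s \<in> {p..q}. y s \<in> cball a r}"
  have "compact ?A"
    using continuous_closed_preimage[OF cy closed_atLeastAtMost closed_cball, of a r]
    by (auto simp: compact_eq_bounded_closed vimage_def Int_def intro: bounded_subset[OF bounded_closed_interval])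
  then obtain s where s: "s \<in> ?A" "\<And>u. u \<in> ?A \<Longrightarrow> u \<le> s"
    using compact_attains_sup[of ?A] pq assms(3) by (metis (no_types, lifting) atLeastAtMost_iff empty_iff mem_Collect_eq order_refl)
  have out: "r < dist a (y u)" if "s < u" "u \<le> q" for u
    using s(2)[of u] s(1) that by (auto simp: not_le[symmetric])
  have lt: "s < q" using s(1) assms(4) by (cases "s = q") auto
  have "r \<le> dist a (y s)"
  proof (rule ccontr)
    assume "\<not> r \<le> dist a (y s)"
    then have e: "r - dist a (y s) > 0" by simp
    then obtain d where d: "d > 0" "\<And>u. u \<in> {p..q} \<Longrightarrow> dist u s < d \<Longrightarrow> dist (y u) (y s) < r - dist a (y s)"
      using cy s(1) unfolding continuous_on_iff by blast
    define u where "u = min q (s + d / 2)"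
    have u: "s < u" "u \<le> q" "dist u s < d" using lt d(1) by (auto simp: u_def dist_real_def min_def)
    have "dist (y u) (y s) < r - dist a (y s)" using d(2)[of u] u s(1) by auto
    then show False using out[OF u(1,2)] dist_triangle[of a "y u" "y s"] by (simp add: dist_commute)
  qed
  then show ?thesis using that[of s] s(1) lt out by auto
qed

text \<open>Take the least time spent in the finite, hence closed, union of balls. The lower bound
  includes that time itself, so that the whole arc up to it avoids every open ball.\<close>

lemma first_entrance:
  fixes y :: "real \<Rightarrow> 'a"
  assumes cy: "continuous_on {p..q} y" and pq: "p \<le> q" and S: "finite S" "b \<in> S" "y q \<in> cball b r"
    and out: "\<And>z. z \<in> S \<Longrightarrow> y p \<notin> cball z r"
  obtains s z where "p < s" "s \<le> q" "z \<in> S" "dist z (y s) = r" "\<And>u z. p \<le> u \<Longrightarrow> u \<le> s \<Longrightarrow> z \<in> S \<Longrightarrow> r \<le> dist z (y u)"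
proof -
  let ?A = "{s \<in> {p..q}. y s \<in> (\<Union>z\<in>S. cball z r)}"
  have "closed (\<Union>z\<in>S. cball z r)" using S(1) by (intro closed_UN) auto
  then have "compact ?A"
    using continuous_closed_preimage[OF cy closed_atLeastAtMost, of "\<Union>z\<in>S. cball z r"]
    by (auto simp: compact_eq_bounded_closed vimage_def Int_def simp del: UN_iff intro: bounded_subset[OF bounded_closed_interval])
  moreover have "q \<in> ?A" using pq S by auto
  ultimately obtain s where s: "s \<in> ?A" "\<And>u. u \<in> ?A \<Longrightarrow> s \<le> u"
    using compact_attains_inf[of ?A] by blast
  have lt: "p < s" using s(1) out by (cases "p = s") auto
  have before: "r < dist z (y u)" if "p \<le> u" "u < s" "z \<in> S" for u z
    using s(2)[of u] s(1) that by (auto simp: not_le[symmetric])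
  have at: "r \<le> dist z (y s)" if z: "z \<in> S" for z
  proof (rule ccontr)
    assume "\<not> r \<le> dist z (y s)"
    then have e: "r - dist z (y s) > 0" by simp
    then obtain d where d: "d > 0" "\<And>u. u \<in> {p..q} \<Longrightarrow> dist u s < d \<Longrightarrow> dist (y u) (y s) < r - dist z (y s)"
      using cy s(1) unfolding continuous_on_iff by blast
    define u where "u = max p (s - d / 2)"
    have u: "p \<le> u" "u < s" "dist u s < d" using lt d(1) by (auto simp: u_def dist_real_def max_def)
    have "dist (y u) (y s) < r - dist z (y s)" using d(2)[of u] u s(1) by auto
    then show False using before[OF u(1,2) z] dist_triangle[of z "y u" "y s"] by (simp add: dist_commute)
  qed
  obtain z where z: "z \<in> S" "dist z (y s) \<le> r" using s(1) by auto
  show ?thesis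
  proof (rule that[of s z])
    show "dist z (y s) = r" using z at[OF z(1)] by simp
    show "r \<le> dist z (y u)" if "p \<le> u" "u \<le> s" "z \<in> S" for u z
      using before[of u z] at[of z] that by (cases "u = s") auto
  qed (use lt s(1) z in auto)
qed

text \<open>Each marked ball is crossed along two radii, entering at the first hit after the last exit from the
  previous ball; since the curve never returns to that ball, its centre can be removed from the set of
  marked points.\<close>

lemma dissipation_path_surgery:
  fixes y :: "real \<Rightarrow> 'a"
  assumes t: "t \<in> {0..T}" and r: "r > 0" and fin: "finite S"
    and y: "\<And>s. s \<in> {P..Q} \<Longrightarrow> (y has_vector_derivative y' s) (at s within {P..Q})"
    and c: "continuous_on {P..Q} y'"
    and g: "g integrable_on {P..Q}" "\<And>s. s \<in> {P..Q} \<Longrightarrow> 0 \<le> g s"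
    and S: "\<And>z. z \<in> S \<Longrightarrow> cball z r \<inter> crit E t \<subseteq> {z}"
      "\<And>z x. z \<in> S \<Longrightarrow> x \<in> cball z r \<Longrightarrow> norm (grad (E t) x) \<le> \<Gamma>"
      "\<And>z z'. z \<in> S \<Longrightarrow> z' \<in> S \<Longrightarrow> z \<noteq> z' \<Longrightarrow> cball z r \<inter> cball z' r = {}"
    and p: "P \<le> p" "p \<le> Q" and a: "a \<in> S" "y p \<in> cball a r" and b: "b \<in> S" "y Q \<in> cball b r"
    and out: "\<And>s. s \<in> {p..Q} \<Longrightarrow> (\<And>z. z \<in> S \<Longrightarrow> r \<le> dist z (y s)) \<Longrightarrow>
      y s \<notin> crit E t \<and> norm (grad (E t) (y s)) * norm (y' s) \<le> g s"
  shows "a = b \<or> (\<exists>K. dissipation_path E t a b K \<and> K \<le> integral {p..Q} g + real (card S) * (2 * r * \<Gamma>))"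
  \<comment> \<open>The starting time \<open>p\<close>, the first centre \<open>a\<close> and the
    marked set vary, while the curve, the final time \<open>Q\<close> and the target
    \<open>b\<close> stay fixed.\<close>
  using fin S p a b out
proof (induction "card S" arbitrary: S a p rule: less_induct)
  case less
  note fin = less.prems(1) and S = less.prems(2-4) and p = less.prems(5,6) and a = less.prems(7,8)
    and b = less.prems(9,10) and out = less.prems(11)
  have cy: "continuous_on {P..Q} y"
    unfolding continuous_on_eq_continuous_within using y has_vector_derivative_continuous by blast
  show ?case
  proof (cases "a = b")
    case False
    have "y Q \<notin> cball a r" using S(3)[OF a(1) b(1) False] b(2) by blast
    moreover have "continuous_on {p..Q} y" by (rule continuous_on_subset[OF cy]) (use p in auto)
    ultimately obtain s1 where s1: "p \<le> s1" "s1 < Q" "dist a (y s1) = r" "\<And>u. s1 < u \<Longrightarrow> u \<le> Q \<Longrightarrow> r < dist a (y u)"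
      using last_exit[of p Q y a r] p(2) a(2) by blast
    have cs: "continuous_on {s1..Q} y" by (rule continuous_on_subset[OF cy]) (use p s1 in auto)
    have "y s1 \<in> cball a r" using s1(3) by simp
    then have ns: "y s1 \<notin> cball z r" if "z \<in> S - {a}" for z
      using S(3)[OF a(1), of z] that by blast
    have fb: "finite (S - {a})" "b \<in> S - {a}" using fin b(1) False by auto
    obtain s2 z where s2: "s1 < s2" "s2 \<le> Q" "z \<in> S - {a}" "dist z (y s2) = r"
      "\<And>u z. s1 \<le> u \<Longrightarrow> u \<le> s2 \<Longrightarrow> z \<in> S - {a} \<Longrightarrow> r \<le> dist z (y u)"
      using first_entrance[OF cs less_imp_le[OF s1(2)] fb b(2) ns] by blast
    \<comment> \<open>The last exit keeps the arc away from \<open>a\<close>, the first entrance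
      from all other centres, so \<open>out\<close> applies with the full set
      \<open>S\<close>.\<close>
    have mid: "y s \<notin> crit E t \<and> norm (grad (E t) (y s)) * norm (y' s) \<le> g s" if s: "s \<in> {s1..s2}" for s
    proof (rule out)
      show "s \<in> {p..Q}" using s s1 s2 by auto
      show "r \<le> dist z (y s)" if "z \<in> S" for z
        using that s2(5)[of s z] s1(3) s1(4)[of s] s s2(2) by (cases "z = a"; cases "s = s1") auto
    qed
    have sub: "{s1..s2} \<subseteq> {P..Q}" using s1 s2 p by auto
    have arc: "dissipation_path E t (y s1) (y s2) (integral {s1..s2} (\<lambda>s. norm (grad (E t) (y s)) * norm (y' s)))"
      (is "dissipation_path E t _ _ ?K0")
    proof (rule dissipation_path_arc[OF t s2(1)])
      show "(y has_vector_derivative y' s) (at s within {s1..s2})" if "s \<in> {s1..s2}" for s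
        by (rule has_vector_derivative_within_subset[OF y sub]) (use that sub in blast)
      show "continuous_on {s1..s2} y'" by (rule continuous_on_subset[OF c sub])
    qed (use mid in blast)
    \<comment> \<open>A radius has length \<open>r\<close> and lies in one ball, which contains no
      critical point except possibly its centre.\<close>
    have seg: "\<exists>K. dissipation_path E t u v K \<and> K \<le> r * \<Gamma>"
      if w: "w \<in> S" and uv: "u \<in> cball w r" "v \<in> cball w r" "dist u v = r" for u v w
    proof -
      have cs: "closed_segment u v \<subseteq> cball w r" using uv by (intro closed_segment_subset) auto
      have "u \<noteq> v" using uv(3) r by auto
      moreover have "closed_segment u v \<inter> crit E t \<subseteq> {w}" using cs S(1)[OF w] by blast
      ultimately obtain K where "dissipation_path E t u v K" "K \<le> \<Gamma> * dist u v"
        using dissipation_path_segment[OF t, of u v w \<Gamma>] cs S(2)[OF w] by blast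
      then show ?thesis using uv(3) by (auto simp: mult.commute)
    qed
    obtain K1 where K1: "dissipation_path E t a (y s1) K1" "K1 \<le> r * \<Gamma>"
      using seg[of a a "y s1"] a(1) s1(3) r by auto
    obtain K2 where K2: "dissipation_path E t (y s2) z K2" "K2 \<le> r * \<Gamma>"
      using seg[of z "y s2" z] s2(3,4) r by (auto simp: dist_commute)
    have gi: "g integrable_on {u..v}" if "P \<le> u" "v \<le> Q" for u v
      by (rule integrable_subinterval_real[OF g(1)]) (use that in auto)
    have K0: "?K0 \<le> integral {s1..s2} g"
    proof (rule integral_le)
      show "(\<lambda>s. norm (grad (E t) (y s)) * norm (y' s)) integrable_on {s1..s2}"
        by (intro integrable_continuous_real continuous_intros continuous_on_compose_energy(2)
            continuous_on_subset[OF cy sub] continuous_on_subset[OF c sub]) (use t in auto)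
      show "g integrable_on {s1..s2}" by (rule gi) (use sub s2(1) in auto)
    qed (use mid in blast)
    have gn: "0 \<le> integral {u..v} g" if "P \<le> u" "v \<le> Q" for u v
      by (rule integral_nonneg[OF gi[OF that]]) (use g(2) that in auto)
    \<comment> \<open>The portion \<open>{p..s1}\<close> before the last exit is cut away; since
      \<open>g\<close> is nonnegative, its integral may stay in the bound.\<close>
    have split: "integral {p..Q} g = integral {p..s1} g + (integral {s1..s2} g + integral {s2..Q} g)"
    proof -
      have "integral {p..s1} g + integral {s1..Q} g = integral {p..Q} g"
        by (rule Henstock_Kurzweil_Integration.integral_combine) (use s1 gi[of p Q] p in auto)
      moreover have "integral {s1..s2} g + integral {s2..Q} g = integral {s1..Q} g"
        by (rule Henstock_Kurzweil_Integration.integral_combine) (use s1 s2 gi[of s1 Q] p in auto)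
      ultimately show ?thesis by simp
    qed
    have path: "dissipation_path E t a z (K1 + ?K0 + K2)"
      by (rule dissipation_path_join[OF dissipation_path_join[OF K1(1) arc] K2(1)])
    \<comment> \<open>Removing \<open>a\<close> pays for two radii, from \<open>a\<close> to its
      sphere and from the next sphere to \<open>z\<close>; together they are one summand
      \<open>2 * r * \<Gamma>\<close>.\<close>
    have cardS: "card S = Suc (card (S - {a}))" by (rule card.remove[OF fin a(1)])
    have "norm (grad (E t) a) \<le> \<Gamma>" by (rule S(2)[OF a(1)]) (use r in simp)
    then have "0 \<le> \<Gamma>" using norm_ge_zero order_trans by blast
    then have \<Gamma>0: "0 \<le> 2 * r * \<Gamma>" using r by simp
    show ?thesis
    proof (cases "z = b")
      case True
      have "K1 + ?K0 + K2 \<le> integral {p..Q} g + real (card S) * (2 * r * \<Gamma>)"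
      proof -
        have "1 * (2 * r * \<Gamma>) \<le> real (card S) * (2 * r * \<Gamma>)" by (rule mult_right_mono[OF _ \<Gamma>0]) (simp add: cardS)
        then show ?thesis using K1(2) K2(2) K0 split gn[of p s1] gn[of s2 Q] p s1 s2 by simp
      qed
      then show ?thesis using path True by blast
    next
      case False
      have "z = b \<or> (\<exists>K. dissipation_path E t z b K \<and> K \<le> integral {s2..Q} g + real (card (S - {a})) * (2 * r * \<Gamma>))"
      proof (rule less.hyps)
        show "card (S - {a}) < card S" using cardS by simp
        show "y s \<notin> crit E t \<and> norm (grad (E t) (y s)) * norm (y' s) \<le> g s"
          if s: "s \<in> {s2..Q}" and o: "\<And>z. z \<in> S - {a} \<Longrightarrow> r \<le> dist z (y s)" for s
        proof (rule out)
          show "s \<in> {p..Q}" using s s1 s2 by auto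
          show "r \<le> dist z (y s)" if "z \<in> S" for z
            using o[of z] that s1(4)[of s] s s2(1) by (cases "z = a") auto
        qed
      qed (use fin S s1 s2 p b \<open>a \<noteq> b\<close> in auto)
      then obtain K where K: "dissipation_path E t z b K" "K \<le> integral {s2..Q} g + real (card (S - {a})) * (2 * r * \<Gamma>)"
        using False by blast
      have "(K1 + ?K0 + K2) + K \<le> integral {p..Q} g + real (card S) * (2 * r * \<Gamma>)"
        using K1(2) K2(2) K0 split gn[of p s1] K(2) p s1 s2 by (simp add: cardS distrib_right)
      then show ?thesis using dissipation_path_join[OF path K(1)] by blast
    qed
  qed simp
qed

end

section \<open>Compactness of viscous trajectories\<close>

text \<open>\<open>s2\<close> is the first time at level at least \<open>\<beta>\<close>, and
  \<open>s1\<close> the last time before it at level at most \<open>\<alpha>\<close>; in between the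
  values are trapped.\<close>

lemma crossing:
  fixes f :: "real \<Rightarrow> real"
  assumes c: "continuous_on {p..q} f" and pq: "p \<le> q" and le: "f p \<le> \<alpha>" "\<alpha> < \<beta>" "\<beta> \<le> f q"
  obtains s1 s2 where "p \<le> s1" "s1 < s2" "s2 \<le> q" "f s1 = \<alpha>" "f s2 = \<beta>" "\<And>s. s \<in> {s1..s2} \<Longrightarrow> \<alpha> \<le> f s \<and> f s \<le> \<beta>"
proof -
  let ?A = "{s \<in> {p..q}. f s \<in> {\<beta>..}}"
  have "compact ?A"
    using continuous_closed_preimage[OF c closed_atLeastAtMost closed_atLeast, of \<beta>]
    by (auto simp: compact_eq_bounded_closed vimage_def Int_def intro: bounded_subset[OF bounded_closed_interval])
  moreover have "q \<in> ?A" using pq le by auto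
  ultimately obtain s2 where s2: "s2 \<in> ?A" "\<And>u. u \<in> ?A \<Longrightarrow> s2 \<le> u"
    using compact_attains_inf[of ?A] by blast
  have c2: "continuous_on {p..s2} f" by (rule continuous_on_subset[OF c]) (use s2 in auto)
  let ?B = "{s \<in> {p..s2}. f s \<in> {..\<alpha>}}"
  have "compact ?B"
    using continuous_closed_preimage[OF c2 closed_atLeastAtMost closed_atMost, of \<alpha>]
    by (auto simp: compact_eq_bounded_closed vimage_def Int_def intro: bounded_subset[OF bounded_closed_interval])
  moreover have "p \<in> ?B" using s2(1) le by auto
  ultimately obtain s1 where s1: "s1 \<in> ?B" "\<And>u. u \<in> ?B \<Longrightarrow> u \<le> s1"
    using compact_attains_sup[of ?B] by blast
  have lt: "s1 < s2" using s1(1) s2(1) le by (cases "s1 = s2") auto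
  have c12: "continuous_on {s1..s2} f" by (rule continuous_on_subset[OF c2]) (use s1 in auto)
  obtain v where v: "s1 \<le> v" "v \<le> s2" "f v = \<beta>"
    using IVT'[of f s1 \<beta> s2] s1(1) s2(1) le lt c12 by auto
  then have "v = s2" using s2(2)[of v] s1(1) s2(1) by auto
  then have f2: "f s2 = \<beta>" using v by simp
  obtain w where w: "s1 \<le> w" "w \<le> s2" "f w = \<alpha>"
    using IVT'[of f s1 \<alpha> s2] s1(1) s2(1) le lt c12 by auto
  then have "w = s1" using s1(2)[of w] s1(1) by auto
  then have f1: "f s1 = \<alpha>" using w by simp
  show ?thesis
  proof (rule that[of s1 s2])
    show "\<alpha> \<le> f s \<and> f s \<le> \<beta>" if s: "s \<in> {s1..s2}" for s
    proof (cases "s = s1 \<or> s = s2")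
      case True then show ?thesis using f1 f2 le by auto
    next
      case False
      then have "s \<notin> ?A" "s \<notin> ?B" using s2(2)[of s] s1(2)[of s] s by auto
      then show ?thesis using s s1(1) s2(1) by auto
    qed
  qed (use s1(1) s2(1) lt f1 f2 in auto)
qed

text \<open>Diagonal extraction. From index \<open>Suc n\<close> on the diagonal sequence is a
  subsequence of the one chosen for the \<open>n\<close>-th point, hence the shift and its removal
  at the end.\<close>

lemma convergent_subsequence_on_countable:
  fixes f :: "nat \<Rightarrow> 'b \<Rightarrow> 'a::euclidean_space"
  assumes "countable C" and b: "\<And>n x. norm (f n x) \<le> R"
  obtains k :: "nat \<Rightarrow> nat" where "strict_mono k" "\<And>x. x \<in> C \<Longrightarrow> convergent (\<lambda>n. f (k n) x)"
proof (cases "C = {}")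
  case True
  then show ?thesis using that[of id] by (simp add: strict_mono_id)
next
  case False
  define e where "e = from_nat_into C"
  have eC: "x \<in> range e" if "x \<in> C" for x
    using that assms(1) False range_from_nat_into[OF False assms(1)] by (simp add: e_def)
  interpret subseqs "\<lambda>n r. convergent (\<lambda>i. f (r i) (e n))"
  proof
    fix n :: nat and s :: "nat \<Rightarrow> nat" assume "strict_mono s"
    have "bounded (range (\<lambda>i. f (s i) (e n)))" unfolding bounded_iff using b by auto
    then obtain l r where "strict_mono (r::nat\<Rightarrow>nat)" "((\<lambda>i. f (s i) (e n)) \<circ> r) \<longlonglongrightarrow> l"
      using bounded_imp_convergent_subsequence by blast
    then show "\<exists>r'. strict_mono r' \<and> convergent (\<lambda>i. f ((s \<circ> r') i) (e n))"
      by (auto simp: o_def convergent_def)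
  qed
  have "convergent (\<lambda>i. f (diagseq i) (e n))" for n
  proof -
    have "convergent (\<lambda>i. f ((diagseq \<circ> (+) (Suc n)) i) (e n))"
    proof (rule diagseq_holds)
      fix r s :: "nat \<Rightarrow> nat" and n
      assume r: "strict_mono r" and "convergent (\<lambda>i. f (s i) (e n))"
      then show "convergent (\<lambda>i. f ((s \<circ> r) i) (e n))"
        using convergent_subseq_convergent[of "\<lambda>i. f (s i) (e n)" r] by (simp add: o_def)
    qed
    then obtain l where "(\<lambda>i. f (diagseq (i + Suc n)) (e n)) \<longlonglongrightarrow> l" by (auto simp: convergent_def add.commute)
    then have "(\<lambda>i. f (diagseq i) (e n)) \<longlonglongrightarrow> l" by (rule LIMSEQ_offset)
    then show ?thesis by (auto simp: convergent_def)
  qed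
  then show ?thesis using that[OF subseq_diagseq] eC by (metis imageE)
qed

text \<open>Records classical flows with uniform bounds, \<open>R\<close> for the values and
  \<open>M\<close> for the dissipation. All assumptions pass to subsequences, so the locale can be
  instantiated again after an extraction.\<close>

locale viscous_sequence = C1_energy_on T E
  for T :: real and E :: "real \<Rightarrow> 'a::euclidean_space \<Rightarrow> real" +
  fixes \<epsilon> :: "nat \<Rightarrow> real" and y :: "nat \<Rightarrow> real \<Rightarrow> 'a" and u0 :: 'a and R M :: real
  assumes \<epsilon>_pos: "\<epsilon> n > 0" and \<epsilon>_lim: "\<epsilon> \<longlonglongrightarrow> 0"
    and flow: "t \<in> {0..T} \<Longrightarrow> (y n has_vector_derivative - (1 / \<epsilon> n) *\<^sub>R grad (E t) (y n t)) (at t within {0..T})"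
    and y_bound: "t \<in> {0..T} \<Longrightarrow> norm (y n t) \<le> R"
    and y_init: "(\<lambda>n. y n 0) \<longlonglongrightarrow> u0"
    and diss_bound: "integral {0..T} (\<lambda>r. (norm (grad (E r) (y n r)))\<^sup>2 / \<epsilon> n) \<le> M"
    and crit_discrete: "t \<in> {0..T} \<Longrightarrow> discrete (crit E t)"
begin

abbreviation cl :: "real \<Rightarrow> real" where "cl \<equiv> clamp_to 0 T"

text \<open>Trajectories and dissipation are extended constantly beyond the end points, so that the one-sided
  limits of the limit curve at \<open>0\<close> and \<open>T\<close> obey the conventions \<open>u\<^sub>-(0) = u(0)\<close> and \<open>u\<^sub>+(T) = u(T)\<close>.\<close>

definition Y :: "nat \<Rightarrow> real \<Rightarrow> 'a" where "Y n t = y n (cl t)"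

definition D :: "nat \<Rightarrow> real \<Rightarrow> real" where
  "D n t = integral {0..cl t} (\<lambda>r. (norm (grad (E r) (y n r)))\<^sup>2 / \<epsilon> n)"

lemma cl_mem: "cl t \<in> {0..T}" using clamp_to_mem T_pos by (metis less_imp_le)

lemma cl_idem: "cl (cl t) = cl t" by (rule clamp_to_id) (rule cl_mem)

lemma y_continuous: "continuous_on {0..T} (y n)"
  unfolding continuous_on_eq_continuous_within using flow has_vector_derivative_continuous by blast

lemma dissipation_continuous: "continuous_on {0..T} (\<lambda>r. (norm (grad (E r) (y n r)))\<^sup>2 / \<epsilon> n)"
  by (intro continuous_intros continuous_on_compose_energy(2) continuous_on_id y_continuous) (use \<epsilon>_pos[of n] in auto)

lemma dissipation_integrable:
  assumes "0 \<le> p" "q \<le> T" shows "(\<lambda>r. (norm (grad (E r) (y n r)))\<^sup>2 / \<epsilon> n) integrable_on {p..q}"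
  by (intro integrable_continuous_real continuous_on_subset[OF dissipation_continuous]) (use assms in auto)

lemma D_diff:
  assumes "p \<le> q"
  shows "D n q - D n p = integral {cl p..cl q} (\<lambda>r. (norm (grad (E r) (y n r)))\<^sup>2 / \<epsilon> n)"
proof -
  have "integral {0..cl p} (\<lambda>r. (norm (grad (E r) (y n r)))\<^sup>2 / \<epsilon> n) + integral {cl p..cl q} (\<lambda>r. (norm (grad (E r) (y n r)))\<^sup>2 / \<epsilon> n)
    = integral {0..cl q} (\<lambda>r. (norm (grad (E r) (y n r)))\<^sup>2 / \<epsilon> n)"
    by (rule Henstock_Kurzweil_Integration.integral_combine)
      (use cl_mem[of p] cl_mem[of q] clamp_to_mono[OF assms] in \<open>auto intro: dissipation_integrable\<close>)
  then show ?thesis by (simp add: D_def)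
qed

lemma D_mono: "mono (D n)"
proof (rule monoI)
  fix p q :: real assume "p \<le> q"
  have "0 \<le> integral {cl p..cl q} (\<lambda>r. (norm (grad (E r) (y n r)))\<^sup>2 / \<epsilon> n)"
    using \<epsilon>_pos[of n] cl_mem[of p] cl_mem[of q] by (intro integral_nonneg dissipation_integrable) auto
  then show "D n p \<le> D n q" using D_diff[OF \<open>p \<le> q\<close>, of n] by simp
qed

lemma D_neg: "t \<le> 0 \<Longrightarrow> D n t = 0"
  using T_pos by (simp add: D_def clamp_to_def)

lemma D_bounds: "0 \<le> D n t" "D n t \<le> M"
proof -
  show "0 \<le> D n t" using monoD[OF D_mono, of "min t 0" t n] D_neg[of "min t 0" n] by simp
  have "D n (max t T) \<le> M" using diss_bound[of n] T_pos by (simp add: D_def clamp_to_def)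
  then show "D n t \<le> M" using monoD[OF D_mono, of t "max t T" n] by simp
qed

lemma D_continuous: "continuous_on S (D n)"
proof -
  have "continuous_on {0..T} (\<lambda>t. integral {0..t} (\<lambda>r. (norm (grad (E r) (y n r)))\<^sup>2 / \<epsilon> n))"
    by (rule indefinite_integral_continuous_1) (rule dissipation_integrable, auto)
  then show ?thesis unfolding D_def
    by (rule continuous_on_compose2[OF _ clamp_to_continuous]) (use cl_mem in blast)
qed

lemma Y_bound: "norm (Y n t) \<le> R" unfolding Y_def by (rule y_bound) (rule cl_mem)

lemma crit_closed:
  assumes "t \<in> {0..T}" shows "closed (crit E t)"
proof -
  have "continuous_on UNIV (\<lambda>u. grad (E t) u)"
    by (rule continuous_on_compose_energy(2)[OF continuous_on_const continuous_on_id]) (rule assms)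
  from continuous_closed_vimage[OF closed_singleton[of 0]] this
  have "closed ((\<lambda>u. grad (E t) u) -` {0})" using continuous_on_eq_continuous_within by blast
  then show ?thesis by (simp add: crit_def vimage_def)
qed

text \<open>Isolated points may accumulate outside the set; here they cannot, because the zero set
  of a continuous gradient is closed and so meets a ball in a compact discrete set.\<close>

lemma crit_locally_finite:
  assumes t: "t \<in> {0..T}" shows "finite (crit E t \<inter> cball a r)"
proof -
  have "compact (crit E t \<inter> cball a r)" by (intro closed_Int_compact crit_closed t compact_cball)
  moreover have "discrete (crit E t \<inter> cball a r)"
    by (rule discrete_subset[OF crit_discrete[OF t]]) auto
  ultimately show ?thesis using discrete_compact_finite_iff by blast
qed

lemma grad_equicontinuous:
  assumes t: "t \<in> {0..T}" and e: "e > 0"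
  obtains \<delta> where "\<delta> > 0"
    "\<And>s x. s \<in> {0..T} \<Longrightarrow> \<bar>s - t\<bar> \<le> \<delta> \<Longrightarrow> x \<in> cball a r \<Longrightarrow> norm (grad (E s) x - grad (E t) x) < e"
proof -
  have "compact ({0..T} \<times> cball a r)" by (intro compact_Times) auto
  then have "uniformly_continuous_on ({0..T} \<times> cball a r) (\<lambda>p. grad (E (fst p)) (snd p))"
    by (rule compact_uniformly_continuous[rotated]) (rule continuous_on_subset[OF continuous_on_grad], auto)
  then obtain d where d: "d > 0" "\<And>p q. p \<in> {0..T} \<times> cball a r \<Longrightarrow> q \<in> {0..T} \<times> cball a r \<Longrightarrow> dist q p < d \<Longrightarrow>
      dist (grad (E (fst q)) (snd q)) (grad (E (fst p)) (snd p)) < e"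
    using e unfolding uniformly_continuous_on_def by blast
  show ?thesis
  proof (rule that[of "d / 2"])
    fix s x assume "s \<in> {0..T}" "\<bar>s - t\<bar> \<le> d / 2" "x \<in> cball a r"
    then show "norm (grad (E s) x - grad (E t) x) < e"
      using d(2)[of "(t, x)" "(s, x)"] d(1) t by (simp add: dist_norm dist_Pair_Pair)
  qed (use d in simp)
qed

text \<open>Where the gradient has norm at least \<open>m\<close>, the speed, which is that norm
  over \<epsilon>, is at most \<open>1 / m\<close> times the dissipation rate; the viscosity
  disappears from the estimate.\<close>

lemma speed_bound:
  assumes s: "0 \<le> s1" "s1 \<le> s2" "s2 \<le> T" and m: "m > 0"
    and G: "\<And>s. s \<in> {s1..s2} \<Longrightarrow> m \<le> norm (grad (E s) (y n s))"
  shows "m * norm (y n s2 - y n s1) \<le> D n s2 - D n s1"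
proof -
  have sub: "{s1..s2} \<subseteq> {0..T}" using s by auto
  have i: "((\<lambda>s. - (1 / \<epsilon> n) *\<^sub>R grad (E s) (y n s)) has_integral (y n s2 - y n s1)) {s1..s2}"
    by (rule fundamental_theorem_of_calculus[OF s(2)])
      (use has_vector_derivative_within_subset[OF flow sub] sub in blast)
  have "norm (integral {s1..s2} (\<lambda>s. - (1 / \<epsilon> n) *\<^sub>R grad (E s) (y n s)))
      \<le> integral {s1..s2} (\<lambda>s. (1 / m) * ((norm (grad (E s) (y n s)))\<^sup>2 / \<epsilon> n))"
  proof (rule integral_norm_bound_integral)
    show "(\<lambda>s. (1 / m) * ((norm (grad (E s) (y n s)))\<^sup>2 / \<epsilon> n)) integrable_on {s1..s2}"
      using integrable_on_cmult_left[OF dissipation_integrable[OF s(1,3), of n], of "1 / m"] by simp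
    fix s assume "s \<in> {s1..s2}"
    then have "m * norm (grad (E s) (y n s)) \<le> norm (grad (E s) (y n s)) * norm (grad (E s) (y n s))"
      using G by (intro mult_right_mono) auto
    then show "norm (- (1 / \<epsilon> n) *\<^sub>R grad (E s) (y n s)) \<le> (1 / m) * ((norm (grad (E s) (y n s)))\<^sup>2 / \<epsilon> n)"
      using m \<epsilon>_pos[of n] by (simp add: field_simps power2_eq_square)
  qed (use i in blast)
  also have "\<dots> = (1 / m) * integral {s1..s2} (\<lambda>s. (norm (grad (E s) (y n s)))\<^sup>2 / \<epsilon> n)" by simp
  also have "\<dots> = (1 / m) * (D n s2 - D n s1)"
    using D_diff[OF s(2), of n] s by (simp add: clamp_to_id)
  finally show ?thesis using integral_unique[OF i] m by (simp add: field_simps)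
qed

text \<open>Around a non-critical annulus the gradient is bounded below, so crossing the annulus dissipates a
  definite amount of energy, uniformly in the viscosity.\<close>

lemma oscillation:
  assumes \<rho>0: "\<rho>0 > 0"
  obtains \<rho> \<delta> c where "0 < \<rho>" "\<rho> \<le> \<rho>0" "\<delta> > 0" "c > 0"
    "\<And>n p q. \<bar>p - t\<bar> \<le> \<delta> \<Longrightarrow> \<bar>q - t\<bar> \<le> \<delta> \<Longrightarrow> dist (Y n p) a \<le> \<rho> / 2 \<Longrightarrow> \<bar>D n q - D n p\<bar> < c \<Longrightarrow> dist (Y n q) a \<le> \<rho>"
proof -
  let ?t = "cl t"
  have t: "?t \<in> {0..T}" by (rule cl_mem)
  obtain d where d: "d > 0" "\<And>x. x \<in> crit E ?t \<inter> cball a \<rho>0 \<Longrightarrow> x \<noteq> a \<Longrightarrow> d \<le> dist a x"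
    using finite_set_avoid[OF crit_locally_finite[OF t, of a \<rho>0], of a] by blast
  \<comment> \<open>The other critical points in the ball of radius \<open>\<rho>0\<close> keep
    distance \<open>d\<close> from \<open>a\<close>, so the annulus between
    \<open>\<rho> / 2\<close> and \<open>\<rho>\<close> contains none, whether or not
    \<open>a\<close> itself is critical.\<close>
  define \<rho> where "\<rho> = min \<rho>0 (d / 2)"
  have \<rho>: "0 < \<rho>" "\<rho> \<le> \<rho>0" "\<rho> < d" using \<rho>0 d(1) by (auto simp: \<rho>_def)
  let ?A = "cball a \<rho> - ball a (\<rho> / 2)"
  have cA: "compact ?A" by (intro compact_diff compact_cball open_ball)
  have nz: "grad (E ?t) x \<noteq> 0" if "x \<in> ?A" for x
  proof
    assume "grad (E ?t) x = 0"
    then have "x \<in> crit E ?t \<inter> cball a \<rho>0" using that \<rho> by (auto simp: crit_def)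
    moreover have "x \<noteq> a" using that \<rho> by auto
    ultimately show False using d(2)[of x] that \<rho> by auto
  qed
  \<comment> \<open>The factor 2 is the reserve for moving the time from \<open>?t\<close> to a
    nearby \<open>s\<close>.\<close>
  obtain m where m: "m > 0" "\<And>x. x \<in> ?A \<Longrightarrow> 2 * m \<le> norm (grad (E ?t) x)"
  proof (cases "?A = {}")
    case True then show ?thesis by (intro that[of 1]) (simp, blast)
  next
    case False
    have "continuous_on ?A (\<lambda>x. norm (grad (E ?t) x))"
      by (intro continuous_on_norm continuous_on_compose_energy(2)[OF continuous_on_const continuous_on_id]) (rule t)
    then obtain x0 where x0: "x0 \<in> ?A" "\<And>x. x \<in> ?A \<Longrightarrow> norm (grad (E ?t) x0) \<le> norm (grad (E ?t) x)"
      using continuous_attains_inf[OF cA False] by blast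
    show ?thesis by (rule that[of "norm (grad (E ?t) x0) / 2"]) (use x0 nz in auto)
  qed
  obtain \<delta> where \<delta>: "\<delta> > 0" "\<And>s x. s \<in> {0..T} \<Longrightarrow> \<bar>s - ?t\<bar> \<le> \<delta> \<Longrightarrow> x \<in> cball a \<rho> \<Longrightarrow> norm (grad (E s) x - grad (E ?t) x) < m"
    using grad_equicontinuous[OF t m(1), of a \<rho>] by blast
  have lower: "m \<le> norm (grad (E s) x)" if "s \<in> {0..T}" "\<bar>s - ?t\<bar> \<le> \<delta>" "\<rho> / 2 \<le> dist x a" "dist x a \<le> \<rho>" for s x
  proof -
    have "x \<in> ?A" using that by (auto simp: dist_commute)
    then have "2 * m \<le> norm (grad (E ?t) x)" "norm (grad (E s) x - grad (E ?t) x) < m"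
      using m(2)[of x] \<delta>(2)[OF that(1,2), of x] by auto
    then show ?thesis using norm_triangle_ineq3[of "grad (E s) x" "grad (E ?t) x"] by (simp add: abs_le_iff)
  qed
  have cost: "m * (\<rho> / 2) \<le> D n s2 - D n s1"
    if s: "s1 < s2" "s1 \<in> {0..T}" "s2 \<in> {0..T}" "\<bar>s1 - ?t\<bar> \<le> \<delta>" "\<bar>s2 - ?t\<bar> \<le> \<delta>"
      and b: "\<bar>dist (y n s2) a - dist (y n s1) a\<bar> = \<rho> / 2"
      and mid: "\<And>s. s \<in> {s1..s2} \<Longrightarrow> \<rho> / 2 \<le> dist (y n s) a \<and> dist (y n s) a \<le> \<rho>" for n s1 s2
  proof -
    have "\<rho> / 2 \<le> norm (y n s2 - y n s1)"
      using b dist_triangle[of "y n s2" a "y n s1"] dist_triangle[of "y n s1" a "y n s2"] by (simp add: dist_norm norm_minus_commute abs_if split: if_splits)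
    then have "m * (\<rho> / 2) \<le> m * norm (y n s2 - y n s1)" using m(1) by simp
    also have "\<dots> \<le> D n s2 - D n s1"
      by (rule speed_bound[OF _ _ _ m(1)]) (use s mid in \<open>auto intro!: lower\<close>)
    finally show ?thesis .
  qed
  have contr: "m * (\<rho> / 2) \<le> \<bar>D n q - D n p\<bar>"
    if pq: "p \<in> {0..T}" "q \<in> {0..T}" "\<bar>p - ?t\<bar> \<le> \<delta>" "\<bar>q - ?t\<bar> \<le> \<delta>" "dist (y n p) a \<le> \<rho> / 2" "\<rho> < dist (y n q) a" for n p q
  proof (cases "p \<le> q")
    case True
    have "continuous_on {p..q} (\<lambda>s. dist (y n s) a)"
      by (intro continuous_intros continuous_on_subset[OF y_continuous]) (use pq in auto)
    then obtain s1 s2 where s: "p \<le> s1" "s1 < s2" "s2 \<le> q" "dist (y n s1) a = \<rho> / 2" "dist (y n s2) a = \<rho>"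
      "\<And>s. s \<in> {s1..s2} \<Longrightarrow> \<rho> / 2 \<le> dist (y n s) a \<and> dist (y n s) a \<le> \<rho>"
      using crossing[of p q "\<lambda>s. dist (y n s) a" "\<rho> / 2" \<rho>] True pq \<rho>(1) by auto
    have "m * (\<rho> / 2) \<le> D n s2 - D n s1" by (rule cost) (use s pq in auto)
    then show ?thesis using monoD[OF D_mono s(1), of n] monoD[OF D_mono s(3), of n] by linarith
  next
    case False
    \<comment> \<open>For \<open>q < p\<close> the trajectory is read backwards, so that the
      crossing again goes outwards.\<close>
    have "continuous_on {-p..-q} (\<lambda>s. dist (y n (- s)) a)"
      by (intro continuous_intros continuous_on_compose2[OF y_continuous]) (use pq in auto)
    then obtain s1 s2 where s: "- p \<le> s1" "s1 < s2" "s2 \<le> - q" "dist (y n (- s1)) a = \<rho> / 2" "dist (y n (- s2)) a = \<rho>"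
      "\<And>s. s \<in> {s1..s2} \<Longrightarrow> \<rho> / 2 \<le> dist (y n (- s)) a \<and> dist (y n (- s)) a \<le> \<rho>"
      using crossing[of "- p" "- q" "\<lambda>s. dist (y n (- s)) a" "\<rho> / 2" \<rho>] False pq \<rho>(1) by auto
    have "m * (\<rho> / 2) \<le> D n (- s1) - D n (- s2)"
    proof (rule cost)
      show "\<rho> / 2 \<le> dist (y n u) a \<and> dist (y n u) a \<le> \<rho>" if "u \<in> {- s2..- s1}" for u
        using s(6)[of "- u"] that by auto
    qed (use s pq in auto)
    moreover have "D n (- s1) \<le> D n p" "D n q \<le> D n (- s2)" using s by (auto intro: monoD[OF D_mono])
    ultimately show ?thesis by linarith
  qed
  show ?thesis
  proof (rule that[OF \<rho>(1,2) \<delta>(1), of "m * (\<rho> / 2)"])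
    fix n p q assume a: "\<bar>p - t\<bar> \<le> \<delta>" "\<bar>q - t\<bar> \<le> \<delta>" "dist (Y n p) a \<le> \<rho> / 2" "\<bar>D n q - D n p\<bar> < m * (\<rho> / 2)"
    have cl': "\<bar>cl p - ?t\<bar> \<le> \<delta>" "\<bar>cl q - ?t\<bar> \<le> \<delta>" using dist_clamp_to[of 0 T p t] dist_clamp_to[of 0 T q t] a by auto
    have "D n (cl s) = D n s" for s by (simp add: D_def cl_idem)
    then show "dist (Y n q) a \<le> \<rho>"
      using contr[OF cl_mem cl_mem cl', of n] a by (force simp: Y_def)
  qed (use m \<rho> in simp)
qed

end

section \<open>The limit curve\<close>

lemma mono_tendsto_at_left:
  fixes F :: "real \<Rightarrow> real"
  assumes "mono F"
  shows "(F \<longlongrightarrow> (SUP x\<in>{..<t}. F x)) (at_left t)"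
proof (rule order_tendstoI)
  have bdd: "bdd_above (F ` {..<t})" by (rule bdd_aboveI2[of _ _ "F t"]) (rule monoD[OF assms], simp)
  fix a assume a: "a < (SUP x\<in>{..<t}. F x)"
  have "{..<t} \<noteq> {}" by simp
  from a[unfolded less_cSUP_iff[OF this bdd]] obtain x where x: "x < t" "a < F x" by blast
  show "eventually (\<lambda>x. a < F x) (at_left t)"
    unfolding eventually_at_left_field
  proof (intro exI[of _ x] conjI allI impI)
    fix z assume "x < z"
    then show "a < F z" using x(2) monoD[OF assms, of x z] by simp
  qed (rule x(1))
next
  have bdd: "bdd_above (F ` {..<t})" by (rule bdd_aboveI2[of _ _ "F t"]) (rule monoD[OF assms], simp)
  fix a assume a: "(SUP x\<in>{..<t}. F x) < a"
  have "F x < a" if "x < t" for x using cSUP_upper[of x "{..<t}" F] bdd that a by auto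
  then show "eventually (\<lambda>x. F x < a) (at_left t)"
    unfolding eventually_at_left_field by (intro exI[of _ "t - 1"]) auto
qed

text \<open>Pointwise convergence is assumed on a dense set and at the jumps of \<open>F\<close>,
  where small increments of \<open>D n\<close> are not at hand; at the other times it will be
  derived.\<close>

locale viscous_limit = viscous_sequence T E \<epsilon> y u0 R M
  for T :: real and E :: "real \<Rightarrow> 'a::euclidean_space \<Rightarrow> real" and \<epsilon> y u0 R M +
  fixes F :: "real \<Rightarrow> real"
  assumes F_mono: "mono F" and F_right: "continuous (at_right t) F"
    and D_lim: "isCont F t \<Longrightarrow> (\<lambda>n. D n t) \<longlonglongrightarrow> F t"
    and Y_rat: "t \<in> \<rat> \<Longrightarrow> convergent (\<lambda>n. Y n t)"
    and Y_disc: "\<not> isCont F t \<Longrightarrow> convergent (\<lambda>n. Y n t)"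
begin

section \<open>Pointwise convergence and one-sided limits\<close>

definition u :: "real \<Rightarrow> 'a" where "u t = lim (\<lambda>n. Y n t)"

definition F_left :: "real \<Rightarrow> real" where "F_left t = (SUP x\<in>{..<t}. F x)"

lemma F_left_tendsto: "(F \<longlongrightarrow> F_left t) (at_left t)"
  unfolding F_left_def by (rule mono_tendsto_at_left[OF F_mono])

lemma F_right_tendsto: "(F \<longlongrightarrow> F t) (at_right t)"
  using F_right by (simp add: continuous_within)

lemma continuity_point_between: "a < b \<Longrightarrow> \<exists>x. a < x \<and> x < b \<and> isCont F x"
  using open_minus_countable[OF mono_ctble_discont[OF F_mono], of "{a<..<b}"] by auto

text \<open>\<open>D n\<close> is known to converge only at continuity points of \<open>F\<close>.
  Their density allows a neighbourhood of \<open>t\<close> bounded by two such points, with small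
  increment of \<open>F\<close>.\<close>

lemma window:
  assumes c: "isCont F t" and "e > 0" "\<delta> > 0"
  obtains p q where "t - \<delta> < p" "p < t" "t < q" "q < t + \<delta>" "isCont F p" "isCont F q" "F q - F p < e"
proof -
  obtain d where d: "d > 0" "\<And>x. \<bar>x - t\<bar> < d \<Longrightarrow> \<bar>F x - F t\<bar> < e / 2"
    using c half_gt_zero[OF \<open>e > 0\<close>] unfolding continuous_at_eps_delta dist_real_def by blast
  define r where "r = min d \<delta>"
  have r: "r > 0" "r \<le> d" "r \<le> \<delta>" using d(1) \<open>\<delta> > 0\<close> by (auto simp: r_def)
  obtain p where p: "t - r < p" "p < t" "isCont F p" using continuity_point_between[of "t - r" t] r by auto
  obtain q where q: "t < q" "q < t + r" "isCont F q" using continuity_point_between[of t "t + r"] r by auto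
  have "\<bar>F p - F t\<bar> < e / 2" "\<bar>F q - F t\<bar> < e / 2" using d(2)[of p] d(2)[of q] p q r by auto
  then have "F q - F p < e" by argo
  then show ?thesis using p q r by (intro that[of p q]) auto
qed

text \<open>Monotonicity of \<open>D n\<close> reduces all increments inside \<open>{p..q}\<close>
  to the one between the end points, so that the estimate is uniform in the two times.\<close>

lemma D_gap_eventually:
  assumes "isCont F p" "isCont F q" "F q - F p < c"
  shows "eventually (\<lambda>n. \<forall>s\<in>{p..q}. \<forall>t\<in>{p..q}. \<bar>D n t - D n s\<bar> < c) sequentially"
proof -
  have "(\<lambda>n. D n q - D n p) \<longlonglongrightarrow> F q - F p" by (intro tendsto_diff D_lim assms)
  then have "eventually (\<lambda>n. D n q - D n p < c) sequentially" using assms(3) by (rule order_tendstoD)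
  then show ?thesis
  proof eventually_elim
    case (elim n)
    show ?case
    proof (intro ballI)
      fix s t assume "s \<in> {p..q}" "t \<in> {p..q}"
      then have "D n p \<le> D n s" "D n s \<le> D n q" "D n p \<le> D n t" "D n t \<le> D n q" by (auto intro: monoD[OF D_mono])
      then show "\<bar>D n t - D n s\<bar> < c" using elim by linarith
    qed
  qed
qed

text \<open>At a continuity point let \<open>a\<close> be the limit of a subsequence.
  \<open>oscillation\<close> carries closeness to \<open>a\<close> along that subsequence from
  \<open>t\<close> to a nearby rational \<open>s\<close>; there the whole sequence converges, so
  closeness holds for all large \<open>n\<close> and is carried back to \<open>t\<close>.\<close>

lemma Y_convergent: "convergent (\<lambda>n. Y n t)"
proof (cases "isCont F t")
  case True
  have b: "bounded (range (\<lambda>n. Y n t))" by (rule boundedI[of _ R]) (auto simp: Y_bound)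
  obtain a r where r: "strict_mono (r::nat\<Rightarrow>nat)" "((\<lambda>n. Y n t) \<circ> r) \<longlonglongrightarrow> a"
    using bounded_imp_convergent_subsequence[OF b] by blast
  have "(\<lambda>n. Y n t) \<longlonglongrightarrow> a"
  proof (rule tendstoI)
    fix e :: real assume "e > 0"
    then have e2: "e / 2 > 0" by simp
    obtain \<rho> \<delta> c where o1: "0 < \<rho>" "\<rho> \<le> e / 2" "\<delta> > 0" "c > 0"
      "\<And>n p q. \<bar>p - t\<bar> \<le> \<delta> \<Longrightarrow> \<bar>q - t\<bar> \<le> \<delta> \<Longrightarrow> dist (Y n p) a \<le> \<rho> / 2 \<Longrightarrow> \<bar>D n q - D n p\<bar> < c \<Longrightarrow> dist (Y n q) a \<le> \<rho>"
      by (rule oscillation[OF e2, of t a]) (rule that)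
    \<comment> \<open>The transfer to \<open>s\<close> uses a finer scale, since its outcome must be
      good enough to start the transfer back at scale \<open>\<rho>\<close>.\<close>
    have r4: "\<rho> / 4 > 0" using o1 by simp
    obtain \<rho>' \<delta>' c' where o2: "0 < \<rho>'" "\<rho>' \<le> \<rho> / 4" "\<delta>' > 0" "c' > 0"
      "\<And>n p q. \<bar>p - t\<bar> \<le> \<delta>' \<Longrightarrow> \<bar>q - t\<bar> \<le> \<delta>' \<Longrightarrow> dist (Y n p) a \<le> \<rho>' / 2 \<Longrightarrow> \<bar>D n q - D n p\<bar> < c' \<Longrightarrow> dist (Y n q) a \<le> \<rho>'"
      by (rule oscillation[OF r4, of t a]) (rule that)
    obtain p q where w: "t - min \<delta> \<delta>' < p" "p < t" "t < q" "q < t + min \<delta> \<delta>'" "isCont F p" "isCont F q" "F q - F p < min c c'"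
      by (rule window[OF True, of "min c c'" "min \<delta> \<delta>'"]) (use o1 o2 in auto)
    obtain s where s: "s \<in> \<rat>" "t < s" "s < q" using Rats_dense_in_real[OF w(3)] by blast
    have near: "\<bar>s - t\<bar> \<le> \<delta>" "\<bar>s - t\<bar> \<le> \<delta>'" using s w by auto
    have gap: "eventually (\<lambda>n. \<bar>D n s - D n t\<bar> < min c c' \<and> \<bar>D n t - D n s\<bar> < min c c') sequentially"
      using D_gap_eventually[OF w(5,6,7)] by eventually_elim (use s w in auto)
    obtain l where l: "(\<lambda>n. Y n s) \<longlonglongrightarrow> l" using Y_rat[OF s(1)] by (auto simp: convergent_def)
    have "dist l a \<le> \<rho>'"
    proof (rule tendsto_upperbound)
      show "(\<lambda>n. dist (Y (r n) s) a) \<longlonglongrightarrow> dist l a"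
        using LIMSEQ_subseq_LIMSEQ[OF l r(1)] by (intro tendsto_dist tendsto_const) (simp add: o_def)
      have "eventually (\<lambda>n. dist (Y (r n) t) a < \<rho>' / 2) sequentially"
        using tendstoD[OF r(2), of "\<rho>' / 2"] o2(1) by simp
      moreover have "eventually (\<lambda>n. \<bar>D (r n) s - D (r n) t\<bar> < min c c') sequentially"
        using eventually_subseq[OF r(1) gap] by eventually_elim simp
      ultimately show "eventually (\<lambda>n. dist (Y (r n) s) a \<le> \<rho>') sequentially"
        by eventually_elim (rule o2(5)[of t], use near o2 in auto)
    qed simp
    have "eventually (\<lambda>n. dist (Y n s) l < \<rho> / 4) sequentially" using tendstoD[OF l, of "\<rho> / 4"] o1(1) by simp
    with gap show "eventually (\<lambda>n. dist (Y n t) a < e) sequentially"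
    proof eventually_elim
      case (elim n)
      have "dist (Y n s) a \<le> \<rho> / 2"
        using dist_triangle[of "Y n s" a l] elim(2) \<open>dist l a \<le> \<rho>'\<close> o2(2) by argo
      then have "dist (Y n t) a \<le> \<rho>" by (intro o1(5)[of s t n]) (use near o1 elim(1) in auto)
      then show ?case using o1(2) \<open>e > 0\<close> by simp
    qed
  qed
  then show ?thesis by (auto simp: convergent_def)
qed (rule Y_disc)

lemma Y_lim: "(\<lambda>n. Y n t) \<longlonglongrightarrow> u t"
  unfolding u_def using Y_convergent by (simp add: convergent_LIMSEQ_iff)

lemma u_bound: "norm (u t) \<le> R"
  by (rule tendsto_upperbound[OF tendsto_norm[OF Y_lim[of t]]]) (auto simp: Y_bound)

lemma u_clamp: "u (cl t) = u t"
  unfolding u_def Y_def by (simp add: cl_idem)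

text \<open>One argument for left, right and two-sided neighbourhoods of \<open>t\<close>. The limit
  \<open>v\<close> is a cluster value of \<open>u\<close> along the intervals, and
  \<open>oscillation\<close> transfers closeness to \<open>v\<close> from one time of
  \<open>I d\<close> to all others.\<close>

lemma u_limit_along_intervals:
  fixes I :: "real \<Rightarrow> real set"
  assumes I: "\<And>d. I d \<subseteq> {t - d..t + d}" "\<And>d p q. p \<in> I d \<Longrightarrow> q \<in> I d \<Longrightarrow> {p..q} \<subseteq> I d" "\<And>d. open (I d)"
    "\<And>d. d > 0 \<Longrightarrow> I d \<noteq> {}" "\<And>d d'. d \<le> d' \<Longrightarrow> I d \<subseteq> I d'"
    and gap: "\<And>c. c > 0 \<Longrightarrow> \<exists>d>0. \<forall>p\<in>I d. \<forall>q\<in>I d. F q - F p < c"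
  obtains v where "\<And>e. e > 0 \<Longrightarrow> \<exists>d>0. \<forall>x\<in>I d. dist (u x) v \<le> e"
proof -
  have "\<exists>x. x \<in> I (1 / real (Suc n))" for n using I(4)[of "1 / real (Suc n)"] by auto
  then obtain x where x: "\<And>n. x n \<in> I (1 / real (Suc n))" by metis
  have b: "bounded (range (\<lambda>n. u (x n)))" by (rule boundedI[of _ R]) (auto simp: u_bound)
  obtain v r where r: "strict_mono (r::nat\<Rightarrow>nat)" "((\<lambda>n. u (x n)) \<circ> r) \<longlonglongrightarrow> v"
    using bounded_imp_convergent_subsequence[OF b] by blast
  show ?thesis
  proof (rule that)
    fix e :: real assume "e > 0"
    obtain \<rho> \<delta> c where o: "0 < \<rho>" "\<rho> \<le> e" "\<delta> > 0" "c > 0"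
      "\<And>n p q. \<bar>p - t\<bar> \<le> \<delta> \<Longrightarrow> \<bar>q - t\<bar> \<le> \<delta> \<Longrightarrow> dist (Y n p) v \<le> \<rho> / 2 \<Longrightarrow> \<bar>D n q - D n p\<bar> < c \<Longrightarrow> dist (Y n q) v \<le> \<rho>"
      by (rule oscillation[OF \<open>e > 0\<close>, of t v]) (rule that)
    obtain d0 where d0: "d0 > 0" "\<And>p q. p \<in> I d0 \<Longrightarrow> q \<in> I d0 \<Longrightarrow> F q - F p < c" using gap[OF o(4)] by blast
    define d where "d = min d0 \<delta>"
    have d: "d > 0" "d \<le> d0" "d \<le> \<delta>" using d0(1) o(3) by (auto simp: d_def)
    have "eventually (\<lambda>n. dist (u (x (r n))) v < \<rho> / 2) sequentially" using tendstoD[OF r(2), of "\<rho> / 2"] o(1) by simp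
    moreover have "eventually (\<lambda>n. 1 / real (Suc (r n)) < d) sequentially"
      using LIMSEQ_subseq_LIMSEQ[OF LIMSEQ_inverse_real_of_nat r(1)] d(1)
      by (intro order_tendstoD(2)[where y = 0]) (auto simp: o_def inverse_eq_divide)
    ultimately obtain n where n: "dist (u (x (r n))) v < \<rho> / 2" "1 / real (Suc (r n)) < d"
      using eventually_happens'[OF sequentially_bot eventually_conj] by blast
    define p where "p = x (r n)"
    have p: "p \<in> I d" "dist (u p) v < \<rho> / 2" using x[of "r n"] I(5)[of "1 / real (Suc (r n))" d] n by (auto simp: p_def)
    have "dist (u q) v \<le> e" if q: "q \<in> I d" for q
    proof -
      have mm: "min p q \<in> I d" "max p q \<in> I d" using p q by (auto simp: min_def max_def)
      \<comment> \<open>Openness leaves room inside \<open>I d\<close> for continuity points of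
        \<open>F\<close> on both sides of \<open>p\<close> and \<open>q\<close>; between such points
        the increment of \<open>D n\<close> is controlled.\<close>
      obtain e1 where e1: "e1 > 0" "ball (min p q) e1 \<subseteq> I d" using I(3)[of d] mm(1) open_contains_ball by blast
      obtain e2 where e2: "e2 > 0" "ball (max p q) e2 \<subseteq> I d" using I(3)[of d] mm(2) open_contains_ball by blast
      have "min p q - e1 < min p q" by (simp only: diff_less_eq less_add_same_cancel1 e1(1))
      from continuity_point_between[OF this]
      obtain p' where p': "min p q - e1 < p'" "p' < min p q" "isCont F p'" by blast
      have "max p q < max p q + e2" by (simp only: less_add_same_cancel1 e2(1))
      from continuity_point_between[OF this]
      obtain q' where q': "max p q < q'" "q' < max p q + e2" "isCont F q'" by blast
      have "p' \<in> ball (min p q) e1" "q' \<in> ball (max p q) e2" using p' q' by (auto simp: dist_real_def)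
      then have "p' \<in> I d" "q' \<in> I d" using e1 e2 by auto
      then have "F q' - F p' < c" using d0(2) I(5)[OF d(2)] by blast
      then have g: "eventually (\<lambda>n. \<forall>s\<in>{p'..q'}. \<forall>t\<in>{p'..q'}. \<bar>D n t - D n s\<bar> < c) sequentially"
        by (intro D_gap_eventually p' q')
      have nt: "\<bar>p - t\<bar> \<le> \<delta>" "\<bar>q - t\<bar> \<le> \<delta>" using I(1)[of d] p(1) q d(3) by (auto simp: abs_le_iff subset_iff)
      have "dist (u q) v \<le> \<rho>"
      proof (rule tendsto_upperbound)
        show "(\<lambda>n. dist (Y n q) v) \<longlonglongrightarrow> dist (u q) v" by (intro tendsto_dist tendsto_const Y_lim)
        have "eventually (\<lambda>n. dist (Y n p) v < \<rho> / 2) sequentially"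
          by (rule order_tendstoD(2)[OF tendsto_dist[OF Y_lim tendsto_const] p(2)])
        with g show "eventually (\<lambda>n. dist (Y n q) v \<le> \<rho>) sequentially"
          by eventually_elim (rule o(5)[of p], use nt p' q' in auto)
      qed simp
      then show ?thesis using o(2) by simp
    qed
    then show "\<exists>d>0. \<forall>x\<in>I d. dist (u x) v \<le> e" using d(1) by blast
  qed
qed

lemma u_left_limit: "\<exists>v. (u \<longlongrightarrow> v) (at_left t)"
proof -
  have gap: "\<exists>d>0. \<forall>p\<in>{t - d<..<t}. \<forall>q\<in>{t - d<..<t}. F q - F p < c" if "c > 0" for c
  proof -
    have "eventually (\<lambda>x. dist (F x) (F_left t) < c / 2) (at_left t)"
      by (rule tendstoD[OF F_left_tendsto]) (use that in simp)
    then obtain b where b: "b < t" "\<And>x. b < x \<Longrightarrow> x < t \<Longrightarrow> dist (F x) (F_left t) < c / 2"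
      unfolding eventually_at_left_field by blast
    have "F q - F p < c" if "p \<in> {t - (t - b)<..<t}" "q \<in> {t - (t - b)<..<t}" for p q
    proof -
      have "dist (F p) (F_left t) < c / 2" "dist (F q) (F_left t) < c / 2" using that b by auto
      then show ?thesis unfolding dist_real_def by argo
    qed
    then show ?thesis using b(1) by (intro exI[of _ "t - b"]) auto
  qed
  obtain v where v: "\<And>e. e > 0 \<Longrightarrow> \<exists>d>0. \<forall>x\<in>{t - d<..<t}. dist (u x) v \<le> e"
    by (rule u_limit_along_intervals[of "\<lambda>d. {t - d<..<t}" t]) (use gap in auto)
  have "(u \<longlongrightarrow> v) (at_left t)"
  proof (rule tendstoI)
    fix e :: real assume "e > 0"
    then obtain d where d: "d > 0" "\<forall>x\<in>{t - d<..<t}. dist (u x) v \<le> e / 2" using v[of "e / 2"] by auto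
    show "eventually (\<lambda>x. dist (u x) v < e) (at_left t)"
      unfolding eventually_at_left_field using d \<open>e > 0\<close> by (intro exI[of _ "t - d"]) force
  qed
  then show ?thesis by blast
qed

lemma u_right_limit: "\<exists>v. (u \<longlongrightarrow> v) (at_right t)"
proof -
  have gap: "\<exists>d>0. \<forall>p\<in>{t<..<t + d}. \<forall>q\<in>{t<..<t + d}. F q - F p < c" if "c > 0" for c
  proof -
    have "eventually (\<lambda>x. dist (F x) (F t) < c / 2) (at_right t)"
      by (rule tendstoD[OF F_right_tendsto]) (use that in simp)
    then obtain b where b: "t < b" "\<And>x. t < x \<Longrightarrow> x < b \<Longrightarrow> dist (F x) (F t) < c / 2"
      unfolding eventually_at_right_field by blast
    have "F q - F p < c" if "p \<in> {t<..<t + (b - t)}" "q \<in> {t<..<t + (b - t)}" for p q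
    proof -
      have "dist (F p) (F t) < c / 2" "dist (F q) (F t) < c / 2" using that b by auto
      then show ?thesis unfolding dist_real_def by argo
    qed
    then show ?thesis using b(1) by (intro exI[of _ "b - t"]) auto
  qed
  obtain v where v: "\<And>e. e > 0 \<Longrightarrow> \<exists>d>0. \<forall>x\<in>{t<..<t + d}. dist (u x) v \<le> e"
    by (rule u_limit_along_intervals[of "\<lambda>d. {t<..<t + d}" t]) (use gap in auto)
  have "(u \<longlongrightarrow> v) (at_right t)"
  proof (rule tendstoI)
    fix e :: real assume "e > 0"
    then obtain d where d: "d > 0" "\<forall>x\<in>{t<..<t + d}. dist (u x) v \<le> e / 2" using v[of "e / 2"] by auto
    show "eventually (\<lambda>x. dist (u x) v < e) (at_right t)"
      unfolding eventually_at_right_field using d \<open>e > 0\<close> by (intro exI[of _ "t + d"]) force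
  qed
  then show ?thesis by blast
qed

lemma u_continuous:
  assumes c: "isCont F t" shows "isCont u t"
proof -
  have gap: "\<exists>d>0. \<forall>p\<in>{t - d<..<t + d}. \<forall>q\<in>{t - d<..<t + d}. F q - F p < c" if "c > 0" for c
  proof -
    obtain d where d: "d > 0" "\<And>x. \<bar>x - t\<bar> < d \<Longrightarrow> \<bar>F x - F t\<bar> < c / 2"
      using assms half_gt_zero[OF \<open>c > 0\<close>] unfolding continuous_at_eps_delta dist_real_def by blast
    have "F q - F p < c" if "p \<in> {t - d<..<t + d}" "q \<in> {t - d<..<t + d}" for p q
    proof -
      have "\<bar>F p - F t\<bar> < c / 2" "\<bar>F q - F t\<bar> < c / 2" using that d(2)[of p] d(2)[of q] by (auto simp: abs_less_iff)
      then show ?thesis by argo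
    qed
    then show ?thesis using d(1) by blast
  qed
  obtain v where v: "\<And>e. e > 0 \<Longrightarrow> \<exists>d>0. \<forall>x\<in>{t - d<..<t + d}. dist (u x) v \<le> e"
    by (rule u_limit_along_intervals[of "\<lambda>d. {t - d<..<t + d}" t]) (use gap in auto)
  \<comment> \<open>The time \<open>t\<close> itself lies in each interval, so the limit is the
    value there.\<close>
  have "dist (u t) v \<le> 0"
  proof (rule field_le_epsilon)
    fix e :: real assume "e > 0"
    from v[OF this] obtain d where "d > 0" "\<forall>x\<in>{t - d<..<t + d}. dist (u x) v \<le> e" by blast
    then show "dist (u t) v \<le> 0 + e" by simp
  qed
  then have eq: "v = u t" by simp
  show ?thesis
    unfolding continuous_at_eps_delta
  proof (intro allI impI)
    fix e :: real assume "e > 0"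
    then obtain d where d: "d > 0" "\<forall>x\<in>{t - d<..<t + d}. dist (u x) v \<le> e / 2" using v[of "e / 2"] by auto
    show "\<exists>d>0. \<forall>x'. dist x' t < d \<longrightarrow> dist (u x') (u t) < e"
    proof (intro exI[of _ d] conjI allI impI)
      fix x' assume "dist x' t < d"
      then have "x' \<in> {t - d<..<t + d}" by (auto simp: dist_real_def abs_less_iff)
      then have "dist (u x') v \<le> e / 2" using d(2) by blast
      then show "dist (u x') (u t) < e" using \<open>e > 0\<close> eq by simp
    qed (rule d(1))
  qed
qed

definition u_left :: "real \<Rightarrow> 'a" where "u_left t = Lim (at_left t) u"

definition u_right :: "real \<Rightarrow> 'a" where "u_right t = Lim (at_right t) u"

lemma u_left_tendsto: "(u \<longlongrightarrow> u_left t) (at_left t)"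
  using u_left_limit[of t] tendsto_Lim[of "at_left t" u] unfolding u_left_def by auto

lemma u_right_tendsto: "(u \<longlongrightarrow> u_right t) (at_right t)"
  using u_right_limit[of t] tendsto_Lim[of "at_right t" u] unfolding u_right_def by auto

lemma u_zero: "u 0 = u0"
proof -
  have "(\<lambda>n. Y n 0) \<longlonglongrightarrow> u0" using y_init T_pos by (simp add: Y_def clamp_to_id)
  then show ?thesis using Y_lim[of 0] LIMSEQ_unique by blast
qed

lemma u_left_zero: "u_left 0 = u 0"
proof -
  have "u t = u 0" if "t < 0" for t using u_clamp[of t] that T_pos by (simp add: clamp_to_def)
  then have "eventually (\<lambda>t. u t = u 0) (at_left 0)"
    unfolding eventually_at_left_field by (intro exI[of _ "-1"]) auto
  then have "(u \<longlongrightarrow> u 0) (at_left 0)" by (rule tendsto_eventually)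
  then show ?thesis using tendsto_unique[OF _ u_left_tendsto] by simp
qed

lemma u_right_end: "u_right T = u T"
proof -
  have "u t = u T" if "t > T" for t using u_clamp[of t] that T_pos by (simp add: clamp_to_def)
  then have "eventually (\<lambda>t. u t = u T) (at_right T)"
    unfolding eventually_at_right_field by (intro exI[of _ "T + 1"]) auto
  then have "(u \<longlongrightarrow> u T) (at_right T)" by (rule tendsto_eventually)
  then show ?thesis using tendsto_unique[OF _ u_right_tendsto] by simp
qed

text \<open>The trajectories stay in the ball of radius \<open>R\<close>, and \<open>h\<close> is
  bounded on the product of \<open>{0..T}\<close> with it; this constant dominates.\<close>

lemma integral_limit:
  fixes h :: "real \<times> 'a \<Rightarrow> real"
  assumes h: "continuous_on ({0..T} \<times> UNIV) h" and pq: "0 \<le> p" "q \<le> T"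
  shows "(\<lambda>r. h (r, u r)) integrable_on {p..q}"
    and "(\<lambda>n. integral {p..q} (\<lambda>r. h (r, y n r))) \<longlonglongrightarrow> integral {p..q} (\<lambda>r. h (r, u r))"
proof -
  have sub: "{p..q} \<subseteq> {0..T}" using pq by auto
  have "compact (h ` ({0..T} \<times> cball 0 R))"
    by (rule compact_continuous_image[OF continuous_on_subset[OF h]])
      (blast, intro compact_Times compact_Icc compact_cball)
  from compact_imp_bounded[OF this] obtain B where B: "\<forall>x \<in> h ` ({0..T} \<times> cball 0 R). norm x \<le> B"
    unfolding bounded_iff by blast
  have 1: "(\<lambda>r. h (r, y n r)) integrable_on {p..q}" for n
    by (intro integrable_continuous_real continuous_on_compose2[OF h] continuous_intros continuous_on_subset[OF y_continuous sub]) (use sub in auto)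
  have 2: "(\<lambda>_. B) integrable_on {p..q}" by (simp add: integrable_const_ivl)
  have 3: "norm (h (r, y n r)) \<le> B" if "r \<in> {p..q}" for n r
  proof -
    have "(r, y n r) \<in> {0..T} \<times> cball 0 R" using that sub y_bound[of r n] by auto
    then show ?thesis using B by blast
  qed
  have 4: "(\<lambda>n. h (r, y n r)) \<longlonglongrightarrow> h (r, u r)" if "r \<in> {p..q}" for r
  proof -
    have r: "r \<in> {0..T}" using that sub by blast
    then have "(\<lambda>n. y n r) \<longlonglongrightarrow> u r" using Y_lim[of r] by (simp add: Y_def clamp_to_id)
    then have "(\<lambda>n. (r, y n r)) \<longlonglongrightarrow> (r, u r)" by (intro tendsto_intros)
    then show ?thesis by (rule continuous_on_tendsto_compose[OF h]) (use r in auto)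
  qed
  show "(\<lambda>r. h (r, u r)) integrable_on {p..q}"
    by (rule dominated_convergence(1)[OF 1 2 3 4])
  show "(\<lambda>n. integral {p..q} (\<lambda>r. h (r, y n r))) \<longlonglongrightarrow> integral {p..q} (\<lambda>r. h (r, u r))"
    by (rule dominated_convergence(2)[OF 1 2 3 4])
qed

section \<open>The energy balance in the limit\<close>

lemma power_integrable: "0 \<le> p \<Longrightarrow> q \<le> T \<Longrightarrow> (\<lambda>r. time_deriv T E r (u r)) integrable_on {p..q}"
  using integral_limit(1)[OF continuous_on_time_deriv] by simp

definition work :: "real \<Rightarrow> real" where "work t = integral {0..cl t} (\<lambda>r. time_deriv T E r (u r))"

lemma work_continuous: "continuous_on UNIV work"
proof -
  have "continuous_on {0..T} (\<lambda>t. integral {0..t} (\<lambda>r. time_deriv T E r (u r)))"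
    by (rule indefinite_integral_continuous_1) (rule power_integrable, auto)
  then show ?thesis unfolding work_def
    by (rule continuous_on_compose2[OF _ clamp_to_continuous]) (use cl_mem in blast)
qed

lemma balance_at_continuity_point:
  assumes c: "isCont F t"
  shows "F t + E (cl t) (u t) = E 0 u0 + work t"
proof -
  have ct: "cl t \<in> {0..T}" by (rule cl_mem)
  have eq: "E (cl t) (y n (cl t)) - E 0 (y n 0) = integral {0..cl t} (\<lambda>r. time_deriv T E r (y n r)) - D n t" for n
    unfolding D_def by (rule energy_balance[OF \<epsilon>_pos flow]) (use ct in auto)
  have a: "continuous_on UNIV (E s)" if "s \<in> {0..T}" for s
    by (rule continuous_on_compose_energy(1)[OF continuous_on_const continuous_on_id]) (rule that)
  have "(\<lambda>n. E (cl t) (Y n t) - E 0 (y n 0)) \<longlonglongrightarrow> E (cl t) (u t) - E 0 u0"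
    by (intro tendsto_diff continuous_on_tendsto_compose[OF a] Y_lim y_init) (use ct T_pos in auto)
  moreover have "(\<lambda>n. integral {0..cl t} (\<lambda>r. time_deriv T E r (y n r)) - D n t) \<longlonglongrightarrow> work t - F t"
    using integral_limit(2)[OF continuous_on_time_deriv, of 0 "cl t"] ct
    by (intro tendsto_diff D_lim c) (simp add: work_def)
  ultimately have "E (cl t) (u t) - E 0 u0 = work t - F t"
    using eq by (intro LIMSEQ_unique) (simp_all add: Y_def)
  then show ?thesis by simp
qed

text \<open>Used with continuity points approaching \<open>t\<close> from the left and from the
  right; in the difference of the two resulting balances the work cancels.\<close>

lemma balance_limit:
  assumes x: "x \<longlonglongrightarrow> t" "\<And>n. isCont F (x n)" and f: "(\<lambda>n. F (x n)) \<longlonglongrightarrow> f" and v: "(\<lambda>n. u (x n)) \<longlonglongrightarrow> v"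
  shows "f + E (cl t) v = E 0 u0 + work t"
proof -
  have "(\<lambda>n. cl (x n)) \<longlonglongrightarrow> cl t"
    by (rule continuous_on_tendsto_compose[OF clamp_to_continuous[of UNIV] x(1)]) auto
  then have p: "(\<lambda>n. (cl (x n), u (x n))) \<longlonglongrightarrow> (cl t, v)" by (intro tendsto_intros v)
  have "(\<lambda>n. E (fst (cl (x n), u (x n))) (snd (cl (x n), u (x n)))) \<longlonglongrightarrow> E (fst (cl t, v)) (snd (cl t, v))"
    by (rule continuous_on_tendsto_compose[OF continuous_on_energy p]) (use cl_mem in auto)
  then have "(\<lambda>n. F (x n) + E (cl (x n)) (u (x n))) \<longlonglongrightarrow> f + E (cl t) v" by (intro tendsto_add f) simp
  moreover have "(\<lambda>n. E 0 u0 + work (x n)) \<longlonglongrightarrow> E 0 u0 + work t"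
    by (intro tendsto_intros continuous_on_tendsto_compose[OF work_continuous x(1)]) auto
  ultimately show ?thesis
    using balance_at_continuity_point[OF x(2)] by (intro LIMSEQ_unique) simp_all
qed

lemma balance_left: "F_left t + E (cl t) (u_left t) = E 0 u0 + work t"
proof -
  have "\<exists>x. t - 1 / real (Suc n) < x \<and> x < t \<and> isCont F x" for n by (rule continuity_point_between) simp
  then obtain x where x: "\<And>n. t - 1 / real (Suc n) < x n" "\<And>n. x n < t" "\<And>n. isCont F (x n)" by metis
  have l: "(\<lambda>n. t - 1 / real (Suc n)) \<longlonglongrightarrow> t - 0"
    using LIMSEQ_inverse_real_of_nat by (intro tendsto_diff tendsto_const) (simp add: inverse_eq_divide)
  have "x \<longlonglongrightarrow> t"
    by (rule tendsto_sandwich[of "\<lambda>n. t - 1 / real (Suc n)" _ _ "\<lambda>_. t"]) (use l x in \<open>auto intro: always_eventually less_imp_le\<close>)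
  then have fl: "filterlim x (at_left t) sequentially" using x(2) by (auto simp: filterlim_at less_imp_neq)
  show ?thesis
    by (rule balance_limit[OF \<open>x \<longlonglongrightarrow> t\<close> x(3)])
      (rule filterlim_compose[OF F_left_tendsto fl], rule filterlim_compose[OF u_left_tendsto fl])
qed

lemma balance_right: "F t + E (cl t) (u_right t) = E 0 u0 + work t"
proof -
  have "\<exists>x. t < x \<and> x < t + 1 / real (Suc n) \<and> isCont F x" for n by (rule continuity_point_between) simp
  then obtain x where x: "\<And>n. t < x n" "\<And>n. x n < t + 1 / real (Suc n)" "\<And>n. isCont F (x n)" by metis
  have l: "(\<lambda>n. t + 1 / real (Suc n)) \<longlonglongrightarrow> t + 0"
    using LIMSEQ_inverse_real_of_nat by (intro tendsto_add tendsto_const) (simp add: inverse_eq_divide)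
  have "x \<longlonglongrightarrow> t"
    by (rule tendsto_sandwich[of "\<lambda>_. t" _ _ "\<lambda>n. t + 1 / real (Suc n)"]) (use l x in \<open>auto intro: always_eventually less_imp_le\<close>)
  then have fl: "filterlim x (at_right t) sequentially" using x(1) by (auto simp: filterlim_at less_imp_neq[THEN not_sym])
  show ?thesis
    by (rule balance_limit[OF \<open>x \<longlonglongrightarrow> t\<close> x(3)])
      (rule filterlim_compose[OF F_right_tendsto fl], rule filterlim_compose[OF u_right_tendsto fl])
qed

section \<open>Criticality of the one-sided limits\<close>

lemma gradient_vanishes_in_mean:
  assumes pq: "0 \<le> p" "p \<le> q" "q \<le> T"
  shows "(\<lambda>r. (norm (grad (E r) (u r)))\<^sup>2) integrable_on {p..q}"
    and "integral {p..q} (\<lambda>r. (norm (grad (E r) (u r)))\<^sup>2) = 0"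
proof -
  have h: "continuous_on ({0..T} \<times> UNIV) (\<lambda>p. (norm (grad (E (fst p)) (snd p)))\<^sup>2)"
    by (intro continuous_intros continuous_on_grad)
  show "(\<lambda>r. (norm (grad (E r) (u r)))\<^sup>2) integrable_on {p..q}"
    using integral_limit(1)[OF h pq(1,3)] by simp
  have lim: "(\<lambda>n. integral {p..q} (\<lambda>r. (norm (grad (E r) (y n r)))\<^sup>2)) \<longlonglongrightarrow> integral {p..q} (\<lambda>r. (norm (grad (E r) (u r)))\<^sup>2)"
    using integral_limit(2)[OF h pq(1,3)] by simp
  have eq: "integral {p..q} (\<lambda>r. (norm (grad (E r) (y n r)))\<^sup>2) = \<epsilon> n * (D n q - D n p)" for n
    using D_diff[OF pq(2), of n] pq \<epsilon>_pos[of n] by (simp add: clamp_to_id)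
  have "(\<lambda>n. \<epsilon> n * (D n q - D n p)) \<longlonglongrightarrow> 0"
  proof (rule tendsto_sandwich[of "\<lambda>_. 0" _ _ "\<lambda>n. \<epsilon> n * M"])
    show "(\<lambda>n. \<epsilon> n * M) \<longlonglongrightarrow> 0" using tendsto_mult_left[OF \<epsilon>_lim, of M] by (simp add: mult.commute)
    show "eventually (\<lambda>n. 0 \<le> \<epsilon> n * (D n q - D n p)) sequentially"
      using \<epsilon>_pos monoD[OF D_mono pq(2)] by (intro always_eventually allI mult_nonneg_nonneg) (auto intro: less_imp_le)
    have "D n q - D n p \<le> M" for n using D_bounds(1)[of n p] D_bounds(2)[of n q] by linarith
    then show "eventually (\<lambda>n. \<epsilon> n * (D n q - D n p) \<le> \<epsilon> n * M) sequentially"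
      using \<epsilon>_pos by (intro always_eventually allI mult_left_mono) (auto intro: less_imp_le)
  qed simp
  then show "integral {p..q} (\<lambda>r. (norm (grad (E r) (u r)))\<^sup>2) = 0"
    using lim unfolding eq by (rule LIMSEQ_unique[rotated])
qed

text \<open>If the gradient did not vanish at \<open>v\<close>, its norm would be bounded below
  along \<open>u\<close> on a nondegenerate interval, against the vanishing integral of its square.
  The assumption \<open>int\<close> says that every event of the filter contains such an interval
  inside \<open>{0..T}\<close>.\<close>

lemma limit_is_critical:
  assumes t: "t \<in> {0..T}" and Fl: "((\<lambda>r. r) \<longlongrightarrow> t) Fl" and v: "(u \<longlongrightarrow> v) Fl"
    and int: "\<And>P. eventually P Fl \<Longrightarrow> \<exists>p q. 0 \<le> p \<and> p < q \<and> q \<le> T \<and> (\<forall>r\<in>{p..q}. P r)"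
  shows "v \<in> crit E t"
proof (rule ccontr)
  assume "v \<notin> crit E t"
  then have \<kappa>: "norm (grad (E t) v) > 0" by (simp add: crit_def)
  have "((\<lambda>r. cl r) \<longlongrightarrow> cl t) Fl"
    by (rule continuous_on_tendsto_compose[OF clamp_to_continuous[of UNIV] Fl]) auto
  then have p: "((\<lambda>r. (cl r, u r)) \<longlongrightarrow> (cl t, v)) Fl" by (intro tendsto_intros v)
  have "((\<lambda>r. grad (E (fst (cl r, u r))) (snd (cl r, u r))) \<longlongrightarrow> grad (E (fst (cl t, v))) (snd (cl t, v))) Fl"
    by (rule continuous_on_tendsto_compose[OF continuous_on_grad p]) (use cl_mem in auto)
  then have "((\<lambda>r. norm (grad (E (cl r)) (u r))) \<longlongrightarrow> norm (grad (E t) v)) Fl"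
    using t by (intro tendsto_norm) (simp add: clamp_to_id)
  then have "eventually (\<lambda>r. norm (grad (E t) v) / 2 < norm (grad (E (cl r)) (u r))) Fl"
    by (rule order_tendstoD) (use \<kappa> in simp)
  then obtain p q where pq: "0 \<le> p" "p < q" "q \<le> T" "\<And>r. r \<in> {p..q} \<Longrightarrow> norm (grad (E t) v) / 2 < norm (grad (E (cl r)) (u r))"
    using int by blast
  have "integral {p..q} (\<lambda>r. (norm (grad (E t) v) / 2)\<^sup>2) \<le> integral {p..q} (\<lambda>r. (norm (grad (E r) (u r)))\<^sup>2)"
  proof (rule integral_le)
    fix r assume r: "r \<in> {p..q}"
    then have "cl r = r" using pq by (intro clamp_to_id) auto
    then show "(norm (grad (E t) v) / 2)\<^sup>2 \<le> (norm (grad (E r) (u r)))\<^sup>2"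
      using pq(4)[OF r] by (intro power_mono) auto
  qed (use gradient_vanishes_in_mean(1)[of p q] pq in \<open>auto simp: integrable_const_ivl\<close>)
  moreover have "integral {p..q} (\<lambda>r. (norm (grad (E t) v) / 2)\<^sup>2) > 0" using pq \<kappa> by simp
  ultimately show False using gradient_vanishes_in_mean(2)[of p q] pq by simp
qed

lemma u_left_critical:
  assumes t: "0 < t" "t \<le> T" shows "u_left t \<in> crit E t"
proof (rule limit_is_critical[OF _ _ u_left_tendsto])
  show "\<exists>p q. 0 \<le> p \<and> p < q \<and> q \<le> T \<and> (\<forall>r\<in>{p..q}. P r)" if "eventually P (at_left t)" for P
  proof -
    obtain b where b: "b < t" "\<And>r. b < r \<Longrightarrow> r < t \<Longrightarrow> P r" using \<open>eventually P (at_left t)\<close> unfolding eventually_at_left_field by blast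
    obtain p where p: "max b 0 < p" "p < t" using dense[of "max b 0" t] b t by auto
    obtain q where q: "p < q" "q < t" using dense[of p t] p by auto
    show ?thesis using p q b t by (intro exI[of _ p] exI[of _ q]) auto
  qed
qed (use t in auto)

lemma u_right_critical:
  assumes t: "0 \<le> t" "t < T" shows "u_right t \<in> crit E t"
proof (rule limit_is_critical[OF _ _ u_right_tendsto])
  show "\<exists>p q. 0 \<le> p \<and> p < q \<and> q \<le> T \<and> (\<forall>r\<in>{p..q}. P r)" if "eventually P (at_right t)" for P
  proof -
    obtain b where b: "t < b" "\<And>r. t < r \<Longrightarrow> r < b \<Longrightarrow> P r" using \<open>eventually P (at_right t)\<close> unfolding eventually_at_right_field by blast
    obtain q where q: "t < q" "q < min b T" using dense[of t "min b T"] b t by auto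
    obtain p where p: "t < p" "p < q" using dense[of t q] q by auto
    show ?thesis using p q b t by (intro exI[of _ p] exI[of _ q]) auto
  qed
qed (use t in auto)

end

section \<open>Cost of a jump and the defect measure\<close>

lemma finite_separated:
  fixes W :: "'a::metric_space set"
  assumes "finite W"
  obtains d where "d > 0" "\<And>x y. x \<in> W \<Longrightarrow> y \<in> W \<Longrightarrow> x \<noteq> y \<Longrightarrow> d \<le> dist x y"
proof (cases "W = {}")
  case True then show ?thesis by (intro that[of 1]) auto
next
  case False
  have "\<forall>x\<in>W. \<exists>d>0. \<forall>y\<in>W. y \<noteq> x \<longrightarrow> d \<le> dist x y" using finite_set_avoid[OF assms] by blast
  then obtain \<delta> where \<delta>: "\<And>x. x \<in> W \<Longrightarrow> \<delta> x > 0" "\<And>x y. x \<in> W \<Longrightarrow> y \<in> W \<Longrightarrow> y \<noteq> x \<Longrightarrow> \<delta> x \<le> dist x y" by metis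
  show ?thesis
  proof (rule that[of "Min (\<delta> ` W)"])
    show "Min (\<delta> ` W) > 0" using assms False \<delta>(1) by simp
    fix x y assume "x \<in> W" "y \<in> W" "x \<noteq> y"
    then have "Min (\<delta> ` W) \<le> \<delta> x" "\<delta> x \<le> dist x y" using assms \<delta>(2)[of x y] by auto
    then show "Min (\<delta> ` W) \<le> dist x y" by linarith
  qed
qed

section \<open>Upper bound for the cost of a jump\<close>

context viscous_limit
begin

lemma u_left_bound: "norm (u_left t) \<le> R"
  by (rule tendsto_upperbound[OF tendsto_norm[OF u_left_tendsto]]) (auto simp: u_bound)

lemma u_right_bound: "norm (u_right t) \<le> R"
  by (rule tendsto_upperbound[OF tendsto_norm[OF u_right_tendsto]]) (auto simp: u_bound)

lemma F_left_le: "F_left t \<le> F t"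
  unfolding F_left_def by (rule cSUP_least) (auto intro: monoD[OF F_mono] less_imp_le)

lemma left_approximation:
  assumes "e > 0" "\<delta> > 0"
  obtains s where "t - \<delta> < s" "s < t" "isCont F s" "dist (u s) (u_left t) < e" "\<bar>F s - F_left t\<bar> < e"
proof -
  have "eventually (\<lambda>s. dist (u s) (u_left t) < e \<and> dist (F s) (F_left t) < e) (at_left t)"
    by (intro eventually_conj tendstoD[OF u_left_tendsto] tendstoD[OF F_left_tendsto] assms)
  then obtain b where b: "b < t" "\<And>s. b < s \<Longrightarrow> s < t \<Longrightarrow> dist (u s) (u_left t) < e \<and> dist (F s) (F_left t) < e"
    unfolding eventually_at_left_field by blast
  have "max b (t - \<delta>) < t" using b assms by simp
  from continuity_point_between[OF this] obtain s where "max b (t - \<delta>) < s" "s < t" "isCont F s" by blast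
  then show ?thesis using b(2)[of s] by (intro that[of s]) (auto simp: dist_real_def)
qed

lemma right_approximation:
  assumes "e > 0" "\<delta> > 0"
  obtains s where "t < s" "s < t + \<delta>" "isCont F s" "dist (u s) (u_right t) < e" "\<bar>F s - F t\<bar> < e"
proof -
  have "eventually (\<lambda>s. dist (u s) (u_right t) < e \<and> dist (F s) (F t) < e) (at_right t)"
    by (intro eventually_conj tendstoD[OF u_right_tendsto] tendstoD[OF F_right_tendsto] assms)
  then obtain b where b: "t < b" "\<And>s. t < s \<Longrightarrow> s < b \<Longrightarrow> dist (u s) (u_right t) < e \<and> dist (F s) (F t) < e"
    unfolding eventually_at_right_field by blast
  have "t < min b (t + \<delta>)" using b assms by simp
  from continuity_point_between[OF this] obtain s where "t < s" "s < min b (t + \<delta>)" "isCont F s" by blast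
  then show ?thesis using b(2)[of s] by (intro that[of s]) (auto simp: dist_real_def)
qed

text \<open>The viscous trajectory across the jump, with the driving time frozen, becomes an admissible curve after
  replacing its portions near critical points by radii; away from them freezing the time changes the
  gradient only by a factor close to one.\<close>

lemma jump_cost_le:
  assumes t: "t \<in> {0..T}" and ne: "u_left t \<noteq> u_right t"
  shows "cost E t (u_left t) (u_right t) \<le> ennreal (F t - F_left t)"
proof (rule ennreal_le_epsilon)
  fix \<eta> :: real assume \<eta>: "0 < \<eta>"
  let ?a = "u_left t" and ?b = "u_right t"
  define \<Delta> where "\<Delta> = F t - F_left t"
  have \<Delta>: "\<Delta> \<ge> 0" using F_left_le by (simp add: \<Delta>_def)
  \<comment> \<open>The radius \<open>R + 1\<close> covers the balls of radius at most one around
    points of \<open>S\<close>, so a critical point in such a ball belongs to the separated set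
    \<open>W\<close>.\<close>
  define W where "W = insert ?a (insert ?b (crit E t \<inter> cball 0 (R + 1)))"
  have "finite W" using crit_locally_finite[OF t] by (simp add: W_def)
  then obtain d where d: "d > 0" "\<And>x y. x \<in> W \<Longrightarrow> y \<in> W \<Longrightarrow> x \<noteq> y \<Longrightarrow> d \<le> dist x y"
    using finite_separated by blast
  \<comment> \<open>Both limits are marked by hand, since the left one at time \<open>0\<close> and
    the right one at time \<open>T\<close> need not be critical.\<close>
  define S where "S = insert ?a (insert ?b (crit E t \<inter> cball 0 R))"
  have S: "finite S" "S \<subseteq> W" "S \<subseteq> cball 0 R" "?a \<in> S" "?b \<in> S"
    using crit_locally_finite[OF t] u_left_bound[of t] u_right_bound[of t] by (auto simp: S_def W_def)
  define N where "N = real (card S)"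
  have N: "N > 0" using S by (auto simp: N_def card_gt_0_iff)
  have cG: "continuous_on A (grad (E t))" for A
    by (rule continuous_on_compose_energy(2)[OF continuous_on_const continuous_on_id]) (rule t)
  have "compact (grad (E t) ` cball 0 (R + 1))" by (rule compact_continuous_image[OF cG compact_cball])
  from compact_imp_bounded[OF this] obtain \<Gamma> where \<Gamma>: "\<Gamma> > 0" "\<forall>x\<in>grad (E t) ` cball 0 (R + 1). norm x \<le> \<Gamma>"
    unfolding bounded_pos by blast
  \<comment> \<open>The bound \<open>d / 3\<close> makes the balls disjoint and free of further
    critical points; the last one limits the total cost \<open>N * (2 * r * \<Gamma>)\<close> of the
    radii to \<open>\<eta> / 2\<close>.\<close>
  define r where "r = min 1 (min (d / 3) (\<eta> / (4 * N * \<Gamma>)))"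
  have "r \<le> d / 3" by (simp add: r_def)
  then have r: "r > 0" "r \<le> 1" "3 * r \<le> d" using d(1) \<eta> N \<Gamma>(1) by (auto simp: r_def)
  have "r \<le> \<eta> / (4 * N * \<Gamma>)" by (simp add: r_def)
  then have "r * (4 * N * \<Gamma>) \<le> \<eta>" using N \<Gamma>(1) by (simp add: pos_le_divide_eq)
  then have rN: "N * (2 * r * \<Gamma>) \<le> \<eta> / 2" by (simp add: mult_ac)
  \<comment> \<open>Serves twice, as excess of the freezing factor over one and as error in the
    increment of \<open>D n\<close>; its size makes
    \<open>(1 + \<eta>1) * (\<Delta> + \<eta>1)\<close> at most
    \<open>\<Delta> + \<eta> / 2\<close>.\<close>
  define \<eta>1 where "\<eta>1 = min 1 (\<eta> / (2 * (\<Delta> + 2)))"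
  have \<eta>1: "\<eta>1 > 0" "\<eta>1 \<le> 1" using \<eta> \<Delta> by (auto simp: \<eta>1_def)
  have "\<eta>1 \<le> \<eta> / (2 * (\<Delta> + 2))" by (simp add: \<eta>1_def)
  then have "\<eta>1 * (2 * (\<Delta> + 2)) \<le> \<eta>" using \<Delta> by (simp add: pos_le_divide_eq)
  moreover have "\<eta>1 * (\<Delta> + 1 + \<eta>1) \<le> \<eta>1 * (\<Delta> + 2)" using \<eta>1 by simp
  ultimately have \<eta>\<Delta>: "(1 + \<eta>1) * (\<Delta> + \<eta>1) \<le> \<Delta> + \<eta> / 2" by (simp add: algebra_simps)
  define Z where "Z = cball 0 R - (\<Union>z\<in>S. ball z r)"
  have cZ: "compact Z" unfolding Z_def by (intro compact_diff compact_cball open_UN) auto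
  have nc: "x \<notin> crit E t" if x: "x \<in> Z" for x
  proof
    assume "x \<in> crit E t"
    then have "x \<in> S" using x by (auto simp: Z_def S_def)
    then have "x \<in> (\<Union>z\<in>S. ball z r)" using r(1) by force
    then show False using x by (simp add: Z_def)
  qed
  obtain m where m: "m > 0" "\<And>x. x \<in> Z \<Longrightarrow> m \<le> norm (grad (E t) x)"
  proof (cases "Z = {}")
    case True then show ?thesis by (intro that[of 1]) auto
  next
    case False
    have "continuous_on Z (\<lambda>x. norm (grad (E t) x))" by (intro continuous_on_norm cG)
    then obtain x0 where x0: "x0 \<in> Z" "\<And>x. x \<in> Z \<Longrightarrow> norm (grad (E t) x0) \<le> norm (grad (E t) x)"
      using continuous_attains_inf[OF cZ False] by blast
    show ?thesis by (rule that[of "norm (grad (E t) x0)"]) (use x0 nc in \<open>auto simp: crit_def\<close>)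
  qed
  \<comment> \<open>The solution of \<open>\<kappa> = \<eta>1 * (m - \<kappa>)\<close>: perturbing a
    vector of norm at least \<open>m\<close> by less than \<open>\<kappa>\<close> leaves one whose
    norm, multiplied by \<open>1 + \<eta>1\<close>, still dominates the original norm.\<close>
  define \<kappa> where "\<kappa> = m * \<eta>1 / (1 + \<eta>1)"
  have \<kappa>: "\<kappa> > 0" "\<kappa> = \<eta>1 * (m - \<kappa>)" using m(1) \<eta>1 by (auto simp: \<kappa>_def field_simps)
  obtain \<delta> where \<delta>: "\<delta> > 0"
    "\<And>s x. s \<in> {0..T} \<Longrightarrow> \<bar>s - t\<bar> \<le> \<delta> \<Longrightarrow> x \<in> cball 0 R \<Longrightarrow> norm (grad (E s) x - grad (E t) x) < \<kappa>"
    using grad_equicontinuous[OF t \<kappa>(1), of 0 R] by blast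
  have frozen: "norm (grad (E t) x) \<le> (1 + \<eta>1) * norm (grad (E s) x)"
    if "s \<in> {0..T}" "\<bar>s - t\<bar> \<le> \<delta>" "x \<in> Z" for s x
  proof -
    have "norm (grad (E s) x - grad (E t) x) < \<kappa>" using \<delta>(2)[OF that(1,2)] that(3) by (simp add: Z_def)
    then have 1: "norm (grad (E t) x) \<le> norm (grad (E s) x) + \<kappa>"
      using norm_triangle_ineq3[of "grad (E s) x" "grad (E t) x"] by (simp add: abs_le_iff)
    then have "m - \<kappa> \<le> norm (grad (E s) x)" using m(2)[OF that(3)] by simp
    then have "\<eta>1 * (m - \<kappa>) \<le> \<eta>1 * norm (grad (E s) x)" using \<eta>1(1) by (intro mult_left_mono) auto
    then show ?thesis using 1 \<kappa>(2) by (simp add: distrib_right)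
  qed
  have e: "min r (\<eta>1 / 2) > 0" using r \<eta>1 by simp
  obtain al where al: "t - \<delta> < al" "al < t" "isCont F al" "dist (u al) ?a < min r (\<eta>1 / 2)" "\<bar>F al - F_left t\<bar> < min r (\<eta>1 / 2)"
    by (rule left_approximation[OF e \<delta>(1), of t])
  obtain be where be: "t < be" "be < t + \<delta>" "isCont F be" "dist (u be) ?b < min r (\<eta>1 / 2)" "\<bar>F be - F t\<bar> < min r (\<eta>1 / 2)"
    by (rule right_approximation[OF e \<delta>(1), of t])
  have "\<bar>F al - F_left t\<bar> < \<eta>1 / 2" "\<bar>F be - F t\<bar> < \<eta>1 / 2" using al(5) be(5) by auto
  then have gap: "F be - F al < \<Delta> + \<eta>1" unfolding \<Delta>_def by argo
  have "(\<lambda>n. D n be - D n al) \<longlonglongrightarrow> F be - F al" by (intro tendsto_diff D_lim al be)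
  then have "eventually (\<lambda>n. D n be - D n al < \<Delta> + \<eta>1) sequentially" using gap by (rule order_tendstoD)
  moreover have "eventually (\<lambda>n. dist (Y n al) ?a < r) sequentially"
    by (rule order_tendstoD(2)[OF tendsto_dist[OF Y_lim tendsto_const]]) (use al in simp)
  moreover have "eventually (\<lambda>n. dist (Y n be) ?b < r) sequentially"
    by (rule order_tendstoD(2)[OF tendsto_dist[OF Y_lim tendsto_const]]) (use be in simp)
  ultimately have "eventually (\<lambda>n. D n be - D n al < \<Delta> + \<eta>1 \<and> dist (Y n al) ?a < r \<and> dist (Y n be) ?b < r) sequentially"
    by eventually_elim simp
  then obtain n where n: "D n be - D n al < \<Delta> + \<eta>1" "dist (Y n al) ?a < r" "dist (Y n be) ?b < r"
    using eventually_happens'[OF sequentially_bot] by blast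
  let ?P = "cl al" and ?Q = "cl be"
  have alb: "al \<le> be" using al be by simp
  have PQ: "0 \<le> ?P" "?P \<le> ?Q" "?Q \<le> T" using cl_mem[of al] cl_mem[of be] clamp_to_mono[OF alb] by auto
  have sub: "{?P..?Q} \<subseteq> {0..T}" using PQ by auto
  \<comment> \<open>Clamping moves \<open>al\<close> and \<open>be\<close> towards \<open>t\<close>,
    because \<open>t\<close> lies in \<open>{0..T}\<close>.\<close>
  have near: "\<bar>s - t\<bar> \<le> \<delta>" if "s \<in> {?P..?Q}" for s
  proof -
    have "al \<le> ?P" "?Q \<le> be" using al(2) be(1) t by (auto simp: clamp_to_def)
    then show ?thesis using that al be by (simp add: abs_le_iff)
  qed
  have cyn: "continuous_on {?P..?Q} (y n)" by (rule continuous_on_subset[OF y_continuous sub])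
  let ?g = "\<lambda>s. (1 + \<eta>1) * ((norm (grad (E s) (y n s)))\<^sup>2 / \<epsilon> n)"
  have "?a = ?b \<or> (\<exists>K. dissipation_path E t ?a ?b K \<and> K \<le> integral {?P..?Q} ?g + real (card S) * (2 * r * \<Gamma>))"
  proof (rule dissipation_path_surgery[OF t r(1) S(1)])
    show "(y n has_vector_derivative - (1 / \<epsilon> n) *\<^sub>R grad (E s) (y n s)) (at s within {?P..?Q})" if "s \<in> {?P..?Q}" for s
      by (rule has_vector_derivative_within_subset[OF flow sub]) (use that sub in blast)
    show "continuous_on {?P..?Q} (\<lambda>s. - (1 / \<epsilon> n) *\<^sub>R grad (E s) (y n s))"
      by (intro continuous_intros continuous_on_compose_energy(2) continuous_on_id cyn) (use sub in blast)
    show "?g integrable_on {?P..?Q}"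
      using integrable_on_cmult_left[OF dissipation_integrable[OF PQ(1,3), of n], of "1 + \<eta>1"] by simp
    show "0 \<le> ?g s" for s using \<eta>1 \<epsilon>_pos[of n] by simp
    show "cball z r \<inter> crit E t \<subseteq> {z}" if z: "z \<in> S" for z
    proof
      fix x assume x: "x \<in> cball z r \<inter> crit E t"
      have "norm x \<le> norm z + dist z x" using norm_triangle_ineq2[of x z] by (simp add: dist_norm norm_minus_commute)
      then have "x \<in> W" using x z S(3) r(2) by (auto simp: W_def)
      then show "x \<in> {z}" using d(2)[of z x] x z S(2) r by force
    qed
    show "norm (grad (E t) x) \<le> \<Gamma>" if "z \<in> S" "x \<in> cball z r" for z x
    proof -
      have "norm x \<le> norm z + dist z x" using norm_triangle_ineq2[of x z] by (simp add: dist_norm norm_minus_commute)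
      then have "x \<in> cball 0 (R + 1)" using that S(3) r(2) by auto
      then show ?thesis using \<Gamma>(2) by blast
    qed
    show "cball z r \<inter> cball z' r = {}" if "z \<in> S" "z' \<in> S" "z \<noteq> z'" for z z'
    proof -
      have "3 * r \<le> dist z z'" using d(2)[of z z'] that S(2) r(3) by force
      then have "\<not> (dist z x \<le> r \<and> dist z' x \<le> r)" for x using dist_triangle2[of z z' x] r(1) by linarith
      then show ?thesis by auto
    qed
    show "?P \<le> ?P" "?P \<le> ?Q" using PQ by auto
    show "y n ?P \<in> cball ?a r" "y n ?Q \<in> cball ?b r" using n by (auto simp: Y_def dist_commute)
    show "y n s \<notin> crit E t \<and> norm (grad (E t) (y n s)) * norm (- (1 / \<epsilon> n) *\<^sub>R grad (E s) (y n s)) \<le> ?g s"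
      if s: "s \<in> {?P..?Q}" and out: "\<And>z. z \<in> S \<Longrightarrow> r \<le> dist z (y n s)" for s
    proof -
      have s': "s \<in> {0..T}" using s sub by blast
      have z: "y n s \<in> Z" using out y_bound[OF s', of n] by (force simp: Z_def)
      have "norm (grad (E t) (y n s)) * norm (- (1 / \<epsilon> n) *\<^sub>R grad (E s) (y n s))
          \<le> ((1 + \<eta>1) * norm (grad (E s) (y n s))) * norm (- (1 / \<epsilon> n) *\<^sub>R grad (E s) (y n s))"
        by (rule mult_right_mono[OF frozen[OF s' near[OF s] z]]) simp
      also have "\<dots> = ?g s" using \<epsilon>_pos[of n] by (simp add: power2_eq_square)
      finally show ?thesis using nc[OF z] by simp
    qed
  qed (use S in auto)
  then obtain K where K: "dissipation_path E t ?a ?b K" "K \<le> integral {?P..?Q} ?g + N * (2 * r * \<Gamma>)"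
    using ne by (auto simp: N_def)
  have "integral {?P..?Q} ?g = (1 + \<eta>1) * (D n be - D n al)" using D_diff[OF alb, of n] by simp
  also have "\<dots> \<le> (1 + \<eta>1) * (\<Delta> + \<eta>1)" using n(1) \<eta>1 by (intro mult_left_mono) auto
  finally have "K \<le> \<Delta> + \<eta>" using K(2) \<eta>\<Delta> rN by argo
  then have "ennreal K \<le> ennreal \<Delta> + ennreal \<eta>" using \<Delta> \<eta> by (simp add: ennreal_plus[symmetric] ennreal_leI del: ennreal_plus)
  then show "cost E t ?a ?b \<le> ennreal (F t - F_left t) + ennreal \<eta>"
    using dissipation_path_cost[OF K(1)] unfolding \<Delta>_def by (rule order_trans[rotated])
qed

text \<open>Half-open intervals have the increments of \<open>F\<close> as measure; letting their
  open left end increase to \<open>s\<close> adds the atom at \<open>s\<close> and brings in the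
  left limit \<open>F_left s\<close>.\<close>

lemma emeasure_Stieltjes_Icc:
  assumes "s \<le> t"
  shows "emeasure (interval_measure F) {s..t} = ennreal (F t - F_left s)"
proof -
  let ?X = "\<lambda>n. s - 1 / real (Suc n)"
  have Ioc: "emeasure (interval_measure F) {a<..b} = F b - F a" if "a \<le> b" for a b
    by (rule emeasure_interval_measure_Ioc[OF that monoD[OF F_mono] F_right])
  have lim: "?X \<longlonglongrightarrow> s - 0"
    using LIMSEQ_inverse_real_of_nat by (intro tendsto_diff tendsto_const) (simp add: inverse_eq_divide)
  then have fl: "filterlim ?X (at_left s) sequentially" by (simp add: filterlim_at)
  have Xt: "?X n \<le> t" for n
  proof -
    have "?X n < s" by simp
    then show ?thesis using assms by linarith
  qed
  have "(\<Inter>n. {?X n<..t}) = {s..t}"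
  proof (intro equalityI subsetI)
    fix x assume x: "x \<in> (\<Inter>n. {?X n<..t})"
    have "s \<le> x" by (rule LIMSEQ_le_const2[OF lim[simplified]]) (use x in \<open>auto intro: less_imp_le\<close>)
    then show "x \<in> {s..t}" using x by auto
  next
    fix x assume x: "x \<in> {s..t}"
    have "?X n < x" for n
    proof -
      have "?X n < s" by simp
      also have "s \<le> x" using x by simp
      finally show ?thesis .
    qed
    then show "x \<in> (\<Inter>n. {?X n<..t})" using x by simp
  qed
  moreover have "(\<lambda>n. emeasure (interval_measure F) {?X n<..t}) \<longlonglongrightarrow> emeasure (interval_measure F) (\<Inter>n. {?X n<..t})"
  proof (rule Lim_emeasure_decseq)
    show "decseq (\<lambda>n. {?X n<..t})"
    proof (rule decseq_SucI)
      fix n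
      have "1 / real (Suc (Suc n)) \<le> 1 / real (Suc n)" by (intro divide_left_mono) auto
      then have "?X n \<le> ?X (Suc n)" by linarith
      then show "{?X (Suc n)<..t} \<subseteq> {?X n<..t}" by (auto simp del: of_nat_Suc)
    qed
    show "emeasure (interval_measure F) {?X n<..t} \<noteq> \<infinity>" for n by (subst Ioc[OF Xt]) auto
  qed auto
  moreover have "(\<lambda>n. emeasure (interval_measure F) {?X n<..t}) \<longlonglongrightarrow> ennreal (F t - F_left s)"
  proof -
    have "emeasure (interval_measure F) {?X n<..t} = ennreal (F t - F (?X n))" for n by (rule Ioc[OF Xt])
    moreover have "(\<lambda>n. ennreal (F t - F (?X n))) \<longlonglongrightarrow> ennreal (F t - F_left s)"
      by (intro tendsto_ennrealI tendsto_diff tendsto_const filterlim_compose[OF F_left_tendsto fl])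
    ultimately show ?thesis by simp
  qed
  ultimately show ?thesis using LIMSEQ_unique by metis
qed

end

section \<open>The vanishing viscosity limit\<close>

lemma mem_Lp_bounded:
  fixes f :: "real \<Rightarrow> 'a::euclidean_space"
  assumes m: "f \<in> borel_measurable (lebesgue_on {0..T})" and b: "\<And>t. t \<in> {0..T} \<Longrightarrow> norm (f t) \<le> R" and p: "p \<ge> 1"
  shows "mem_Lp p T f" and "mem_Linf T f"
proof -
  interpret finite_measure "lebesgue_on {0..T}" by (rule finite_measure_lebesgue_on) simp
  have "integrable (lebesgue_on {0..T}) (\<lambda>t. norm (f t) powr p)"
  proof (rule integrable_const_bound)
    show "AE t in lebesgue_on {0..T}. norm (norm (f t) powr p) \<le> R powr p"
      by (rule AE_I2) (use b p in \<open>auto intro!: powr_mono2\<close>)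
    show "(\<lambda>t. norm (f t) powr p) \<in> borel_measurable (lebesgue_on {0..T})" using m by measurable
  qed
  then show "mem_Lp p T f" using m by (simp add: mem_Lp_def)
  show "mem_Linf T f" unfolding mem_Linf_def using m b by (auto intro!: exI[of _ R] AE_I2)
qed

text \<open>The uniform bound supplies the dominating functions: the constant
  \<open>(2 * R) powr p\<close> for strong convergence and \<open>norm (\<phi> t) * R\<close> for
  the pairing with an integrable \<open>\<phi>\<close>.\<close>

lemma bounded_convergence_Lp:
  fixes f :: "nat \<Rightarrow> real \<Rightarrow> 'a::euclidean_space"
  assumes m: "\<And>n. f n \<in> borel_measurable (lebesgue_on {0..T})" "g \<in> borel_measurable (lebesgue_on {0..T})"
    and b: "\<And>n t. t \<in> {0..T} \<Longrightarrow> norm (f n t) \<le> R"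
    and lim: "\<And>t. t \<in> {0..T} \<Longrightarrow> (\<lambda>n. f n t) \<longlonglongrightarrow> g t"
  shows "p \<ge> 1 \<Longrightarrow> tendsto_Lp p T f g" and "weak_star_tendsto_Linf T f g"
proof -
  have bg: "norm (g t) \<le> R" if "t \<in> {0..T}" for t
    by (rule tendsto_upperbound[OF tendsto_norm[OF lim[OF that]]]) (use b that in auto)
  interpret finite_measure "lebesgue_on {0..T}" by (rule finite_measure_lebesgue_on) simp
  note [measurable] = m
  show "tendsto_Lp p T f g" if p: "p \<ge> 1"
    unfolding tendsto_Lp_def
  proof (intro conjI allI mem_Lp_bounded(1)[OF m(1) b p] mem_Lp_bounded(1)[OF m(2) bg p])
    have "(\<lambda>n. LINT t|lebesgue_on {0..T}. norm (f n t - g t) powr p) \<longlonglongrightarrow> (LINT t|lebesgue_on {0..T}. 0)"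
    proof (rule integral_dominated_convergence[where w = "\<lambda>_. (2 * R) powr p"])
      show "AE t in lebesgue_on {0..T}. (\<lambda>n. norm (f n t - g t) powr p) \<longlonglongrightarrow> 0"
      proof (rule AE_I2)
        fix t assume "t \<in> space (lebesgue_on {0..T})"
        then have "(\<lambda>n. norm (f n t - g t)) \<longlonglongrightarrow> 0" using lim[of t] by (simp add: tendsto_norm_zero LIM_zero)
        then show "(\<lambda>n. norm (f n t - g t) powr p) \<longlonglongrightarrow> 0"
          by (rule tendsto_zero_powrI) (use p in auto)
      qed
      show "AE t in lebesgue_on {0..T}. norm (norm (f n t - g t) powr p) \<le> (2 * R) powr p" for n
      proof (rule AE_I2)
        fix t assume "t \<in> space (lebesgue_on {0..T})"
        then have "norm (f n t - g t) \<le> 2 * R" using b[of t n] bg[of t] norm_triangle_ineq4[of "f n t" "g t"] by simp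
        then show "norm (norm (f n t - g t) powr p) \<le> (2 * R) powr p" using p by (auto intro!: powr_mono2)
      qed
    qed auto
    then show "(\<lambda>n. LINT t|lebesgue_on {0..T}. norm (f n t - g t) powr p) \<longlonglongrightarrow> 0" by simp
  qed
  show "weak_star_tendsto_Linf T f g"
    unfolding weak_star_tendsto_Linf_def
  proof (intro conjI allI impI mem_Lp_bounded(2)[OF m(1) b order_refl] mem_Lp_bounded(2)[OF m(2) bg order_refl])
    fix \<phi> :: "real \<Rightarrow> 'a" assume \<phi>: "mem_Lp 1 T \<phi>"
    then have [measurable]: "\<phi> \<in> borel_measurable (lebesgue_on {0..T})" by (simp add: mem_Lp_def)
    have i: "integrable (lebesgue_on {0..T}) (\<lambda>t. norm (\<phi> t))" using \<phi> by (simp add: mem_Lp_def)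
    show "(\<lambda>n. LINT t|lebesgue_on {0..T}. \<phi> t \<bullet> f n t) \<longlonglongrightarrow> (LINT t|lebesgue_on {0..T}. \<phi> t \<bullet> g t)"
    proof (rule integral_dominated_convergence[where w = "\<lambda>t. norm (\<phi> t) * R"])
      show "AE t in lebesgue_on {0..T}. (\<lambda>n. \<phi> t \<bullet> f n t) \<longlonglongrightarrow> \<phi> t \<bullet> g t"
        by (rule AE_I2) (auto intro!: tendsto_inner lim)
      show "AE t in lebesgue_on {0..T}. norm (\<phi> t \<bullet> f n t) \<le> norm (\<phi> t) * R" for n
      proof (rule AE_I2)
        fix t assume "t \<in> space (lebesgue_on {0..T})"
        then have "norm (\<phi> t) * norm (f n t) \<le> norm (\<phi> t) * R" using b by (intro mult_left_mono) auto
        then show "norm (\<phi> t \<bullet> f n t) \<le> norm (\<phi> t) * R" using Cauchy_Schwarz_ineq2[of "\<phi> t" "f n t"] by simp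
      qed
      show "integrable (lebesgue_on {0..T}) (\<lambda>t. norm (\<phi> t) * R)" using i by simp
    qed auto
  qed
qed

section \<open>Verification of the defining properties of a solution\<close>

context viscous_limit
begin

lemma y_measurable: "y n \<in> borel_measurable (lebesgue_on {0..T})"
  by (rule continuous_imp_measurable_on_sets_lebesgue[OF y_continuous]) simp

lemma y_lim: "t \<in> {0..T} \<Longrightarrow> (\<lambda>n. y n t) \<longlonglongrightarrow> u t"
  using Y_lim[of t] by (simp add: Y_def clamp_to_id)

lemma u_measurable: "u \<in> borel_measurable (lebesgue_on {0..T})"
  by (rule borel_measurable_LIMSEQ_metric[OF y_measurable]) (use y_lim in simp)

text \<open>\<open>work\<close> is a gauge integral, whereas a solution is defined with a Lebesgue
  integral; the power is bounded along \<open>u\<close>, so the integrand is absolutely integrable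
  and the two agree.\<close>

lemma power_integral:
  assumes "0 \<le> s" "s \<le> t" "t \<le> T"
  shows "(LINT r|lebesgue_on {s..t}. time_deriv T E r (u r)) = work t - work s"
proof -
  have "compact ((\<lambda>p. time_deriv T E (fst p) (snd p)) ` ({0..T} \<times> cball 0 R))"
    by (rule compact_continuous_image[OF continuous_on_subset[OF continuous_on_time_deriv]])
      (blast, intro compact_Times compact_Icc compact_cball)
  from compact_imp_bounded[OF this]
  obtain B where B: "\<forall>x \<in> (\<lambda>p. time_deriv T E (fst p) (snd p)) ` ({0..T} \<times> cball 0 R). norm x \<le> B"
    unfolding bounded_iff by blast
  have b: "norm (time_deriv T E r (u r)) \<le> B" if "r \<in> {s..t}" for r
  proof -
    have "(r, u r) \<in> {0..T} \<times> cball 0 R" using that assms u_bound[of r] by auto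
    then show ?thesis using B by (metis (no_types, lifting) fst_conv image_eqI snd_conv)
  qed
  have i: "(\<lambda>r. time_deriv T E r (u r)) integrable_on {p..q}" if "0 \<le> p" "q \<le> T" for p q
    by (rule power_integrable[OF that])
  have "(\<lambda>r. time_deriv T E r (u r)) absolutely_integrable_on {s..t}"
    by (rule absolutely_integrable_integrable_bound[OF b i[OF assms(1,3)]]) (auto simp: integrable_const_ivl)
  then have "integrable (lebesgue_on {s..t}) (\<lambda>r. time_deriv T E r (u r))"
    by (simp add: integrable_restrict_space set_integrable_def)
  then have "(LINT r|lebesgue_on {s..t}. time_deriv T E r (u r)) = integral {s..t} (\<lambda>r. time_deriv T E r (u r))"
    by (rule lebesgue_integral_eq_integral) simp
  moreover have "integral {0..s} (\<lambda>r. time_deriv T E r (u r)) + integral {s..t} (\<lambda>r. time_deriv T E r (u r))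
      = integral {0..t} (\<lambda>r. time_deriv T E r (u r))"
    by (rule Henstock_Kurzweil_Integration.integral_combine) (use assms i in auto)
  ultimately show ?thesis using assms by (simp add: work_def clamp_to_id)
qed

lemma continuity_point_iff: "isCont F t \<longleftrightarrow> F_left t = F t"
proof
  assume "isCont F t"
  then have "(F \<longlongrightarrow> F t) (at_left t)" unfolding isCont_def by (rule filterlim_mono[OF _ order_refl at_le]) simp
  then show "F_left t = F t" using tendsto_unique[OF _ F_left_tendsto] by simp
next
  assume "F_left t = F t"
  then show "isCont F t"
    using F_left_tendsto[of t] F_right_tendsto[of t] by (simp add: isCont_def filterlim_split_at)
qed

text \<open>As \<open>{s..t}\<close> has measure \<open>F t - F_left s\<close>, the required balance
  is the right balance at \<open>t\<close> minus the left balance at \<open>s\<close>.\<close>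

theorem DV_solution_limit: "DV_solution_with T E u (restrict_space (interval_measure F) {0..T})"
proof -
  let ?\<mu> = "restrict_space (interval_measure F) {0..T}"
  have em: "emeasure ?\<mu> {s..t} = ennreal (F t - F_left s)" if "0 \<le> s" "s \<le> t" "t \<le> T" for s t
    using emeasure_Stieltjes_Icc[OF that(2)] that by (subst emeasure_restrict_space) auto
  have Fle: "F_left s \<le> F t" if "s \<le> t" for s t using F_left_le[of s] monoD[OF F_mono that] by linarith
  have me: "measure ?\<mu> {s..t} = F t - F_left s" if "0 \<le> s" "s \<le> t" "t \<le> T" for s t
    using em[OF that] Fle[OF that(2)] by (simp add: measure_def)
  have sing: "measure ?\<mu> {t} = F t - F_left t" "emeasure ?\<mu> {t} = ennreal (F t - F_left t)" if "t \<in> {0..T}" for t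
    using me[of t t] em[of t t] that by auto
  have L: "left_lim u t = u_left t" for t
    by (simp add: left_lim_def u_left_def[symmetric] u_left_zero)
  have Rr: "right_lim T u t = u_right t" for t
    by (simp add: right_lim_def u_right_def[symmetric] u_right_end)
  have fin: "finite_measure ?\<mu>"
  proof (rule finite_measureI)
    have "space ?\<mu> = {0..T}" by (simp add: space_restrict_space)
    then show "emeasure ?\<mu> (space ?\<mu>) \<noteq> \<infinity>" using em[of 0 T] T_pos by simp
  qed
  have drop: "F t - F_left t = E t (u_left t) - E t (u_right t)" if "t \<in> {0..T}" for t
    using balance_left[of t] balance_right[of t] that by (simp add: clamp_to_id)
  have cont: "isCont F t \<longleftrightarrow> measure ?\<mu> {t} = 0" if "t \<in> {0..T}" for t
    using sing(1)[OF that] by (auto simp: continuity_point_iff)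
  \<comment> \<open>An atom forces an energy drop, hence distinct one-sided limits; without an atom
    \<open>F\<close> is continuous at \<open>t\<close>, and then so is \<open>u\<close>.\<close>
  have J: "measure ?\<mu> {t} > 0 \<longleftrightarrow> u_left t \<noteq> u_right t" if t: "t \<in> {0..T}" for t
  proof
    assume "measure ?\<mu> {t} > 0"
    then show "u_left t \<noteq> u_right t" using drop[OF t] sing(1)[OF t] by auto
  next
    assume ne: "u_left t \<noteq> u_right t"
    show "measure ?\<mu> {t} > 0"
    proof (rule ccontr)
      assume "\<not> ?thesis"
      then have "measure ?\<mu> {t} = 0" by (simp add: measure_le_0_iff not_less)
      then have "isCont u t" using cont[OF t] u_continuous by blast
      then have "(u \<longlongrightarrow> u t) (at_left t)" "(u \<longlongrightarrow> u t) (at_right t)"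
        by (auto simp: isCont_def filterlim_at_split)
      then have "u_left t = u t" "u_right t = u t"
        using tendsto_unique[OF _ u_left_tendsto] tendsto_unique[OF _ u_right_tendsto] by simp_all
      then show False using ne by simp
    qed
  qed
  let ?J = "{t \<in> {0..T}. measure ?\<mu> {t} > 0}"
  have notJ: "isCont u t" if "t \<in> {0..T} - ?J" for t
  proof -
    have "measure ?\<mu> {t} = 0" using that by (simp add: not_less measure_le_0_iff)
    then show ?thesis using cont[of t] that u_continuous by blast
  qed
  show ?thesis
    unfolding DV_solution_with_def Let_def L Rr
  proof (intro conjI allI ballI impI)
    show "u \<in> borel_measurable (lebesgue_on {0..T})" by (rule u_measurable)
    show "bounded (u ` {0..T})" by (rule boundedI[of _ R]) (auto simp: u_bound)
    show "\<exists>l. (u \<longlongrightarrow> l) (at_left s)" "\<exists>l. (u \<longlongrightarrow> l) (at_right s)" for s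
      using u_left_limit u_right_limit by blast+
    show "sets ?\<mu> = sets (restrict_space borel {0..T})" by (rule sets_restrict_space_cong) simp
    show "finite_measure ?\<mu>" by (rule fin)
    have "countable {t. measure ?\<mu> {t} \<noteq> 0}" by (rule finite_measure.countable_support[OF fin])
    then show "countable ?J" by (rule countable_subset[rotated]) auto
    show "measure ?\<mu> {s..t} + E t (u_right t) = E s (u_left s) + (LINT r|lebesgue_on {s..t}. time_deriv T E r (u r))"
      if "0 \<le> s \<and> s \<le> t \<and> t \<le> T" for s t
      using balance_left[of s] balance_right[of t] that me[of s t] power_integral[of s t] by (simp add: clamp_to_id)
    show "continuous (at t within {0..T}) u" if "t \<in> {0..T} - ?J" for t
      by (rule continuous_at_imp_continuous_at_within[OF notJ[OF that]])
    \<comment> \<open>Off the atoms \<open>u t\<close> agrees with its left limit, which is critical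
      for \<open>t > 0\<close>.\<close>
    show "u t \<in> crit E t" if t: "t \<in> {0<..T} - ?J" for t
    proof -
      have "isCont u t" using notJ[of t] t by auto
      then have "(u \<longlongrightarrow> u t) (at_left t)" by (simp add: isCont_def filterlim_at_split)
      then have "u t = u_left t" using tendsto_unique[OF _ _ u_left_tendsto] by simp
      then show ?thesis using u_left_critical[of t] t by simp
    qed
    show "u_left s \<in> crit E s" if "s \<in> {0<..T}" for s using u_left_critical[of s] that by simp
    show "u_right t \<in> crit E t" if "t \<in> {0..<T}" for t using u_right_critical[of t] that by simp
    show "?J = {t \<in> {0..T}. u_left t \<noteq> u_right t}" using J by blast
    fix t assume tJ: "t \<in> ?J"
    then have t: "t \<in> {0..T}" and pos: "F t - F_left t > 0" and ne: "u_left t \<noteq> u_right t"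
      using sing(1)[of t] J[of t] by auto
    have "ennreal (F t - F_left t) \<le> cost E t (u_left t) (u_right t)"
      unfolding drop[OF t] by (rule energy_drop_le_cost[OF t])
    then have eq: "cost E t (u_left t) (u_right t) = ennreal (F t - F_left t)"
      using jump_cost_le[OF t ne] by (rule order_antisym[rotated])
    then show "0 < cost E t (u_left t) (u_right t)" using pos by simp
    show "cost E t (u_left t) (u_right t) = emeasure ?\<mu> {t}" using eq sing(2)[OF t] by simp
    show "measure ?\<mu> {t} = E t (u_left t) - E t (u_right t)" using drop[OF t] sing(1)[OF t] by simp
  qed
qed

end

section \<open>Extraction of the subsequence\<close>

context viscous_sequence
begin

text \<open>The diagonal extraction comes after Helly's, because the countable set on which the
  values must converge contains the discontinuities of the limit \<open>F\<close>; the rationals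
  provide density.\<close>

lemma compactness:
  obtains k F where "strict_mono k" "viscous_limit T E (\<lambda>n. \<epsilon> (k n)) (\<lambda>n. y (k n)) u0 R M F"
proof -
  have "continuous (at_right x) (D n)" for n x
    using D_continuous[of UNIV n] by (auto simp: continuous_on_eq_continuous_at intro: continuous_at_imp_continuous_at_within)
  moreover have "\<bar>D n x\<bar> \<le> M" for n x using D_bounds[of n x] by simp
  ultimately obtain s F where s: "strict_mono (s::nat\<Rightarrow>nat)" "\<And>x. continuous (at_right x) F" "mono F"
    "\<And>x. isCont F x \<Longrightarrow> (\<lambda>n. D (s n) x) \<longlonglongrightarrow> F x"
    using Helly_selection[of D M] D_mono by blast
  have "countable (\<rat> \<union> {x. \<not> isCont F x})"
    using mono_ctble_discont[OF s(3)] countable_rat by (intro countable_Un)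
  then obtain r :: "nat \<Rightarrow> nat" where r: "strict_mono r"
    "\<And>x. x \<in> \<rat> \<union> {x. \<not> isCont F x} \<Longrightarrow> convergent (\<lambda>n. Y (s (r n)) x)"
    by (rule convergent_subsequence_on_countable[where f = "\<lambda>n. Y (s n)" and R = R]) (use Y_bound in blast)+
  let ?k = "\<lambda>n. s (r n)"
  have k: "strict_mono ?k" using s(1) r(1) by (simp add: strict_mono_def)
  interpret k: viscous_sequence T E "\<lambda>n. \<epsilon> (?k n)" "\<lambda>n. y (?k n)" u0 R M
  proof unfold_locales
    show "(\<lambda>n. \<epsilon> (?k n)) \<longlonglongrightarrow> 0" using LIMSEQ_subseq_LIMSEQ[OF \<epsilon>_lim k] by (simp add: o_def)
    show "(\<lambda>n. y (?k n) 0) \<longlonglongrightarrow> u0" using LIMSEQ_subseq_LIMSEQ[OF y_init k] by (simp add: o_def)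
  qed (use \<epsilon>_pos flow y_bound diss_bound crit_discrete in auto)
  have "viscous_limit T E (\<lambda>n. \<epsilon> (?k n)) (\<lambda>n. y (?k n)) u0 R M F"
  proof unfold_locales
    show "mono F" by (rule s(3))
    show "continuous (at_right t) F" for t by (rule s(2))
    show "(\<lambda>n. k.D n t) \<longlonglongrightarrow> F t" if "isCont F t" for t
      using LIMSEQ_subseq_LIMSEQ[OF s(4)[OF that] r(1)] by (simp add: o_def k.D_def D_def)
    show "convergent (\<lambda>n. k.Y n t)" if "t \<in> \<rat>" for t using r(2)[of t] that by (simp add: k.Y_def Y_def)
    show "convergent (\<lambda>n. k.Y n t)" if "\<not> isCont F t" for t using r(2)[of t] that by (simp add: k.Y_def Y_def)
  qed
  then show ?thesis using k by (intro that)
qed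

end

theorem theorem1:
  fixes T :: real
    and E :: "real \<Rightarrow> 'a::euclidean_space \<Rightarrow> real"
    and \<epsilon> :: "nat \<Rightarrow> real"
    and x :: "nat \<Rightarrow> 'a"
    and u0 :: 'a
    and w :: "nat \<Rightarrow> real \<Rightarrow> 'a"
  assumes "T > 0"
    and "\<And>t u. t \<in> {0..T} \<Longrightarrow> 0 \<le> E t u"
    and "C1_energy T E"
    and "\<And>\<rho>. \<rho> > 0 \<Longrightarrow> bounded {u. (SUP t\<in>{0..T}. \<bar>E t u\<bar>) \<le> \<rho>}"
    and "\<exists>C1>0. \<exists>C2>0. \<forall>t\<in>{0..T}. \<forall>u. \<bar>time_deriv T E t u\<bar> \<le> C1 * E t u + C2"
    and "\<And>t. t \<in> {0..T} \<Longrightarrow> discrete (crit E t)"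
    and "\<And>n. \<epsilon> n > 0"
    and "\<epsilon> \<longlonglongrightarrow> 0"
    and "x \<longlonglongrightarrow> u0"
    and "\<And>n. viscous_solution T E (\<epsilon> n) (x n) (w n)"
  shows "\<exists>(k :: nat \<Rightarrow> nat) (u :: real \<Rightarrow> 'a).
           strict_mono k \<and>
           (\<forall>t\<in>{0..T}. (\<lambda>n. w (k n) t) \<longlonglongrightarrow> u t) \<and>
           weak_star_tendsto_Linf T (\<lambda>n. w (k n)) u \<and>
           (\<forall>p\<ge>1. tendsto_Lp p T (\<lambda>n. w (k n)) u) \<and>
           u 0 = u0 \<and>
           DV_solution T E u"
proof -
  interpret C1_energy_on T E by unfold_locales (use assms(1,3) in auto)
  obtain C1 C2 where C: "C1 > 0" "C2 > 0" "\<And>t u. t \<in> {0..T} \<Longrightarrow> \<bar>time_deriv T E t u\<bar> \<le> C1 * E t u + C2"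
    using assms(5) by blast
  have w0: "w n 0 = x n" for n using assms(10)[of n] by (simp add: viscous_solution_def)
  have flow: "(w n has_vector_derivative - (1 / \<epsilon> n) *\<^sub>R grad (E t) (w n t)) (at t within {0..T})" if "t \<in> {0..T}" for n t
    by (rule viscous_solution_has_vector_derivative[OF C1_energy_on_axioms assms(7,10) that])
  have init: "(\<lambda>n. w n 0) \<longlonglongrightarrow> u0" using assms(9) by (simp add: w0)
  obtain R M where RM: "\<And>n t. t \<in> {0..T} \<Longrightarrow> norm (w n t) \<le> R"
    "\<And>n. integral {0..T} (\<lambda>r. (norm (grad (E r) (w n r)))\<^sup>2 / \<epsilon> n) \<le> M"
    using viscous_bounds[OF assms(2,4) C assms(7) init flow] by blast
  interpret viscous_sequence T E \<epsilon> w u0 R M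
    by unfold_locales (use assms(6,7,8) flow init RM in auto)
  obtain k F where k: "strict_mono k" "viscous_limit T E (\<lambda>n. \<epsilon> (k n)) (\<lambda>n. w (k n)) u0 R M F"
    by (rule compactness)
  interpret l: viscous_limit T E "\<lambda>n. \<epsilon> (k n)" "\<lambda>n. w (k n)" u0 R M F by (rule k(2))
  \<comment> \<open>Pointwise convergence and the common bound \<open>R\<close> give the other modes
    of convergence.\<close>
  note conv = bounded_convergence_Lp[OF l.y_measurable l.u_measurable l.y_bound l.y_lim]
  show ?thesis
    using k(1) l.y_lim conv l.u_zero l.DV_solution_limit unfolding DV_solution_def by blast
qed

end
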